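(* Let $L(s)$, $s=(x,y)\in \mathbf{C}_\infty^\ast\times\mathbb{Z}_p$, be an $L$-series of arithmetic interest. Let $y\in\mathbb{Z}_p$ be fixed and let $\mathbf{K}_y$ be the extension of $\mathbf{K}$ generated by the zeroes in $x$ of $L(x,y)$. Then the maximal separable (over $\mathbf{K}$) subfield of $\mathbf{K}_y$ is independent of the choice of sign function $\mathrm{sgn}$ and of the choice of positive uniformizer $\pi$ used to define $L(s)$.
   Context: Basic rings. Let $r$ be a power of the prime $p$, $\mathcal{X}$ a smooth projective geometrically connected curve over $\mathbb{F}_r$, $\infty\in\mathcal{X}$ a closed point, $\mathbf{A}$ the ring of functions regular outside $\infty$, $\mathbf{k}$ its fraction field, $\mathbf{K}=\mathbf{k}_\infty$ the completion at $\infty$, $v_\infty$ the normalized valuation, $\mathbb{F}_\infty\subset\mathbf{K}$ the field of constants, and $\mathbf{C}_\infty$ the completion of a fixed algebraic closure $\overline{\mathbf{K}}$ of $\mathbf{K}$. Exponentiation of ideals. A sign function is a homomorphism $\mathrm{sgn}\colon\mathbf{K}^\ast\to\mathbb{F}_\infty^\ast$ which is the identity on $\mathbb{F}_\infty^\ast$; $\alpha\in \mathbf{K}^\ast$ is positive if $\mathrm{sgn}(\alpha)=1$. Fix $\mathrm{sgn}$ and a positive uniformizer $\pi\in\mathbf{K}$. For positive $\alpha$ write $\alpha=\pi^{v_\infty(\alpha)}\langle\alpha\rangle$, with $\langle\alpha\rangle$ in the group $U_1$ of $1$-units of $\mathbf{K}$. Let $\mathcal{I}$ be the group of fractional ideals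 of $\mathbf{A}$ and $\mathcal{P}^+$ the finite-index subgroup of principal ideals having a positive generator. Set $\langle(\mathfrak{i})\rangle:=\langle\mathfrak{i}\rangle$ for $\mathfrak{i}$ positive; since the group $\hat U_1$ of $1$-units of $\mathbf{C}_\infty$ is uniquely divisible, this extends uniquely to a homomorphism $\langle\ \rangle\colon\mathcal{I}\to\hat U_1$. For $y\in\mathbb{Z}_p$ put $\langle\mathfrak{I}\rangle^y=\sum_{j\ge0}\binom{y}{j}(\langle\mathfrak{I}\rangle-1)^j$, and for $s=(x,y)\in S_\infty:=\mathbf{C}_\infty^\ast\times\mathbb{Z}_p$ put $\mathfrak{I}^s:=x^{\deg\mathfrak{I}}\langle\mathfrak{I}\rangle^y$ (degree over $\mathbb{F}_r$). The group $S_\infty$ is written additively, so $-s=(x^{-1},-y)$. $L$-series of arithmetic interest. Let $F$ be a finite extension of $\mathbf{k}$ (more precisely of the copy of $\mathbf{k}$ playing the role of scalars, identified with $\mathbf{k}$ through the canonical isomorphism) and $\mathcal{O}_F$ its ring of $\mathbf{A}$-integers. For a Drinfeld module $\psi$ over $F$ and for almost all primes $\mathfrak{P}$ of $\mathcal{O}_F$, put $P_\mathfrak{P}(u)=\det(1-uF_\mathfrak{P}\mid T_v(\psi^\mathfrak{P}))$, where $\psi^{\mathfrak{P}}$ is the good reduction, $F_\mathfrak{P}$ its Frobenius endomorphism and $T_v$ its $v$-adic Tate module for $v\in\mathrm{Spec}(\mathbf{A})$ prime to $\mathfrak{P}$; $P_{\mathfrak P}$ has coefficients in $\mathbf{A}$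 independent of $v$. The same is done for pure $T$-modules with multiplication by $\mathbf{A}$, and more generally for strictly compatible families of $v$-adic representations of $\mathrm{Gal}(F^{\mathrm{sep}}/F)$ (unramified outside finitely many primes and the primes above $v$, with $P_{\mathfrak P}(u)=\det(1-u\,\mathrm{Frob}_{\mathfrak P})$ independent of $v$ and having coefficients integral over $\mathbf{A}$ in a fixed finite extension of $\mathbf{k}$). The $L$-series is $L(s)=\prod_\mathfrak{P}P_\mathfrak{P}(N\mathfrak{P}^{-s})^{-1}$, $N\mathfrak{P}$ being the ideal norm to $\mathbf{A}$; it converges on a half-plane $|x|_\infty>c$. Such $L(s)$ are called of arithmetic interest. Expanding, $$L(x,y)=\sum_{j\ge0}x^{-j}\Big(\sum_{\deg N\mathfrak{I}=j}a_\mathfrak{I}\langle N\mathfrak{I}\rangle^{-y}\Big),$$ $\mathfrak{I}$ running over ideals of $\mathcal{O}_F$; the $a_\mathfrak{I}$ do not depend on $\mathrm{sgn}$ or $\pi$. For fixed $y$ this is viewed as a power series in $x^{-1}$, and its zeroes are its zeroes $x\in\mathbf{C}_\infty^\ast$ where it converges. There is a finite extension of $\mathbf{K}$ containing the coefficients of $L(x,y)$ for all $y$, and consequently all zeroes lie in $\overline{\mathbf{K}}$. If $L(x,y)$ is a non-zero constant then $\mathbf{K}_y:=\mathbf{K}$. *)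

theory Defs
  imports
    "HOL-Analysis.Elementary_Metric_Spaces"
    "HOL-Computational_Algebra.Computational_Algebra"
    "HOL-Algebra.Algebraic_Closure_Type"
    "HOL-Algebra.Generated_Fields"
    "HOL-Algebra.Ideal_Product"
    "Jordan_Normal_Form.Determinant"
begin

section \<open>Subrings of a field type\<close>

abbreviation RT :: "'a::field ring" where
  "RT \<equiv> ring_of_type_algebra"

abbreviation ring_on :: "'a::field set \<Rightarrow> 'a ring" where
  "ring_on S \<equiv> RT\<lparr>carrier := S\<rparr>"

definition finite_ext :: "'a::field set \<Rightarrow> 'a set \<Rightarrow> bool" where
  "finite_ext K E \<longleftrightarrow>
     subfield K RT \<and> subfield E RT \<and> K \<subseteq> E \<and> ring.finite_dimension RT K E"

definition integral_over :: "'a::field set \<Rightarrow> 'a \<Rightarrow> bool" where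
  "integral_over S x \<longleftrightarrow> (\<exists>p. lead_coeff p = 1 \<and> set (coeffs p) \<subseteq> S \<and> poly p x = 0)"

definition separable_poly :: "'a::field poly \<Rightarrow> bool" where
  "separable_poly p \<longleftrightarrow> coprime p (pderiv p)"

definition separable_over :: "'a::field set \<Rightarrow> 'a \<Rightarrow> bool" where
  "separable_over K x \<longleftrightarrow> (\<exists>p. set (coeffs p) \<subseteq> K \<and> separable_poly p \<and> poly p x = 0)"

text \<open>
  Separable elements form a subfield, so the union below is itself one of the fields
  occurring in it: it is the largest subfield of \<open>E\<close> that is separable over \<open>K\<close>.
\<close>
definition max_separable_subfield :: "'a::field set \<Rightarrow> 'a set \<Rightarrow> 'a set" where
  "max_separable_subfield K E =
     \<Union> {M. subfield M RT \<and> K \<subseteq> M \<and> M \<subseteq> E \<and> (\<forall>x\<in>M. separable_over K x)}"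

definition nonzero_primes :: "'a::field set \<Rightarrow> 'a set set" where
  "nonzero_primes S = {P. primeideal P (ring_on S) \<and> P \<noteq> {0}}"

definition nonarch_abs :: "'a::field set \<Rightarrow> ('a \<Rightarrow> real) \<Rightarrow> bool" where
  "nonarch_abs L nv \<longleftrightarrow>
     (\<forall>x\<in>L. nv x \<ge> 0 \<and> (nv x = 0 \<longleftrightarrow> x = 0)) \<and>
     (\<forall>x\<in>L. \<forall>y\<in>L. nv (x * y) = nv x * nv y \<and> nv (x + y) \<le> max (nv x) (nv y))"

section \<open>The curve, the place at infinity and the basic rings\<close>

text \<open>
  All of \<open>\<F>\<^sub>r \<subseteq> A \<subseteq> k \<subseteq> K \<subseteq> C\<^sub>\<infinity>\<close> live inside one field type \<open>'c\<close>, which is \<open>C\<^sub>\<infinity>\<close> itself; its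
  metric is the one of the absolute value at infinity.

  A smooth projective geometrically connected curve over the finite (hence perfect) field
  \<open>\<F>\<^sub>r\<close> is given by its function field \<open>k\<close>, a field of transcendence degree one, finitely
  generated over \<open>\<F>\<^sub>r\<close>, in which \<open>\<F>\<^sub>r\<close> is algebraically closed. Its closed points are the
  valuation rings of \<open>k\<close> over \<open>\<F>\<^sub>r\<close> (their local rings) other than \<open>k\<close>.
\<close>

definition function_field :: "'a::field set \<Rightarrow> 'a set \<Rightarrow> bool" where
  "function_field Fr k \<longleftrightarrow>
     subfield Fr RT \<and> finite Fr \<and> subfield k RT \<and> Fr \<subseteq> k \<and>
     (\<exists>t\<in>k. ring.transcendental RT Fr t \<and> finite_ext (generate_field RT (insert t Fr)) k) \<and>
     (\<forall>x\<in>k - Fr. ring.transcendental RT Fr x)"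

definition closed_points :: "'a::field set \<Rightarrow> 'a set \<Rightarrow> 'a set set" where
  "closed_points Fr k =
     {R. subring R RT \<and> Fr \<subseteq> R \<and> R \<subset> k \<and> (\<forall>x\<in>k. x \<in> R \<or> inverse x \<in> R)}"

abbreviation abs_inf :: "'c::{field, metric_space} \<Rightarrow> real" where
  "abs_inf x \<equiv> dist x 0"

text \<open>The point at infinity, as the local ring of the curve at it.\<close>
definition point_inf :: "'c::{field, metric_space} set \<Rightarrow> 'c set" where
  "point_inf k = {x \<in> k. abs_inf x \<le> 1}"

definition ring_A :: "'c::{field, metric_space} set \<Rightarrow> 'c set \<Rightarrow> 'c set" where
  "ring_A Fr k = {x \<in> k. \<forall>R \<in> closed_points Fr k - {point_inf k}. x \<in> R}"

definition field_K :: "'c::{field, metric_space} set \<Rightarrow> 'c set" where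
  "field_K k = closure k"

definition const_inf :: "'c::{field, metric_space} set \<Rightarrow> 'c set \<Rightarrow> 'c set" where
  "const_inf Fr k = {x \<in> field_K k. \<not> ring.transcendental RT Fr x}"

text \<open>
  The absolute value is normalized by \<open>\<bar>x\<bar> = q\<^sup>-\<^sup>v\<^sup>(\<^sup>x\<^sup>)\<close> on \<open>K\<close>, where \<open>q\<close> is the number of elements
  of the field of constants of \<open>K\<close> and \<open>v\<close> is the normalized (surjective) valuation.
  The last two conditions say, together with the class \<open>complete_space\<close>, that \<open>'c\<close> is the
  completion of an algebraic closure of \<open>K\<close>.
\<close>
locale infinite_place =
  fixes Fr k :: "'c::{alg_closed_field, complete_space} set"
  assumes function_field: "function_field Fr k"
    and nonarch_abs: "nonarch_abs UNIV (abs_inf :: 'c \<Rightarrow> real)"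
    and dist_abs: "\<And>x y :: 'c. dist x y = abs_inf (x - y)"
    and point_inf: "point_inf k \<in> closed_points Fr k"
    and abs_normalized:
      "abs_inf ` (field_K k - {0}) = range (\<lambda>n::int. real (card (const_inf Fr k)) powi n)"
    and algebraic_dense: "closure {x. \<not> ring.transcendental RT (field_K k) x} = UNIV"

definition v_inf :: "'c::{field, metric_space} set \<Rightarrow> 'c set \<Rightarrow> 'c \<Rightarrow> int" where
  "v_inf Fr k x = (THE n. abs_inf x = real (card (const_inf Fr k)) powi (- n))"

section \<open>Ideals and their exponentiation\<close>

definition frac_ideal :: "'a::field set \<Rightarrow> 'a set \<Rightarrow> bool" where
  "frac_ideal A J \<longleftrightarrow>
     additive_subgroup J RT \<and> J \<noteq> {0} \<and> (\<forall>a\<in>A. \<forall>x\<in>J. a * x \<in> J) \<and>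
     (\<exists>d\<in>A - {0}. (\<lambda>x. d * x) ` J \<subseteq> A)"

definition frac_ideals :: "'a::field set \<Rightarrow> 'a set monoid" where
  "frac_ideals A = \<lparr>carrier = {J. frac_ideal A J}, monoid.mult = ideal_prod RT, one = A\<rparr>"

definition one_units :: "'c::{field, metric_space} monoid" where
  "one_units = \<lparr>carrier = {u. dist u 1 < 1}, monoid.mult = (*), one = 1\<rparr>"

definition sign_function :: "'c::{field, metric_space} set \<Rightarrow> 'c set \<Rightarrow> ('c \<Rightarrow> 'c) \<Rightarrow> bool" where
  "sign_function Fr k sg \<longleftrightarrow>
     sg \<in> hom (mult_of (ring_on (field_K k))) (mult_of (ring_on (const_inf Fr k))) \<and>
     (\<forall>c \<in> const_inf Fr k - {0}. sg c = c)"

definition positive :: "'c::{field, metric_space} set \<Rightarrow> ('c \<Rightarrow> 'c) \<Rightarrow> 'c \<Rightarrow> bool" where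
  "positive k sg x \<longleftrightarrow> x \<in> field_K k - {0} \<and> sg x = 1"

definition positive_uniformizer ::
  "'c::{field, metric_space} set \<Rightarrow> 'c set \<Rightarrow> ('c \<Rightarrow> 'c) \<Rightarrow> 'c \<Rightarrow> bool" where
  "positive_uniformizer Fr k sg \<pi> \<longleftrightarrow> positive k sg \<pi> \<and> v_inf Fr k \<pi> = 1"

definition one_unit_part :: "'c::{field, metric_space} set \<Rightarrow> 'c set \<Rightarrow> 'c \<Rightarrow> 'c \<Rightarrow> 'c" where
  "one_unit_part Fr k \<pi> x = x / \<pi> powi v_inf Fr k x"

text \<open>
  \<open>br\<close> is the homomorphism from the fractional ideals to the one-units of \<open>C\<^sub>\<infinity>\<close> that extends
  the one-unit part of positive generators. It exists and is unique on fractional ideals,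
  because the principal ideals with a positive generator have finite index and the group of
  one-units is uniquely divisible.
\<close>
definition ideal_bracket ::
  "'c::{field, metric_space} set \<Rightarrow> 'c set \<Rightarrow> ('c \<Rightarrow> 'c) \<Rightarrow> 'c \<Rightarrow> ('c set \<Rightarrow> 'c) \<Rightarrow> bool" where
  "ideal_bracket Fr k sg \<pi> br \<longleftrightarrow>
     br \<in> hom (frac_ideals (ring_A Fr k)) one_units \<and>
     (\<forall>\<alpha>\<in>k. positive k sg \<alpha> \<longrightarrow> br ((\<lambda>a. \<alpha> * a) ` ring_A Fr k) = one_unit_part Fr k \<pi> \<alpha>)"

text \<open>
  The degree over \<open>\<F>\<^sub>r\<close> of a nonzero ideal of \<open>A\<close>: the \<open>\<F>\<^sub>r\<close>-dimension of the finite ring \<open>A/I\<close>.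
\<close>
definition ideal_deg :: "'c::{field, metric_space} set \<Rightarrow> 'c set \<Rightarrow> 'c set \<Rightarrow> nat" where
  "ideal_deg Fr k I = (THE d. card (carrier (ring_on (ring_A Fr k) Quot I)) = card Fr ^ d)"

text \<open>A \<open>p\<close>-adic integer, as the sequence of its residues modulo \<open>p\<^sup>n\<close>.\<close>
definition padic_int :: "nat \<Rightarrow> (nat \<Rightarrow> nat) \<Rightarrow> bool" where
  "padic_int p y \<longleftrightarrow> (\<forall>n. y n < p ^ n \<and> y (Suc n) mod p ^ n = y n)"

definition padic_uminus :: "nat \<Rightarrow> (nat \<Rightarrow> nat) \<Rightarrow> nat \<Rightarrow> nat" where
  "padic_uminus p y n = (p ^ n - y n) mod p ^ n"

text \<open>
  The binomial polynomials are continuous on \<open>\<int>\<^sub>p\<close>, so the integers \<open>y n choose j\<close> converge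
  \<open>p\<close>-adically to the binomial coefficient of \<open>y\<close>; their images in characteristic \<open>p\<close> are
  eventually constant, equal to its reduction modulo \<open>p\<close>.
\<close>
definition padic_binom :: "(nat \<Rightarrow> nat) \<Rightarrow> nat \<Rightarrow> 'c::{field, metric_space}" where
  "padic_binom y j = lim (\<lambda>n. of_nat (y n choose j))"

definition unit_powp :: "'c::{field, metric_space} \<Rightarrow> (nat \<Rightarrow> nat) \<Rightarrow> 'c" where
  "unit_powp u y = (\<Sum>j. padic_binom y j * (u - 1) ^ j)"

section \<open>Strictly compatible families of representations\<close>

text \<open>
  The type \<open>'f\<close> is a separable closure of \<open>F\<close>, and \<open>\<theta>\<close> is the canonical isomorphism of \<open>k\<close> onto
  its copy playing the role of scalars.
\<close>
locale scalar_extension = infinite_place Fr k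
  for Fr k :: "'c::{alg_closed_field, complete_space} set" +
  fixes \<theta> :: "'c \<Rightarrow> 'f::field" and F :: "'f set"
  assumes scalars: "\<theta> \<in> Ring.ring_hom (ring_on k) RT"
    and finite_ext: "finite_ext (\<theta> ` k) F"
    and separable: "\<And>x. separable_over F x"
    and separably_closed:
      "\<And>p. \<lbrakk>set (coeffs p) \<subseteq> F; separable_poly p; degree p > 0\<rbrakk> \<Longrightarrow> \<exists>x. poly p x = 0"

definition gal :: "'f::field set \<Rightarrow> ('f \<Rightarrow> 'f) set" where
  "gal F = {\<sigma>. bij \<sigma> \<and> \<sigma> \<in> Ring.ring_hom RT RT \<and> (\<forall>x\<in>F. \<sigma> x = x)}"

definition integers_of :: "'c::{field, metric_space} set \<Rightarrow> 'c set \<Rightarrow> ('c \<Rightarrow> 'f::field) \<Rightarrow> 'f set \<Rightarrow> 'f set"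
  where "integers_of Fr k \<theta> F = {x \<in> F. integral_over (\<theta> ` ring_A Fr k) x}"

abbreviation primes_of :: "'c::{field, metric_space} set \<Rightarrow> 'c set \<Rightarrow> ('c \<Rightarrow> 'f::field) \<Rightarrow> 'f set \<Rightarrow> 'f set set"
  where "primes_of Fr k \<theta> F \<equiv> nonzero_primes (integers_of Fr k \<theta> F)"

definition prime_below :: "'c::{field, metric_space} set \<Rightarrow> 'c set \<Rightarrow> ('c \<Rightarrow> 'f::field) \<Rightarrow> 'f set \<Rightarrow> 'c set"
  where "prime_below Fr k \<theta> P = {a \<in> ring_A Fr k. \<theta> a \<in> P}"

definition residue_card ::
  "'c::{field, metric_space} set \<Rightarrow> 'c set \<Rightarrow> ('c \<Rightarrow> 'f::field) \<Rightarrow> 'f set \<Rightarrow> 'f set \<Rightarrow> nat" where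
  "residue_card Fr k \<theta> F P = card (carrier (ring_on (integers_of Fr k \<theta> F) Quot P))"

definition residue_degree ::
  "'c::{field, metric_space} set \<Rightarrow> 'c set \<Rightarrow> ('c \<Rightarrow> 'f::field) \<Rightarrow> 'f set \<Rightarrow> 'f set \<Rightarrow> nat" where
  "residue_degree Fr k \<theta> F P =
     (THE f. residue_card Fr k \<theta> F P =
             card (carrier (ring_on (ring_A Fr k) Quot (prime_below Fr k \<theta> P))) ^ f)"

definition ideal_norm ::
  "'c::{field, metric_space} set \<Rightarrow> 'c set \<Rightarrow> ('c \<Rightarrow> 'f::field) \<Rightarrow> 'f set \<Rightarrow> 'f set \<Rightarrow> 'c set" where
  "ideal_norm Fr k \<theta> F P =
     prime_below Fr k \<theta> P [^]\<^bsub>frac_ideals (ring_A Fr k)\<^esub> residue_degree Fr k \<theta> F P"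

text \<open>Primes of the integral closure of \<open>A\<close> in the separable closure \<open>UNIV\<close> of \<open>F\<close>.\<close>
definition primes_above ::
  "'c::{field, metric_space} set \<Rightarrow> 'c set \<Rightarrow> ('c \<Rightarrow> 'f::field) \<Rightarrow> 'f set \<Rightarrow> 'f set \<Rightarrow> 'f set set" where
  "primes_above Fr k \<theta> F P = {Q \<in> primes_of Fr k \<theta> UNIV. Q \<inter> F = P}"

definition inertia ::
  "'c::{field, metric_space} set \<Rightarrow> 'c set \<Rightarrow> ('c \<Rightarrow> 'f::field) \<Rightarrow> 'f set \<Rightarrow> 'f set \<Rightarrow> ('f \<Rightarrow> 'f) set" where
  "inertia Fr k \<theta> F Q = {\<sigma> \<in> gal F. \<forall>x \<in> integers_of Fr k \<theta> UNIV. \<sigma> x - x \<in> Q}"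

text \<open>The (arithmetic) Frobenius elements of \<open>Q\<close> over \<open>P\<close>, a coset of the inertia group.\<close>
definition frobenius ::
  "'c::{field, metric_space} set \<Rightarrow> 'c set \<Rightarrow> ('c \<Rightarrow> 'f::field) \<Rightarrow> 'f set \<Rightarrow> 'f set \<Rightarrow> 'f set \<Rightarrow> ('f \<Rightarrow> 'f) set"
  where
  "frobenius Fr k \<theta> F P Q =
     {\<sigma> \<in> gal F. \<forall>x \<in> integers_of Fr k \<theta> UNIV. \<sigma> x - x ^ residue_card Fr k \<theta> F P \<in> Q}"

text \<open>
  \<open>L\<close> with absolute value \<open>nv\<close> is a finite extension of the completion \<open>k\<^sub>v\<close>, which is the closure
  of \<open>k\<close> in \<open>L\<close>. Only the abstract field \<open>L\<close> is placed inside \<open>C\<^sub>\<infinity>\<close>, which is no restriction because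
  \<open>C\<^sub>\<infinity>\<close> is algebraically closed of the transcendence degree of the continuum over \<open>k\<close>; its
  topology is that of \<open>nv\<close>.
\<close>
definition local_field ::
  "'c::{field, metric_space} set \<Rightarrow> 'c set \<Rightarrow> 'c set \<Rightarrow> 'c set \<Rightarrow> ('c \<Rightarrow> real) \<Rightarrow> bool" where
  "local_field Fr k v L nv \<longleftrightarrow>
     subfield L RT \<and> k \<subseteq> L \<and> nonarch_abs L nv \<and>
     (\<forall>a \<in> ring_A Fr k. nv a \<le> 1) \<and> v = {a \<in> ring_A Fr k. nv a < 1} \<and>
     (\<forall>s::nat \<Rightarrow> 'c. range s \<subseteq> L \<and> (\<forall>e>0. \<exists>N. \<forall>m\<ge>N. \<forall>n\<ge>N. nv (s m - s n) < e)
        \<longrightarrow> (\<exists>l\<in>L. (\<lambda>n. nv (s n - l)) \<longlonglongrightarrow> 0)) \<and>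
     finite_ext {x \<in> L. \<forall>e>0. \<exists>a\<in>k. nv (x - a) < e} L"

text \<open>
  A continuous representation on \<open>L\<^sup>n\<close>; the Galois group carries the Krull topology, whose
  basic open sets consist of the elements with prescribed values on a finite set.
\<close>
definition galois_rep ::
  "'f::field set \<Rightarrow> nat \<Rightarrow> 'c::field set \<Rightarrow> ('c \<Rightarrow> real) \<Rightarrow> (('f \<Rightarrow> 'f) \<Rightarrow> 'c mat) \<Rightarrow> bool" where
  "galois_rep F n L nv \<rho> \<longleftrightarrow>
     (\<forall>\<sigma>\<in>gal F. \<rho> \<sigma> \<in> carrier_mat n n \<and> elements_mat (\<rho> \<sigma>) \<subseteq> L) \<and>
     \<rho> id = 1\<^sub>m n \<and> (\<forall>\<sigma>\<in>gal F. \<forall>\<tau>\<in>gal F. \<rho> (\<sigma> \<circ> \<tau>) = \<rho> \<sigma> * \<rho> \<tau>) \<and>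
     (\<forall>\<sigma>\<in>gal F. \<forall>e>0. \<exists>B. finite B \<and>
        (\<forall>\<tau>\<in>gal F. (\<forall>x\<in>B. \<tau> x = \<sigma> x) \<longrightarrow>
           (\<forall>i<n. \<forall>j<n. nv (\<rho> \<tau> $$ (i, j) - \<rho> \<sigma> $$ (i, j)) < e)))"

text \<open>This is \<open>det (1 - u M)\<close>, with \<open>u = [:0, 1:]\<close>; \<open>char_poly M\<close> is \<open>det (u - M)\<close>.\<close>
definition rev_char_poly :: "'c::field mat \<Rightarrow> 'c poly" where
  "rev_char_poly M =
     det (1\<^sub>m (dim_row M) - [:0, 1:] \<cdot>\<^sub>m map_mat (\<lambda>a. [:a:]) M)"

text \<open>
  \<open>Pol P\<close> is the characteristic polynomial at \<open>P\<close>, and \<open>S\<close> the finite set of exceptional primes.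
  The maximal ideals \<open>v\<close> of \<open>A\<close> are its nonzero primes.
\<close>
definition strictly_compatible ::
  "'c::{field, metric_space} set \<Rightarrow> 'c set \<Rightarrow> ('c \<Rightarrow> 'f::field) \<Rightarrow> 'f set \<Rightarrow>
   'c set \<Rightarrow> nat \<Rightarrow> ('c set \<Rightarrow> 'c set) \<Rightarrow> ('c set \<Rightarrow> 'c \<Rightarrow> real) \<Rightarrow>
   ('c set \<Rightarrow> ('f \<Rightarrow> 'f) \<Rightarrow> 'c mat) \<Rightarrow> 'f set set \<Rightarrow> ('f set \<Rightarrow> 'c poly) \<Rightarrow> bool" where
  "strictly_compatible Fr k \<theta> F E n L nv \<rho> S Pol \<longleftrightarrow>
     finite_ext k E \<and> finite S \<and>
     (\<forall>v. maximalideal v (ring_on (ring_A Fr k)) \<longrightarrow>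
        local_field Fr k v (L v) (nv v) \<and> galois_rep F n (L v) (nv v) (\<rho> v) \<and>
        (\<forall>P \<in> primes_of Fr k \<theta> F - S. prime_below Fr k \<theta> P \<noteq> v \<longrightarrow>
           (\<forall>Q \<in> primes_above Fr k \<theta> F P.
              (\<forall>\<sigma> \<in> inertia Fr k \<theta> F Q. \<rho> v \<sigma> = 1\<^sub>m n) \<and>
              (\<forall>\<sigma> \<in> frobenius Fr k \<theta> F P Q. rev_char_poly (\<rho> v \<sigma>) = Pol P)))) \<and>
     (\<forall>P \<in> primes_of Fr k \<theta> F - S.
        set (coeffs (Pol P)) \<subseteq> {c \<in> E. integral_over (ring_A Fr k) c})"

section \<open>The L-series\<close>

text \<open>
  An L-series of arithmetic interest is given by its polynomials \<open>Pol P\<close> at the primes \<open>P\<close>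
  outside the finite set \<open>S\<close>. For a Drinfeld module or a pure T-module, reduction identifies its Tate module
  at \<open>v\<close> with that of the good reduction at any \<open>P\<close> prime to \<open>v\<close>, the Frobenius endomorphism
  of the reduction acting as the arithmetic Frobenius elements at \<open>P\<close>. The Tate modules thus
  form a strictly compatible family with the same polynomials.
\<close>
definition arithmetic_interest ::
  "'c::{field, metric_space} set \<Rightarrow> 'c set \<Rightarrow> ('c \<Rightarrow> 'f::field) \<Rightarrow> 'f set \<Rightarrow>
   'f set set \<Rightarrow> ('f set \<Rightarrow> 'c poly) \<Rightarrow> bool" where
  "arithmetic_interest Fr k \<theta> F S Pol \<longleftrightarrow>
     (\<exists>E n L nv \<rho>. strictly_compatible Fr k \<theta> F E n L nv \<rho> S Pol)"

text \<open>
  With \<open>X\<close> standing for \<open>x\<^sup>-\<^sup>1\<close>, the monomial below is \<open>N(P)\<^sup>-\<^sup>s\<close>, \<open>s = (x, y)\<close>; hence this is the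
  local factor of \<open>L(x, y)\<close> at \<open>P\<close> as a power series in \<open>x\<^sup>-\<^sup>1\<close>.
\<close>
definition euler_factor ::
  "'c::{field, metric_space} set \<Rightarrow> 'c set \<Rightarrow> ('c \<Rightarrow> 'f::field) \<Rightarrow> 'f set \<Rightarrow>
   ('f set \<Rightarrow> 'c poly) \<Rightarrow> ('c set \<Rightarrow> 'c) \<Rightarrow> (nat \<Rightarrow> nat) \<Rightarrow> 'f set \<Rightarrow> 'c fps" where
  "euler_factor Fr k \<theta> F Pol br y P =
     inverse (fps_of_poly (pcompose (Pol P)
       (monom (unit_powp (br (ideal_norm Fr k \<theta> F P)) (padic_uminus CHAR('c) y))
              (ideal_deg Fr k (ideal_norm Fr k \<theta> F P)))))"

text \<open>
  The Euler product \<open>L(x, y)\<close> as a power series in \<open>x\<^sup>-\<^sup>1\<close>: only the finitely many primes whose norm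
  has degree at most \<open>j\<close> contribute to the coefficient of \<open>x\<^sup>-\<^sup>j\<close>.
\<close>
definition L_fps ::
  "'c::{field, metric_space} set \<Rightarrow> 'c set \<Rightarrow> ('c \<Rightarrow> 'f::field) \<Rightarrow> 'f set \<Rightarrow>
   'f set set \<Rightarrow> ('f set \<Rightarrow> 'c poly) \<Rightarrow> ('c set \<Rightarrow> 'c) \<Rightarrow> (nat \<Rightarrow> nat) \<Rightarrow> 'c fps" where
  "L_fps Fr k \<theta> F S Pol br y = Abs_fps (\<lambda>j.
     fps_nth (\<Prod>P \<in> {P \<in> primes_of Fr k \<theta> F - S. ideal_deg Fr k (ideal_norm Fr k \<theta> F P) \<le> j}.
       euler_factor Fr k \<theta> F Pol br y P) j)"

text \<open>The zeroes in \<open>x\<close>, the series being one in \<open>x\<^sup>-\<^sup>1\<close>.\<close>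
definition zeroes :: "'c::{field, metric_space} fps \<Rightarrow> 'c set" where
  "zeroes f = {x. x \<noteq> 0 \<and> (\<lambda>j. fps_nth f j * inverse x ^ j) sums 0}"

definition zero_field ::
  "'c::{field, metric_space} set \<Rightarrow> 'c set \<Rightarrow> ('c \<Rightarrow> 'f::field) \<Rightarrow> 'f set \<Rightarrow>
   'f set set \<Rightarrow> ('f set \<Rightarrow> 'c poly) \<Rightarrow> ('c set \<Rightarrow> 'c) \<Rightarrow> (nat \<Rightarrow> nat) \<Rightarrow> 'c set" where
  "zero_field Fr k \<theta> F S Pol br y =
     generate_field RT (field_K k \<union> zeroes (L_fps Fr k \<theta> F S Pol br y))"

end

theory Submission
  imports Defs "HOL-Number_Theory.Residues"
begin

text \<open>
  Let \<open>(sg\<^sub>1, \<pi>\<^sub>1)\<close> and \<open>(sg\<^sub>2, \<pi>\<^sub>2)\<close> be two choices, with brackets \<open>br\<^sub>1\<close> and \<open>br\<^sub>2\<close>, and let \<open>q = r\<^sup>D\<close> be the number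
  of constants of \<open>K\<close>. If the power \<open>P\<^sup>n\<close> of a prime \<open>P\<close> of \<open>A\<close> is generated by \<open>\<alpha>\<close>, then \<open>\<alpha>\<^bsup>q-1\<^esup>\<close> is positive for
  both signs, and both values \<open>br\<^sub>i(P)\<^bsup>n(q-1)\<^esup>\<close> are known: their quotient is \<open>(\<pi>\<^sub>2/\<pi>\<^sub>1)\<^bsup>(q-1)v(\<alpha>)\<^esup>\<close>. By the product
  formula \<open>-D v(\<alpha>) = n deg P\<close>, and one-units have no torsion, so \<open>br\<^sub>1(P) = \<kappa>\<^bsup>deg P\<^esup> br\<^sub>2(P)\<close> for a one-unit \<open>\<kappa>\<close>
  with \<open>\<kappa>\<^bsup>D(q-1)\<^esup> = (\<pi>\<^sub>1/\<pi>\<^sub>2)\<^bsup>q-1\<^esup>\<close> that does not depend on \<open>P\<close> (\<open>brackets_differ_by_degree\<close>). The one-units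
  of the complete field \<open>K\<close> have roots of all orders prime to the characteristic \<open>p\<close> in \<open>K\<close>, so some \<open>p\<^sup>t\<close>-th power
  of \<open>\<kappa>\<close> lies in \<open>K\<close> (\<open>one_unit_root\<close>): \<open>\<kappa>\<close> is purely inseparable over \<open>K\<close>, and so is \<open>\<mu> = \<kappa>\<^bsup>-y\<^esup>\<close>.

  As power series in \<open>x\<^sup>-\<^sup>1\<close> the two L-series therefore differ by the substitution of \<open>\<mu>x\<^sup>-\<^sup>1\<close> for \<open>x\<^sup>-\<^sup>1\<close>, and the
  zeroes of the first are \<open>\<mu>\<close> times those of the second (\<open>zeroes_scaled\<close>). Hence the \<open>p\<^sup>t\<close>-th powers of the
  elements of the first zero field lie in the second one. An element that is separable over \<open>K\<close> and whose \<open>p\<^sup>t\<close>-th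
  power lies in a field containing \<open>K\<close> is itself in that field (\<open>separable_and_purely_inseparable_imp_in\<close>), so the
  separable parts of the two fields contain each other.

  The arithmetic of \<open>A\<close> used here, namely that a power of \<open>P\<close> is principal and the product formula in the form
  \<open>card (A/\<alpha>A) = \<bar>\<alpha>\<bar>\<close>, comes from the position of \<open>A\<close> in \<open>K\<close>. It is discrete: by Chevalley's extension theorem a
  non-constant element of \<open>A\<close> is large at infinity, since it must have a pole somewhere
  (\<open>exists_valuation_ring\<close>, \<open>abs_A_nonconstant\<close>). It is cocompact: every leading term of sufficiently large degree
  is attained by an element of \<open>A\<close> (\<open>A_cofinite\<close>). Counting the elements of bounded absolute value then gives the
  product formula (\<open>index_principal\<close>) and, by Minkowski's pigeonhole argument, the finiteness of the number of ideal
  classes (\<open>finitely_many_ideal_classes\<close>). Two powers of an ideal in one class are turned into a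
  principal power by Nakayama's lemma, \<open>A\<close> being integrally closed (\<open>ideal_power_principal\<close>).
\<close>

section \<open>Subrings and subfields of a field type\<close>

lemma RT_simps [simp]:
  "carrier (RT :: 'a::field ring) = UNIV" "x \<otimes>\<^bsub>RT\<^esub> y = x * (y :: 'a)" "\<one>\<^bsub>RT\<^esub> = (1 :: 'a)"
  "\<zero>\<^bsub>RT\<^esub> = (0 :: 'a)" "x \<oplus>\<^bsub>RT\<^esub> y = x + (y :: 'a)"
  by (simp_all add: ring_of_type_algebra_def)

lemma field_RT: "field (RT :: 'a::field ring)"
  by (rule field_from_type_algebra)

interpretation RT: domain "RT :: 'a::field ring"
  by (rule field.axioms(1)[OF field_RT])

lemma RT_a_inv [simp]: "\<ominus>\<^bsub>RT\<^esub> x = - (x :: 'a::field)"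
  using RT.minus_equality[of "- x" x] by simp

lemma RT_m_inv [simp]: "x \<noteq> 0 \<Longrightarrow> inv\<^bsub>RT\<^esub> x = inverse (x :: 'a::field)"
  using RT.comm_inv_char[of x "inverse x"] by simp

lemma subring_iff:
  "subring S (RT :: 'a::field ring) \<longleftrightarrow> 1 \<in> S \<and> (\<forall>x\<in>S. \<forall>y\<in>S. x - y \<in> S \<and> x * y \<in> S)"
proof
  assume "subring S (RT :: 'a ring)"
  note * = subringE[OF this]
  show "1 \<in> S \<and> (\<forall>x\<in>S. \<forall>y\<in>S. x - y \<in> S \<and> x * y \<in> S)"
    using *(3) *(6) *(7)[OF _ *(5)] by (metis RT_a_inv RT_simps(2,3,5) diff_conv_add_uminus)
next
  assume *: "1 \<in> S \<and> (\<forall>x\<in>S. \<forall>y\<in>S. x - y \<in> S \<and> x * y \<in> S)"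
  have neg: "- x \<in> S" if "x \<in> S" for x
    using * that by (metis diff_0 diff_self)
  show "subring S (RT :: 'a ring)"
    by (rule RT.subringI) (use * neg in \<open>auto, metis diff_minus_eq_add\<close>)
qed

lemma subfield_iff:
  "subfield K (RT :: 'a::field ring) \<longleftrightarrow> subring K RT \<and> (\<forall>x\<in>K. inverse x \<in> K)"
proof
  assume K: "subfield K (RT :: 'a ring)"
  have "inverse x \<in> K" if "x \<in> K" for x
  proof (cases "x = 0")
    case False
    then have "inv\<^bsub>RT\<^esub> x \<in> K"
      using RT.subfield_m_inv(1)[OF K] that by auto
    then show ?thesis using False by simp
  qed (use that in auto)
  then show "subring K RT \<and> (\<forall>x\<in>K. inverse x \<in> K)"
    using subfieldE(1)[OF K] by blast
next
  assume *: "subring K (RT :: 'a ring) \<and> (\<forall>x\<in>K. inverse x \<in> K)"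
  show "subfield K (RT :: 'a ring)"
    by (rule field.subfieldI'[OF field_RT]) (use * in auto)
qed

text \<open>The closure properties in terms of the operations of the type, so that automation can prove membership.\<close>
locale subring_of_type =
  fixes S :: "'a::field set"
  assumes subring: "subring S RT"
begin

lemma one_in [simp, intro]: "1 \<in> S"
  and diff_in [intro]: "x \<in> S \<Longrightarrow> y \<in> S \<Longrightarrow> x - y \<in> S"
  and mult_in [intro]: "x \<in> S \<Longrightarrow> y \<in> S \<Longrightarrow> x * y \<in> S"
  using subring by (auto simp: subring_iff)

lemma zero_in [simp, intro]: "0 \<in> S"
  using diff_in[of 1 1] by simp

lemma uminus_in [intro]: "x \<in> S \<Longrightarrow> - x \<in> S"
  using diff_in[of 0 x] by simp

lemma add_in [intro]: "x \<in> S \<Longrightarrow> y \<in> S \<Longrightarrow> x + y \<in> S"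
  using diff_in[of x "- y"] by auto

lemma power_in [intro]: "x \<in> S \<Longrightarrow> x ^ n \<in> S"
  by (induction n) auto

lemma sum_in [intro]: "(\<And>i. i \<in> I \<Longrightarrow> f i \<in> S) \<Longrightarrow> sum f I \<in> S"
  by (induction I rule: infinite_finite_induct) auto

lemma prod_in [intro]: "(\<And>i. i \<in> I \<Longrightarrow> f i \<in> S) \<Longrightarrow> prod f I \<in> S"
  by (induction I rule: infinite_finite_induct) auto

lemma of_nat_in [intro]: "of_nat n \<in> S"
  by (induction n) auto

end

locale subfield_of_type =
  fixes S :: "'a::field set"
  assumes subfield: "subfield S RT"
begin

sublocale subring_of_type S
  by (rule subring_of_type.intro) (use subfield in \<open>simp add: subfield_iff\<close>)

lemma inverse_in [intro]: "x \<in> S \<Longrightarrow> inverse x \<in> S"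
  using subfield by (simp add: subfield_iff)

lemma divide_in [intro]: "x \<in> S \<Longrightarrow> y \<in> S \<Longrightarrow> x / y \<in> S"
  by (auto simp: divide_inverse)

end

section \<open>Polynomials with coefficients in a subring\<close>

definition polys :: "'a::zero set \<Rightarrow> 'a poly set" where
  "polys S = {p. \<forall>i. coeff p i \<in> S}"

lemma polysD: "p \<in> polys S \<Longrightarrow> coeff p i \<in> S"
  by (simp add: polys_def)

lemma polys_mono: "S \<subseteq> T \<Longrightarrow> polys S \<subseteq> polys T"
  by (auto simp: polys_def)

lemma polys_pConsD:
  assumes "pCons c p \<in> polys S"
  shows "c \<in> S" "p \<in> polys S"
  using polysD[OF assms, of 0] polysD[OF assms, of "Suc i" for i] by (simp_all add: polys_def)

lemma polys_iff_coeffs: "0 \<in> S \<Longrightarrow> p \<in> polys S \<longleftrightarrow> set (coeffs p) \<subseteq> S"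
  using range_coeff[of p] by (simp add: polys_def image_subset_iff[of "coeff p" UNIV, simplified, symmetric])

context subring_of_type
begin

lemma polys_0 [simp, intro]: "0 \<in> polys S"
  and polys_1 [simp, intro]: "1 \<in> polys S"
  and polys_const [intro]: "c \<in> S \<Longrightarrow> [:c:] \<in> polys S"
  by (auto simp: polys_def coeff_pCons split: nat.splits)

lemma polys_pCons [intro]: "c \<in> S \<Longrightarrow> p \<in> polys S \<Longrightarrow> pCons c p \<in> polys S"
  by (auto simp: polys_def coeff_pCons split: nat.splits)

lemma polys_add [intro]: "p \<in> polys S \<Longrightarrow> q \<in> polys S \<Longrightarrow> p + q \<in> polys S"
  and polys_diff [intro]: "p \<in> polys S \<Longrightarrow> q \<in> polys S \<Longrightarrow> p - q \<in> polys S"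
  and polys_uminus [intro]: "p \<in> polys S \<Longrightarrow> - p \<in> polys S"
  and polys_smult [intro]: "c \<in> S \<Longrightarrow> p \<in> polys S \<Longrightarrow> smult c p \<in> polys S"
  and polys_monom [intro]: "c \<in> S \<Longrightarrow> monom c n \<in> polys S"
  by (auto simp: polys_def)

lemma polys_mult [intro]: "p \<in> polys S \<Longrightarrow> q \<in> polys S \<Longrightarrow> p * q \<in> polys S"
  by (auto simp: polys_def coeff_mult)

lemma poly_in: "p \<in> polys S \<Longrightarrow> x \<in> S \<Longrightarrow> poly p x \<in> S"
  by (auto simp: poly_altdef polys_def)

text \<open>Long division only divides by the leading coefficient 1, so it never leaves the subring.\<close>
lemma polys_divide_monic:
  assumes "p \<in> polys S" "m \<in> polys S" "lead_coeff m = 1"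
  shows "\<exists>g\<in>polys S. \<exists>r\<in>polys S. p = m * g + r \<and> (r = 0 \<or> degree r < degree m)"
  using assms(1)
proof (induction "degree p" arbitrary: p rule: less_induct)
  case less
  show ?case
  proof (cases "p = 0 \<or> degree p < degree m")
    case True
    then show ?thesis using less.prems by (intro bexI[of _ 0] bexI[of _ p]) auto
  next
    case False
    then have p: "p \<noteq> 0" and deg: "degree m \<le> degree p" by auto
    define g where "g = monom (lead_coeff p) (degree p - degree m)"
    define p' where "p' = p - m * g"
    have g: "g \<in> polys S" and p': "p' \<in> polys S"
      using less.prems assms(2) unfolding g_def p'_def by (auto dest: polysD)
    have m: "m \<noteq> 0" using assms(3) by auto
    have dg: "degree (m * g) = degree p" and lg: "lead_coeff (m * g) = lead_coeff p"
      using p m deg assms(3) lead_coeff_mult[of m g]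
      by (simp_all add: g_def degree_mult_eq degree_monom_eq)
    have "coeff p' (degree p) = 0"
      using dg lg by (simp add: p'_def)
    moreover have "degree p' \<le> degree p"
      unfolding p'_def using dg by (metis degree_diff_le order_refl)
    ultimately have "p' = 0 \<or> degree p' < degree p"
      by (metis le_neq_implies_less leading_coeff_0_iff)
    then show ?thesis
    proof
      assume "p' = 0"
      then show ?thesis using g by (intro bexI[of _ g] bexI[of _ 0]) (auto simp: p'_def)
    next
      assume "degree p' < degree p"
      from less.hyps[OF this p'] obtain g' r where *: "g' \<in> polys S" "r \<in> polys S"
        "p' = m * g' + r" "r = 0 \<or> degree r < degree m" by blast
      then have "p = m * (g + g') + r" by (simp add: p'_def algebra_simps)
      then show ?thesis using * g by (intro bexI[of _ "g + g'"] bexI[of _ r]) auto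
    qed
  qed
qed

end

section \<open>Algebraic elements\<close>

text \<open>Over a subring this negates \<open>RT.transcendental\<close>, with polynomials as a type instead of coefficient lists.\<close>
definition algebraic_over :: "'a::field set \<Rightarrow> 'a \<Rightarrow> bool" where
  "algebraic_over S x \<longleftrightarrow> (\<exists>p\<in>polys S. p \<noteq> 0 \<and> poly p x = 0)"

lemma algebraic_over_mono: "S \<subseteq> T \<Longrightarrow> algebraic_over S x \<Longrightarrow> algebraic_over T x"
  using polys_mono unfolding algebraic_over_def by blast

lemma RT_eval_rev: "RT.eval (rev cs) x = poly (Poly cs) (x :: 'a::field)"
proof (induction cs)
  case (Cons c cs)
  then show ?case using RT.eval_append_aux[of "rev cs" c x] by (simp add: mult.commute)
qed simp

lemma RT_eval_rev_coeffs: "RT.eval (rev (coeffs p)) x = poly p (x :: 'a::field)"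
  by (simp add: RT_eval_rev)

lemma algebraic_iff:
  assumes "subring S (RT :: 'a::field ring)"
  shows "RT.algebraic S x \<longleftrightarrow> algebraic_over S x"
proof -
  interpret subring_of_type S by (rule subring_of_type.intro) fact
  show ?thesis
  proof
    assume "RT.algebraic S x"
    then have "(RT.algebraic over S) x" by (simp add: over_def)
    then obtain l where l: "l \<in> carrier (S [X]\<^bsub>RT\<^esub>)" "l \<noteq> []" "RT.eval l x = 0"
      by (rule RT.algebraicE[OF assms, rotated]) auto
    then have l': "set l \<subseteq> S" "hd l \<noteq> 0"
      by (auto simp: univ_poly_carrier[symmetric] polynomial_def)
    define p where "p = Poly (rev l)"
    have cp: "coeffs p = rev l"
      using l l' by (simp add: p_def strip_while_def dropWhile_eq_self_iff)
    then have "p \<noteq> 0" "p \<in> polys S" "poly p x = 0"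
      using l l' RT_eval_rev_coeffs[of p x] by (auto simp: polys_iff_coeffs)
    then show "algebraic_over S x" by (auto simp: algebraic_over_def)
  next
    assume "algebraic_over S x"
    then obtain p where p: "p \<in> polys S" "p \<noteq> 0" "poly p x = 0" by (auto simp: algebraic_over_def)
    have "(RT.algebraic over S) x"
      by (rule RT.algebraicI[of "rev (coeffs p)"])
         (use p in \<open>auto simp: RT_eval_rev_coeffs univ_poly_carrier[symmetric] polynomial_def
            polys_iff_coeffs hd_rev last_coeffs_eq_coeff_degree\<close>)
    then show "RT.algebraic S x" by (simp add: over_def)
  qed
qed

section \<open>Separable and purely inseparable elements\<close>

context subfield_of_type
begin

text \<open>
  A monic \<open>m\<close> of least degree with root \<open>x\<close> divides every other such polynomial, because the remainder also has
  the root \<open>x\<close>.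
\<close>
lemma minimal_polynomial:
  assumes "algebraic_over S x"
  shows "\<exists>m\<in>polys S. lead_coeff m = 1 \<and> poly m x = 0 \<and> (\<forall>p\<in>polys S. poly p x = 0 \<longrightarrow> m dvd p)"
proof -
  define Q where "Q = (\<lambda>n. \<exists>m\<in>polys S. lead_coeff m = 1 \<and> poly m x = 0 \<and> degree m = n)"
  have monic: "\<exists>n\<le>degree p. Q n" if "p \<in> polys S" "p \<noteq> 0" "poly p x = 0" for p
  proof -
    have "smult (inverse (lead_coeff p)) p \<in> polys S"
      using that by (auto dest: polysD)
    then show ?thesis
      unfolding Q_def using that
      by (intro exI[of _ "degree p"] conjI bexI[of _ "smult (inverse (lead_coeff p)) p"]) auto
  qed
  define n where "n = (LEAST n. Q n)"
  have "\<exists>n. Q n" using assms monic by (auto simp: algebraic_over_def)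
  then have "Q n" unfolding n_def by (rule LeastI_ex)
  then obtain m where m: "m \<in> polys S" "lead_coeff m = 1" "poly m x = 0" "degree m = n"
    by (auto simp: Q_def)
  have "m dvd p" if p: "p \<in> polys S" "poly p x = 0" for p
  proof -
    obtain g r where gr: "g \<in> polys S" "r \<in> polys S" "p = m * g + r" "r = 0 \<or> degree r < degree m"
      using polys_divide_monic[OF p(1) m(1,2)] by blast
    have "poly r x = 0" using gr(3) p(2) m(3) by simp
    have "r = 0"
    proof (rule ccontr)
      assume "r \<noteq> 0"
      then obtain i where "i \<le> degree r" "Q i"
        using monic[OF gr(2)] \<open>poly r x = 0\<close> by blast
      moreover have "n \<le> i" unfolding n_def using \<open>Q i\<close> by (rule Least_le)
      ultimately show False using gr(4) m(4) \<open>r \<noteq> 0\<close> by auto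
    qed
    then show ?thesis using gr(3) by simp
  qed
  then show ?thesis using m by blast
qed

end

text \<open>
  The minimal polynomial of \<open>x\<close> over \<open>E\<close> divides \<open>X\<^sup>Q - x\<^sup>Q = (X - x)\<^sup>Q\<close> with \<open>Q = p\<^sup>t\<close>, so \<open>x\<close> is its only root. It
  also divides a separable polynomial, so this root is simple and the minimal polynomial is \<open>X - x\<close>.
\<close>
lemma separable_and_purely_inseparable_imp_in:
  fixes x :: "'a::alg_closed_field"
  assumes "subfield E RT" "separable_over E x" "prime CHAR('a)" "x ^ (CHAR('a) ^ t) \<in> E"
  shows "x \<in> E"
proof -
  interpret E: subfield_of_type E by (rule subfield_of_type.intro) fact
  obtain f where f: "set (coeffs f) \<subseteq> E" "coprime f (pderiv f)" "poly f x = 0"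
    using assms(2) by (auto simp: separable_over_def separable_poly_def)
  have fE: "f \<in> polys E" using f(1) by (simp add: polys_iff_coeffs)
  have f0: "f \<noteq> 0" using f(2) by auto
  obtain m where m: "m \<in> polys E" "lead_coeff m = 1" "poly m x = 0"
    and dvd: "\<And>p. p \<in> polys E \<Longrightarrow> poly p x = 0 \<Longrightarrow> m dvd p"
    using E.minimal_polynomial[of x] fE f0 f(3) by (auto simp: algebraic_over_def)
  define q where "q = CHAR('a) ^ t"
  have q: "q > 0" using assms(3) by (simp add: q_def prime_gt_0_nat)
  have "monom 1 q - [:x ^ q:] \<in> polys E" using assms(4) by (auto simp: q_def)
  then have m_dvd: "m dvd monom 1 q - [:x ^ q:]" by (rule dvd) (simp add: poly_monom)
  have roots: "y = x" if "poly m y = 0" for y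
  proof -
    have "y ^ q - x ^ q = 0"
      using m_dvd that by (auto elim!: dvdE simp: poly_monom dest!: arg_cong[of _ _ "\<lambda>p. poly p y"])
    moreover have "(y - x + x) ^ q = (y - x) ^ q + x ^ q"
      by (rule freshmans_dream'[OF assms(3) q_def])
    ultimately show ?thesis using q by simp
  qed
  have "[:- x, 1:] dvd m" using m(3) by (simp add: poly_eq_0_iff_dvd)
  then obtain h where h: "m = [:- x, 1:] * h" by (elim dvdE)
  have "degree h = 0"
  proof (rule ccontr)
    assume "degree h \<noteq> 0"
    then obtain y where y: "poly h y = 0"
      using alg_closed_imp_poly_has_root[of h] by auto
    then have "poly m y = 0" by (simp add: h)
    then have "poly h x = 0" using y roots by simp
    moreover obtain g where "f = m * g" using dvd[OF fE f(3)] by (elim dvdE)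
    moreover have "poly (pderiv m) x = poly h x"
      unfolding h pderiv_mult by (simp add: pderiv_pCons)
    ultimately have "poly (pderiv f) x = 0" using m(3) by (simp add: pderiv_mult)
    then have "[:- x, 1:] dvd pderiv f" "[:- x, 1:] dvd f"
      using f(3) by (simp_all add: poly_eq_0_iff_dvd)
    then have "is_unit [:- x, 1:]" using f(2) by (meson coprime_common_divisor)
    then show False by (simp add: is_unit_iff_degree)
  qed
  then obtain c where "h = [:c:]" by (elim degree_eq_zeroE)
  then have "c = 1" "coeff m 0 = - x * c" using m(2) by (auto simp: h split: if_splits)
  then have "- coeff m 0 = x" by simp
  then show ?thesis using m(1) by (metis E.uminus_in polysD)
qed

section \<open>Valuation rings\<close>

context subring_of_type
begin

definition adjoin :: "'a \<Rightarrow> 'a set" where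
  "adjoin x = (\<lambda>p. poly p x) ` polys S"

lemma subring_adjoin: "subring (adjoin x) RT"
  unfolding subring_iff adjoin_def
proof (intro conjI ballI)
  show "1 \<in> (\<lambda>p. poly p x) ` polys S" by (rule image_eqI[of _ _ 1]) auto
next
  fix u v assume "u \<in> (\<lambda>p. poly p x) ` polys S" "v \<in> (\<lambda>p. poly p x) ` polys S"
  then obtain p q where "p \<in> polys S" "q \<in> polys S" "u = poly p x" "v = poly q x" by blast
  then show "u - v \<in> (\<lambda>p. poly p x) ` polys S" "u * v \<in> (\<lambda>p. poly p x) ` polys S"
    by (auto intro: image_eqI[of _ _ "p - q"] image_eqI[of _ _ "p * q"])
qed

lemma adjoin_superset: "S \<subseteq> adjoin x"
proof
  fix c assume "c \<in> S"
  then show "c \<in> adjoin x" unfolding adjoin_def by (intro image_eqI[of _ _ "[:c:]"]) auto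
qed

lemma adjoin_generator: "x \<in> adjoin x"
  unfolding adjoin_def by (intro image_eqI[of _ _ "[:0, 1:]"]) auto

lemma adjoin_minimal:
  assumes "subring R RT" "S \<subseteq> R" "x \<in> R"
  shows "adjoin x \<subseteq> R"
proof -
  interpret R: subring_of_type R by (rule subring_of_type.intro) fact
  show ?thesis unfolding adjoin_def using polys_mono[OF assms(2)] assms(3) R.poly_in by auto
qed

lemma integral_over_iff: "integral_over S x \<longleftrightarrow> (\<exists>p\<in>polys S. lead_coeff p = 1 \<and> poly p x = 0)"
  by (auto simp: integral_over_def polys_iff_coeffs)

text \<open>An equation \<open>x = c\<^sub>0 + c\<^sub>1 x\<^sup>-\<^sup>1 + \<dots> + c\<^sub>n x\<^sup>-\<^sup>n\<close> is an integral equation after multiplication by \<open>x\<^sup>n\<close>.\<close>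

lemma integral_if_in_adjoin_inverse:
  assumes "x \<in> adjoin (inverse x)"
  shows "integral_over S x"
proof (cases "x = 0")
  case True
  then show ?thesis unfolding integral_over_iff by (intro bexI[of _ "[:0, 1:]"]) auto
next
  case False
  obtain p where p: "p \<in> polys S" "x = poly p (inverse x)" using assms by (auto simp: adjoin_def)
  define n where "n = degree p"
  define g where "g = (\<Sum>i\<le>n. monom (coeff p i) (n - i))"
  have g: "g \<in> polys S"
    unfolding g_def polys_def using p(1) by (auto simp: coeff_sum polys_def)
  have dg: "degree g \<le> n"
    unfolding g_def by (intro degree_sum_le) (auto intro: order_trans[OF degree_monom_le])
  have "poly g x = (\<Sum>i\<le>n. coeff p i * x ^ (n - i))"
    by (simp add: g_def poly_sum poly_monom)
  also have "\<dots> = (\<Sum>i\<le>n. x ^ n * (coeff p i * inverse x ^ i))"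
    using False by (intro sum.cong) (auto simp: power_diff field_simps)
  also have "\<dots> = x ^ n * poly p (inverse x)"
    by (simp add: poly_altdef n_def sum_distrib_left)
  finally have "poly g x = x ^ n * x" using p(2) by simp
  moreover have "coeff (monom 1 (Suc n) - g) (Suc n) = 1"
    using dg by (simp add: coeff_eq_0)
  moreover have "degree (monom (1 :: 'a) (Suc n) - g) = Suc n"
  proof (rule antisym)
    show "degree (monom (1 :: 'a) (Suc n) - g) \<le> Suc n"
      using dg by (intro degree_diff_le) (auto intro: degree_monom_le)
    show "Suc n \<le> degree (monom (1 :: 'a) (Suc n) - g)"
      using dg by (intro le_degree) (simp add: coeff_eq_0)
  qed
  ultimately show ?thesis
    unfolding integral_over_iff using g
    by (intro bexI[of _ "monom 1 (Suc n) - g"]) (auto simp: poly_monom)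
qed

text \<open>
  If \<open>x\<close> were not in the ring, its inverse would be, and the integral equation divided by \<open>x\<^bsup>n-1\<^esup>\<close> would express
  \<open>x\<close> as a polynomial in the inverse.
\<close>
lemma integral_in_valuation_ring:
  assumes "x \<in> S \<or> inverse x \<in> S" "integral_over S x"
  shows "x \<in> S"
proof (rule ccontr)
  assume x: "x \<notin> S"
  then have y: "inverse x \<in> S" and x0: "x \<noteq> 0" using assms(1) by auto
  obtain p where p: "p \<in> polys S" "lead_coeff p = 1" "poly p x = 0"
    using assms(2) by (auto simp: integral_over_iff)
  have "degree p \<noteq> 0" using p by (metis degree_eq_zeroE coeff_pCons_0 degree_pCons_0 poly_const_conv mult.right_neutral zero_neq_one)
  then obtain n where n: "degree p = Suc n" by (cases "degree p") auto
  have "0 = (\<Sum>i\<le>n. coeff p i * x ^ i) + x ^ Suc n"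
    using p by (simp add: poly_altdef n)
  then have "x ^ Suc n = - (\<Sum>i\<le>n. coeff p i * x ^ i)" by (simp add: eq_neg_iff_add_eq_0 add.commute)
  then have "x = - (\<Sum>i\<le>n. coeff p i * x ^ i) / x ^ n" using x0 by (simp add: field_simps)
  also have "\<dots> = - (\<Sum>i\<le>n. coeff p i * inverse x ^ (n - i))"
    using x0 by (simp add: sum_divide_distrib) (intro sum.cong, auto simp: power_diff field_simps)
  also have "\<dots> \<in> S" using p(1) y by (auto dest: polysD)
  finally show False using x by simp
qed

end

lemma (in subring_of_type) integral_over_mono: "S \<subseteq> T \<Longrightarrow> integral_over S x \<Longrightarrow> integral_over T x"
  by (auto simp: integral_over_def)

text \<open>
  A relation \<open>1 = w q(x\<^sup>-\<^sup>1)\<close> expresses \<open>x\<^sup>n\<close> by lower powers of \<open>x\<close>, since \<open>1 - w q\<^sub>0\<close> is a unit; substituting this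
  for the top power lowers the degree of a relation \<open>1 = w p(x)\<close>.
\<close>
lemma shorten_relation:
  fixes R :: "'a::field set"
  assumes "subring R RT" "w \<in> R"
    and units: "\<And>c. c \<in> R \<Longrightarrow> inverse (1 + w * c) \<in> R \<and> 1 + w * c \<noteq> 0"
    and p: "p \<in> polys R" "degree p \<le> n" "w * poly p x = 1"
    and q: "q \<in> polys R" "degree q \<le> m" "w * poly q (inverse x) = 1"
    and "m \<le> n" "0 < n" "x \<noteq> 0"
  shows "\<exists>p'\<in>polys R. degree p' \<le> n - 1 \<and> w * poly p' x = 1"
proof -
  interpret R: subring_of_type R by (rule subring_of_type.intro) fact
  define u where "u = 1 - w * coeff q 0"
  have u: "inverse u \<in> R" "u \<noteq> 0"
    using units[of "- coeff q 0"] polysD[OF q(1)] by (auto simp: u_def)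
  have "poly q (inverse x) = (\<Sum>j\<le>m. coeff q j * inverse x ^ j)"
    using q(2) by (subst poly_altdef, intro sum.mono_neutral_left) (auto simp: coeff_eq_0)
  also have "\<dots> = coeff q 0 + (\<Sum>j=1..m. coeff q j * inverse x ^ j)"
    by (simp add: atMost_atLeast0 sum.atLeast_Suc_atMost)
  finally have "u = w * (\<Sum>j=1..m. coeff q j * inverse x ^ j)"
    using q(3) by (simp add: u_def algebra_simps)
  then have "1 = inverse u * w * (\<Sum>j=1..m. coeff q j * inverse x ^ j)"
    using u(2) by (metis left_inverse mult.assoc)
  then have xn: "x ^ n = inverse u * w * (\<Sum>j=1..m. coeff q j * inverse x ^ j) * x ^ n" by simp
  define g where "g = (\<Sum>j=1..m. monom (inverse u * w * coeff q j) (n - j))"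
  have g: "g \<in> polys R"
    unfolding g_def polys_def using polysD[OF q(1)] u(1) assms(2) by (auto simp: coeff_sum intro!: R.sum_in R.mult_in)
  have dg: "degree g \<le> n - 1"
    unfolding g_def by (intro degree_sum_le) (auto intro!: order_trans[OF degree_monom_le])
  have "poly g x = (\<Sum>j=1..m. inverse u * w * coeff q j * x ^ (n - j))"
    by (simp add: g_def poly_sum poly_monom)
  also have "\<dots> = (\<Sum>j=1..m. inverse u * w * (coeff q j * inverse x ^ j) * x ^ n)"
    using \<open>m \<le> n\<close> \<open>x \<noteq> 0\<close> by (intro sum.cong) (auto simp: power_diff field_simps)
  also have "\<dots> = x ^ n"
    by (subst (2) xn) (simp add: sum_distrib_left sum_distrib_right)
  finally have gx: "poly g x = x ^ n" .
  define p' where "p' = p - monom (coeff p n) n + smult (coeff p n) g"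
  have "degree p' \<le> n - 1"
  proof (rule degree_le, intro allI impI)
    fix i assume i: "n - 1 < i"
    have "coeff g i = 0" using dg i by (intro coeff_eq_0) auto
    moreover have "coeff p i = 0" if "i \<noteq> n" using p(2) i that by (intro coeff_eq_0) auto
    ultimately show "coeff p' i = 0" by (auto simp: p'_def)
  qed
  moreover have "p' \<in> polys R" using p(1) g unfolding p'_def by (auto dest: polysD)
  moreover have "poly p' x = poly p x" by (simp add: p'_def poly_monom gx)
  ultimately show ?thesis using p(3) by auto
qed

text \<open>
  A case of Chevalley's extension theorem. Put \<open>w = z\<^sup>-\<^sup>1\<close>. As \<open>z\<close> is not integral over \<open>B\<close>, it is not in \<open>B[w]\<close>, and
  Zorn's lemma gives a ring \<open>R\<close> that is maximal among those between \<open>B[w]\<close> and \<open>k\<close> without \<open>z\<close>. Maximality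
  makes all \<open>1 + wc\<close> units. If neither \<open>x\<close> nor \<open>x\<^sup>-\<^sup>1\<close> were in \<open>R\<close>, then both \<open>R[x]\<close> and \<open>R[x\<^sup>-\<^sup>1]\<close> would contain \<open>z\<close>,
  and of two such relations of least degree the longer one could be shortened.
\<close>
lemma exists_valuation_ring:
  assumes "subfield k RT" "subring B RT" "B \<subseteq> k" "z \<in> k" "\<not> integral_over B z"
  shows "\<exists>R. subring R RT \<and> B \<subseteq> R \<and> R \<subseteq> k \<and> z \<notin> R \<and> (\<forall>x\<in>k. x \<in> R \<or> inverse x \<in> R)"
proof -
  interpret k: subfield_of_type k by (rule subfield_of_type.intro) fact
  interpret B: subring_of_type B by (rule subring_of_type.intro) fact
  define w where "w = inverse z"
  have z0: "z \<noteq> 0"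
    using assms(5) B.integral_if_in_adjoin_inverse[of 0] B.adjoin_superset[of 0] by auto
  then have wz: "w * z = 1" "w \<noteq> 0" "w \<in> k" using assms(4) by (auto simp: w_def)
  define \<R> where "\<R> = {R. subring R RT \<and> B \<subseteq> R \<and> R \<subseteq> k \<and> w \<in> R \<and> z \<notin> R}"
  have "B.adjoin w \<in> \<R>"
    unfolding \<R>_def
    using B.subring_adjoin B.adjoin_superset B.adjoin_generator B.integral_if_in_adjoin_inverse[of z]
      B.adjoin_minimal[of k w] k.subring assms(3,5) wz(3) by (auto simp: w_def)
  moreover have "\<Union>C \<in> \<R>" if C: "C \<noteq> {}" "subset.chain \<R> C" for C
  proof -
    have sub: "subring R RT" if "R \<in> C" for R
      using C(2) that by (auto simp: subset.chain_def \<R>_def)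
    have common: "\<exists>R\<in>C. x \<in> R \<and> y \<in> R" if "x \<in> \<Union>C" "y \<in> \<Union>C" for x y
    proof -
      obtain R1 R2 where R12: "R1 \<in> C" "R2 \<in> C" "x \<in> R1" "y \<in> R2"
        using \<open>x \<in> \<Union>C\<close> \<open>y \<in> \<Union>C\<close> by blast
      then have "R1 \<subseteq> R2 \<or> R2 \<subseteq> R1" using C(2) by (auto simp: subset_chain_def)
      then show ?thesis using R12 by blast
    qed
    have "subring (\<Union>C) RT"
      unfolding subring_iff
    proof (intro conjI ballI)
      show "1 \<in> \<Union>C" using C(1) sub by (auto simp: subring_iff)
    next
      fix x y assume "x \<in> \<Union>C" "y \<in> \<Union>C"
      then obtain R where "R \<in> C" "x \<in> R" "y \<in> R" using common by blast
      then have "x - y \<in> R" "x * y \<in> R" using sub[of R] by (auto simp: subring_iff)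
      then show "x - y \<in> \<Union>C" "x * y \<in> \<Union>C" using \<open>R \<in> C\<close> by auto
    qed
    then show ?thesis using C by (auto simp: \<R>_def subset.chain_def subset_iff)
  qed
  ultimately obtain R where R: "R \<in> \<R>" and max: "\<And>R'. R' \<in> \<R> \<Longrightarrow> R \<subseteq> R' \<Longrightarrow> R' = R"
    using subset_Zorn_nonempty[of \<R>] by blast
  interpret R: subring_of_type R by (rule subring_of_type.intro) (use R in \<open>simp add: \<R>_def\<close>)
  have BR: "B \<subseteq> R" "R \<subseteq> k" "w \<in> R" "z \<notin> R" using R by (auto simp: \<R>_def)
  have not_unit: "w * c \<noteq> 1" if "c \<in> R" for c
    using that BR(4) wz by (metis mult_left_cancel)
  have units: "inverse (1 + w * c) \<in> R \<and> 1 + w * c \<noteq> 0" if c: "c \<in> R" for c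
  proof
    define u where "u = 1 + w * c"
    have u: "u \<in> R" using c BR(3) by (auto simp: u_def)
    have u_pow: "\<exists>d\<in>R. u ^ n = 1 + w * d" for n
    proof (induction n)
      case (Suc n)
      then obtain d where "d \<in> R" "u ^ n = 1 + w * d" by blast
      then show ?case
        using c BR(3) by (intro bexI[of _ "c + d + w * c * d"]) (auto simp: u_def algebra_simps)
    qed (auto intro: bexI[of _ 0])
    show u0: "1 + w * c \<noteq> 0"
      using not_unit[of "- c"] R.uminus_in[OF c] by (auto simp: add_eq_0_iff)
    then have "u \<noteq> 0" by (simp add: u_def)
    \<comment> \<open>the localization of \<open>R\<close> at \<open>u\<close> also omits \<open>z\<close>, so it equals \<open>R\<close>\<close>
    define R' where "R' = {b / u ^ n | b n. b \<in> R}"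
    have R': "b / u ^ n \<in> R'" if "b \<in> R" for b n using that by (auto simp: R'_def)
    have "R \<subseteq> R'" using R'[of _ 0] by auto
    moreover have "R' \<in> \<R>"
      unfolding \<R>_def
    proof (intro CollectI conjI)
      show "subring R' RT"
        unfolding subring_iff
      proof (intro conjI ballI)
        show "1 \<in> R'" using R'[of 1 0] by simp
      next
        fix x y assume "x \<in> R'" "y \<in> R'"
        then obtain a b m n where ab: "a \<in> R" "b \<in> R" "x = a / u ^ m" "y = b / u ^ n"
          by (auto simp: R'_def)
        have e: "x - y = (a * u ^ n - b * u ^ m) / u ^ (m + n)" "x * y = a * b / u ^ (m + n)"
          using \<open>u \<noteq> 0\<close> by (auto simp: ab field_simps power_add)
        show "x - y \<in> R'" "x * y \<in> R'" unfolding e by (rule R', use ab(1,2) u in auto)+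
      qed
      show "B \<subseteq> R'" "w \<in> R'" using \<open>R \<subseteq> R'\<close> BR by auto
      show "R' \<subseteq> k" using BR(2) u by (auto simp: R'_def)
      show "z \<notin> R'"
      proof
        assume "z \<in> R'"
        then obtain b n where b: "b \<in> R" "z = b / u ^ n" by (auto simp: R'_def)
        obtain d where d: "d \<in> R" "u ^ n = 1 + w * d" using u_pow by blast
        have "b = z * u ^ n" using b(2) \<open>u \<noteq> 0\<close> by simp
        then have "w * b = u ^ n" using wz(1) by (simp flip: mult.assoc)
        then have "w * (b - d) = 1" using d(2) by (simp add: algebra_simps)
        then show False using not_unit[of "b - d"] b(1) d(1) by auto
      qed
    qed
    ultimately have "R' = R" by (intro max)
    then show "inverse (1 + w * c) \<in> R"
      using R'[of 1 1] by (auto simp: u_def inverse_eq_divide)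
  qed
  have "x \<in> R \<or> inverse x \<in> R" if x: "x \<in> k" for x
  proof (rule ccontr)
    assume "\<not> (x \<in> R \<or> inverse x \<in> R)"
    then have not_in: "x \<notin> R" "inverse x \<notin> R" by auto
    then have x0: "x \<noteq> 0" by auto
    define P where "P = (\<lambda>x n. \<exists>p\<in>polys R. degree p \<le> n \<and> w * poly p x = 1)"
    have ex: "\<exists>n. P y n" if y: "y \<in> k" "y \<notin> R" for y
    proof -
      have "z \<in> R.adjoin y"
      proof (rule ccontr)
        assume "z \<notin> R.adjoin y"
        then have "R.adjoin y \<in> \<R>"
          using R.subring_adjoin R.adjoin_superset[of y] R.adjoin_minimal[of k y] k.subring BR y(1)
          by (auto simp: \<R>_def)
        then show False
          using max[of "R.adjoin y"] R.adjoin_superset[of y] R.adjoin_generator[of y] y(2) by auto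
      qed
      then show ?thesis using wz(1) by (auto simp: P_def R.adjoin_def)
    qed
    have pos: "0 < n" if "P y n" for y n
    proof (rule ccontr)
      assume "\<not> 0 < n"
      then obtain p where "p \<in> polys R" "degree p = 0" "w * poly p y = 1"
        using \<open>P y n\<close> by (auto simp: P_def)
      then show False using not_unit[of "coeff p 0"] by (auto elim!: degree_eq_zeroE dest: polysD[of _ _ 0])
    qed
    have shorten: "P y (n - 1)" if "P y n" "P (inverse y) m" "m \<le> n" "y \<noteq> 0" for y n m
    proof -
      from that(1,2) obtain p p' where "p \<in> polys R" "degree p \<le> n" "w * poly p y = 1"
        "p' \<in> polys R" "degree p' \<le> m" "w * poly p' (inverse y) = 1" by (auto simp: P_def)
      then show ?thesis
        unfolding P_def using that pos[OF that(1)]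
        by (intro shorten_relation[OF R.subring BR(3) units, of p n y p' m]) auto
    qed
    define n where "n = (LEAST n. P x n)"
    define m where "m = (LEAST n. P (inverse x) n)"
    have n: "P x n" unfolding n_def by (rule LeastI_ex[OF ex[OF x not_in(1)]])
    have m: "P (inverse x) m" unfolding m_def by (rule LeastI_ex[OF ex[OF _ not_in(2)]]) (use x in auto)
    show False
    proof (cases "m \<le> n")
      case True
      have "n \<le> n - 1" unfolding n_def
        by (rule Least_le) (use shorten[OF n m True x0] n_def in simp)
      then show False using pos[OF n] by simp
    next
      case False
      have "m \<le> m - 1" unfolding m_def
        by (rule Least_le) (use shorten[OF m, of n] n False x0 m_def in simp)
      then show False using pos[OF m] by simp
    qed
  qed
  then show ?thesis using R BR R.subring by blast
qed

section \<open>Modules over a subring\<close>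

text \<open>
  The last unknown is eliminated by multiplying all equations with \<open>u = s - b\<^sub>n\<^sub>n\<close>. The common factor on the left
  remains congruent to 1 modulo \<open>J\<close>, and if it becomes zero, then \<open>1 \<in> J\<close>.
\<close>
lemma nakayama:
  fixes b :: "nat \<Rightarrow> nat \<Rightarrow> 'a::field"
  assumes "subring R RT" "J \<subseteq> R" "\<And>x y. x \<in> J \<Longrightarrow> y \<in> J \<Longrightarrow> x + y \<in> J"
    and J_mult: "\<And>x y. x \<in> R \<Longrightarrow> y \<in> J \<Longrightarrow> x * y \<in> J"
  shows "s - 1 \<in> J \<Longrightarrow> (\<And>i. i < n \<Longrightarrow> s * m i = (\<Sum>l<n. b i l * m l)) \<Longrightarrow>
     (\<And>i l. i < n \<Longrightarrow> l < n \<Longrightarrow> b i l \<in> J) \<Longrightarrow> 1 \<in> J \<or> (\<forall>i<n. m i = 0)"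
proof (induction n arbitrary: s b)
  case (Suc n)
  interpret R: subring_of_type R by (rule subring_of_type.intro) fact
  have J_uminus: "- x \<in> J" if "x \<in> J" for x using J_mult[of "- 1" x] that by auto
  define u where "u = s - b n n"
  have u1: "u - 1 \<in> J"
    using assms(3)[OF Suc.prems(1) J_uminus[OF Suc.prems(3)[of n n]]] by (simp add: u_def algebra_simps)
  then have uR: "u \<in> R" using assms(2) R.add_in[of "u - 1" 1] by auto
  have last: "u * m n = (\<Sum>l<n. b n l * m l)"
    using Suc.prems(2)[of n] by (simp add: u_def algebra_simps)
  have "1 \<in> J \<or> (\<forall>i<n. m i = 0)"
  proof (rule Suc.IH[of "u * s" "\<lambda>i l. u * b i l + b i n * b n l"])
    have "u * s - 1 = u * (s - 1) + (u - 1)" by (simp add: algebra_simps)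
    then show "u * s - 1 \<in> J" using u1 Suc.prems(1) assms(3) J_mult[OF uR] by metis
  next
    fix i assume "i < n"
    then have "u * s * m i = u * ((\<Sum>l<n. b i l * m l) + b i n * m n)"
      using Suc.prems(2)[of i] by (simp add: mult.assoc)
    also have "\<dots> = u * (\<Sum>l<n. b i l * m l) + b i n * (u * m n)" by (simp add: algebra_simps)
    also have "\<dots> = (\<Sum>l<n. (u * b i l + b i n * b n l) * m l)"
      unfolding last by (simp add: sum_distrib_left sum.distrib distrib_right mult.assoc)
    finally show "u * s * m i = (\<Sum>l<n. (u * b i l + b i n * b n l) * m l)" .
  next
    fix i l assume "i < n" "l < n"
    then have "b i l \<in> J" "b i n \<in> J" "b n l \<in> J" using Suc.prems(3) by auto
    then show "u * b i l + b i n * b n l \<in> J" using assms(2,3) J_mult uR by blast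
  qed
  moreover have "1 \<in> J" if "u = 0" using J_uminus[OF u1] that by simp
  moreover have "m n = 0" if "\<forall>i<n. m i = 0" "u \<noteq> 0" using last that by simp
  ultimately show ?case by (auto simp: less_Suc_eq)
qed auto

text \<open>Over a field these are the vector subspaces, over \<open>A\<close> the ideals and fractional ideals, with zero included.\<close>

definition submodule_of :: "'a::field set \<Rightarrow> 'a set \<Rightarrow> bool" where
  "submodule_of F V \<longleftrightarrow> 0 \<in> V \<and> (\<forall>x\<in>V. \<forall>y\<in>V. x + y \<in> V) \<and> (\<forall>c\<in>F. \<forall>x\<in>V. c * x \<in> V)"

text \<open>A subspace of largest cardinality among those counted by a power of \<open>card F\<close> cannot be enlarged by a vector.\<close>
lemma card_subspace:
  assumes "subfield F (RT :: 'a::field ring)" "submodule_of F V" "finite V" "finite F"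
  shows "\<exists>d. card V = card F ^ d"
proof -
  interpret F: subfield_of_type F by (rule subfield_of_type.intro) fact
  have F2: "card F \<ge> 2"
    using card_mono[OF assms(4), of "{0, 1}"] by auto
  define P where "P = (\<lambda>d. \<exists>W\<subseteq>V. submodule_of F W \<and> card W = card F ^ d)"
  have "P 0" unfolding P_def
    by (intro exI[of _ "{0}"]) (use assms(2) in \<open>auto simp: submodule_of_def\<close>)
  moreover have "d \<le> card V" if "P d" for d
  proof -
    obtain W where "W \<subseteq> V" "card W = card F ^ d" using \<open>P d\<close> by (auto simp: P_def)
    then have "card F ^ d \<le> card V" using card_mono[OF assms(3)] by metis
    moreover have "d < 2 ^ d" by simp
    moreover have "2 ^ d \<le> card F ^ d" using F2 by (rule power_mono) simp
    ultimately show ?thesis by linarith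
  qed
  ultimately obtain d where d: "P d" and max: "\<And>e. P e \<Longrightarrow> e \<le> d"
    using GreatestI_nat[of P 0 "card V"] Greatest_le_nat[of P _ "card V"] by blast
  obtain W where W: "W \<subseteq> V" "submodule_of F W" "card W = card F ^ d" using d by (auto simp: P_def)
  have "W = V"
  proof (rule ccontr)
    assume "W \<noteq> V"
    then obtain x where x: "x \<in> V" "x \<notin> W" using W(1) by auto
    define f where "f = (\<lambda>(w, c). w + c * x)"
    have neg: "- w \<in> W" if "w \<in> W" for w
      using W(2) that F.uminus_in[OF F.one_in] unfolding submodule_of_def
      by (metis mult_minus1)
    have "inj_on f (W \<times> F)"
    proof (rule inj_onI, clarify)
      fix w c w' c' assume *: "w \<in> W" "c \<in> F" "w' \<in> W" "c' \<in> F" "f (w, c) = f (w', c')"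
      then have e: "(c - c') * x = w' + - w" by (simp add: f_def algebra_simps)
      have "c = c'"
      proof (rule ccontr)
        assume "c \<noteq> c'"
        then have "x = inverse (c - c') * (w' + - w)"
          using e by (metis eq_iff_diff_eq_0 left_inverse mult.assoc mult_1)
        moreover have "w' + - w \<in> W"
          using *(3) neg[OF *(1)] W(2) unfolding submodule_of_def by blast
        moreover have "inverse (c - c') \<in> F" using *(2,4) by auto
        ultimately show False using x(2) W(2) by (auto simp: submodule_of_def)
      qed
      then show "w = w' \<and> c = c'" using e by simp
    qed
    then have "card (f ` (W \<times> F)) = card F ^ Suc d"
      by (simp add: card_image card_cartesian_product W(3) mult.commute)
    moreover have "submodule_of F (f ` (W \<times> F))"
      unfolding submodule_of_def
    proof (intro conjI ballI)
      show "0 \<in> f ` (W \<times> F)"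
        by (rule image_eqI[of _ _ "(0, 0)"]) (use W(2) in \<open>auto simp: f_def submodule_of_def\<close>)
    next
      fix u v assume "u \<in> f ` (W \<times> F)" "v \<in> f ` (W \<times> F)"
      then obtain w c w' c' where *: "w \<in> W" "c \<in> F" "w' \<in> W" "c' \<in> F" "u = w + c * x" "v = w' + c' * x"
        by (auto simp: f_def)
      show "u + v \<in> f ` (W \<times> F)"
        by (rule image_eqI[of _ _ "(w + w', c + c')"])
           (use * W(2) in \<open>auto simp: f_def submodule_of_def algebra_simps\<close>)
    next
      fix e u assume e: "e \<in> F" and "u \<in> f ` (W \<times> F)"
      then obtain w c where *: "w \<in> W" "c \<in> F" "u = w + c * x" by (auto simp: f_def)
      show "e * u \<in> f ` (W \<times> F)"
        by (rule image_eqI[of _ _ "(e * w, e * c)"])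
           (use * e W(2) in \<open>auto simp: f_def submodule_of_def algebra_simps\<close>)
    qed
    moreover have "f ` (W \<times> F) \<subseteq> V"
      using W(1) x(1) assms(2) by (auto simp: f_def submodule_of_def)
    ultimately have "P (Suc d)" by (auto simp: P_def)
    then show False using max by fastforce
  qed
  then show ?thesis using W(3) by blast
qed

section \<open>Algebraic dependence in function fields\<close>

text \<open>The coefficients of an equation have a common denominator.\<close>
lemma algebraic_over_fractions:
  assumes "subring B RT" "G \<subseteq> {x / y | x y. x \<in> B \<and> y \<in> B \<and> y \<noteq> 0}" "algebraic_over G z"
  shows "algebraic_over B z"
proof -
  interpret B: subring_of_type B by (rule subring_of_type.intro) fact
  obtain p where p: "p \<in> polys G" "p \<noteq> 0" "poly p z = 0"
    using assms(3) by (auto simp: algebraic_over_def)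
  have "\<exists>b\<in>B. b \<noteq> 0 \<and> b * coeff p i \<in> B" for i
  proof -
    obtain x y where "coeff p i = x / y" "x \<in> B" "y \<in> B" "y \<noteq> 0"
      using polysD[OF p(1), of i] assms(2) by blast
    then show ?thesis by (intro bexI[of _ y]) auto
  qed
  then obtain b where b: "\<And>i. b i \<in> B" "\<And>i. b i \<noteq> 0" "\<And>i. b i * coeff p i \<in> B" by metis
  define c where "c = (\<Prod>i\<le>degree p. b i)"
  have "c * coeff p i \<in> B" for i
  proof (cases "i \<le> degree p")
    case True
    then have "c = b i * (\<Prod>j\<in>{..degree p} - {i}. b j)" by (simp add: c_def prod.remove)
    then have "c * coeff p i = (\<Prod>j\<in>{..degree p} - {i}. b j) * (b i * coeff p i)" by simp
    then show ?thesis using b by (metis B.mult_in B.prod_in)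
  qed (simp add: coeff_eq_0)
  then have "smult c p \<in> polys B" by (simp add: polys_def)
  moreover have "c \<noteq> 0" using b(2) by (simp add: c_def)
  ultimately show ?thesis
    using p unfolding algebraic_over_def by (intro bexI[of _ "smult c p"]) auto
qed

lemma generate_field_subfield: "subfield (generate_field RT H) (RT :: 'a::field ring)"
  by (rule field.generate_field_is_subfield[OF field_RT]) simp

lemma generate_field_minimal:
  "subfield E (RT :: 'a::field ring) \<Longrightarrow> H \<subseteq> E \<Longrightarrow> generate_field RT H \<subseteq> E"
  by (rule field.generate_field_min_subfield1[OF field_RT]) auto

lemma (in subfield_of_type) generate_field_fractions:
  "generate_field RT (insert t S) \<subseteq> {x / y | x y. x \<in> adjoin t \<and> y \<in> adjoin t \<and> y \<noteq> 0}"
    (is "_ \<subseteq> ?Q")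
proof (rule generate_field_minimal)
  interpret T: subring_of_type "adjoin t" by (rule subring_of_type.intro) (rule subring_adjoin)
  have Q: "u \<in> ?Q" if "u = x / y" "x \<in> adjoin t" "y \<in> adjoin t" "y \<noteq> 0" for u x y using that by blast
  show "subfield ?Q RT"
    unfolding subfield_iff subring_iff
  proof (intro conjI ballI)
    show "1 \<in> ?Q" by (rule Q[of _ 1 1]) auto
  next
    fix u v assume "u \<in> ?Q" "v \<in> ?Q"
    then obtain x y x' y' where *: "u = x / y" "x \<in> adjoin t" "y \<in> adjoin t" "y \<noteq> 0"
      "v = x' / y'" "x' \<in> adjoin t" "y' \<in> adjoin t" "y' \<noteq> 0" by blast
    show "u - v \<in> ?Q" by (rule Q[of _ "x * y' - x' * y" "y * y'"]) (use * in \<open>auto simp: field_simps\<close>)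
    show "u * v \<in> ?Q" by (rule Q[of _ "x * x'" "y * y'"]) (use * in auto)
  next
    fix u assume "u \<in> ?Q"
    then obtain x y where *: "u = x / y" "x \<in> adjoin t" "y \<in> adjoin t" "y \<noteq> 0" by blast
    show "inverse u \<in> ?Q"
    proof (cases "x = 0")
      case True
      show ?thesis by (rule Q[of _ 0 1]) (use True * in auto)
    next
      case False
      show ?thesis by (rule Q[of _ y x]) (use False * in auto)
    qed
  qed
  show "insert t S \<subseteq> ?Q"
  proof
    fix u assume "u \<in> insert t S"
    then show "u \<in> ?Q"
      using adjoin_superset[of t] adjoin_generator[of t] by (intro Q[of _ u 1]) auto
  qed
qed

text \<open>
  The exchange argument for transcendence degree one: a polynomial relation between \<open>a\<close> and \<open>t\<close>
  over a field involves both elements if neither of them is algebraic.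
\<close>
lemma function_field_algebraic:
  assumes "function_field Fr k" "a \<in> k" "a \<notin> Fr" "z \<in> k"
  shows "algebraic_over ((\<lambda>p. poly p a) ` polys Fr) z"
proof -
  have Fr: "subfield Fr RT" using assms(1) by (simp add: function_field_def)
  interpret Fr: subfield_of_type Fr by (rule subfield_of_type.intro) fact
  obtain t where t: "t \<in> k" "finite_ext (generate_field RT (insert t Fr)) k"
    using assms(1) by (auto simp: function_field_def)
  let ?T = "generate_field RT (insert t Fr)" and ?G = "generate_field RT (insert a Fr)"
  have alg_T: "algebraic_over ?T x" if "x \<in> k" for x
    using RT.finite_dimension_imp_algebraic[of ?T k x] t(2) that
    by (auto simp: finite_ext_def over_def subfieldE algebraic_iff)
  have a_tr: "\<not> algebraic_over Fr a"
    using assms(1-3) algebraic_iff[OF Fr.subring, of a] by (auto simp: function_field_def)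
  interpret G: subfield_of_type ?G by (rule subfield_of_type.intro) (rule generate_field_subfield)
  have Fr_G: "Fr \<subseteq> ?G" "a \<in> ?G" by (auto intro: generate_field.incl)
  have t_alg: "algebraic_over ?G t"
  proof -
    have "algebraic_over (Fr.adjoin t) a"
      by (rule algebraic_over_fractions[OF Fr.subring_adjoin Fr.generate_field_fractions alg_T[OF assms(2)]])
    then obtain p where p: "p \<in> polys (Fr.adjoin t)" "p \<noteq> 0" "poly p a = 0"
      by (auto simp: algebraic_over_def)
    have "\<forall>i. \<exists>f\<in>polys Fr. coeff p i = poly f t"
      using polysD[OF p(1)] by (auto simp: Fr.adjoin_def)
    then obtain f where f: "\<And>i. f i \<in> polys Fr" "\<And>i. coeff p i = poly (f i) t" by metis
    \<comment> \<open>the relation \<open>p(a) = 0\<close>, read as a polynomial in \<open>t\<close>\<close>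
    define Q where "Q = (\<Sum>i\<le>degree p. smult (a ^ i) (f i))"
    have coeff_Q: "coeff Q j = (\<Sum>i\<le>degree p. a ^ i * coeff (f i) j)" for j
      by (simp add: Q_def coeff_sum)
    have "Q \<in> polys ?G"
      using Fr_G polysD[OF f(1)]
      by (auto simp: polys_def coeff_Q intro!: G.sum_in G.mult_in G.power_in)
    moreover have "poly Q t = 0"
      using p(3) by (simp add: Q_def poly_sum f(2)[symmetric] poly_altdef[of p] mult.commute)
    moreover have "Q \<noteq> 0"
    proof
      assume "Q = 0"
      have "f (degree p) \<noteq> 0" using f(2)[of "degree p"] p(2) by auto
      then obtain j where j: "coeff (f (degree p)) j \<noteq> 0" by (metis leading_coeff_0_iff)
      \<comment> \<open>the coefficient of \<open>t\<^sup>j\<close>, as a polynomial in \<open>a\<close> over \<open>Fr\<close>\<close>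
      define A where "A = (\<Sum>i\<le>degree p. monom (coeff (f i) j) i)"
      have "coeff A (degree p) = coeff (f (degree p)) j" by (simp add: A_def coeff_sum)
      then have "A \<noteq> 0" using j by auto
      moreover have "A \<in> polys Fr"
        unfolding A_def polys_def using polysD[OF f(1)] by (auto simp: coeff_sum intro!: Fr.sum_in)
      moreover have "poly A a = coeff Q j"
        by (simp add: A_def poly_sum poly_monom coeff_Q mult.commute)
      ultimately show False using a_tr \<open>Q = 0\<close> by (auto simp: algebraic_over_def)
    qed
    ultimately show ?thesis by (auto simp: algebraic_over_def)
  qed
  let ?H = "RT.simple_extension ?G t"
  have G: "subfield ?G RT" by (rule generate_field_subfield)
  have t_alg': "(RT.algebraic over ?G) t" using t_alg by (simp add: over_def algebraic_iff G.subring)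
  have H: "subfield ?H RT"
    using RT.simple_extension_is_subfield[OF G] t_alg' by simp
  interpret H: subfield_of_type ?H by (rule subfield_of_type.intro) (rule H)
  have "?G \<subseteq> ?H" using RT.simple_extension_incl[of ?G t] by simp
  moreover have "t \<in> ?H" using RT.simple_extension_mem[OF G.subring] by simp
  ultimately have "?T \<subseteq> ?H" using H Fr_G by (intro generate_field_minimal) auto
  then have z_alg: "(RT.algebraic over ?H) z"
    using alg_T[OF assms(4)] algebraic_over_mono by (auto simp: over_def algebraic_iff H.subring)
  let ?Z = "RT.simple_extension ?H z"
  have "RT.finite_dimension ?G ?Z"
    by (rule RT.telescopic_base_dim(1)[OF G H])
       (use RT.finite_dimension_simple_extension[OF G] RT.finite_dimension_simple_extension[OF H]
          t_alg' z_alg in auto)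
  then have "RT.algebraic ?G z"
    using RT.finite_dimension_imp_algebraic[OF G RT.simple_extension_is_subring[OF H.subring], of z z]
      RT.simple_extension_mem[OF H.subring, of z] by (simp add: over_def)
  then have "algebraic_over ?G z" by (simp add: algebraic_iff G.subring)
  then have "algebraic_over (Fr.adjoin a) z"
    by (rule algebraic_over_fractions[OF Fr.subring_adjoin Fr.generate_field_fractions])
  then show ?thesis by (simp add: Fr.adjoin_def)
qed

text \<open>Clearing the leading coefficient of an algebraic equation makes it integral.\<close>

lemma (in subring_of_type) integral_multiple:
  assumes "algebraic_over S z"
  shows "\<exists>b\<in>S. b \<noteq> 0 \<and> integral_over S (b * z)"
proof -
  obtain p where p: "p \<in> polys S" "p \<noteq> 0" "poly p z = 0"
    using assms by (auto simp: algebraic_over_def)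
  define b where "b = lead_coeff p"
  have b: "b \<in> S" "b \<noteq> 0" using p by (auto simp: b_def dest: polysD)
  have n: "degree p \<noteq> 0"
    using p by (metis degree_eq_zeroE pCons_eq_0_iff poly_pCons mult_zero_right add.right_neutral poly_0)
  then obtain n where n: "degree p = Suc n" by (cases "degree p") auto
  define g where "g = (\<Sum>i\<le>n. monom (coeff p i * b ^ (n - i)) i)"
  have g: "g \<in> polys S"
    unfolding g_def polys_def using polysD[OF p(1)] b by (auto simp: coeff_sum intro!: sum_in)
  have dg: "degree g \<le> n"
    unfolding g_def by (intro degree_sum_le) (auto intro: order_trans[OF degree_monom_le])
  have "poly g (b * z) = (\<Sum>i\<le>n. b ^ n * (coeff p i * z ^ i))"
    unfolding g_def poly_sum poly_monom
    by (intro sum.cong refl)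
       (auto simp: power_mult_distrib power_add[symmetric] algebra_simps simp flip: power_add)
  also have "\<dots> = b ^ n * (\<Sum>i\<le>n. coeff p i * z ^ i)" by (simp add: sum_distrib_left)
  finally have "poly g (b * z) + (b * z) ^ Suc n = b ^ n * ((\<Sum>i\<le>n. coeff p i * z ^ i) + b * z ^ Suc n)"
    by (simp add: power_mult_distrib algebra_simps)
  also have "\<dots> = 0" using p(3) by (simp add: poly_altdef n b_def)
  finally have "poly (g + monom 1 (Suc n)) (b * z) = 0" by (simp add: poly_monom)
  moreover have "degree (g + monom (1 :: 'a) (Suc n)) = Suc n"
    using dg by (subst degree_add_eq_right) (auto simp: degree_monom_eq)
  then have "lead_coeff (g + monom (1 :: 'a) (Suc n)) = 1"
    using dg by (simp add: coeff_eq_0)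
  ultimately show ?thesis
    unfolding integral_over_iff using g b
    by (intro bexI[of _ b] conjI bexI[of _ "g + monom 1 (Suc n)"]) auto
qed

section \<open>Power maps on finite sets\<close>

text \<open>An injective map of a finite set into itself returns to every starting point.\<close>
lemma power_fixed_of_finite:
  fixes x :: "'a::field"
  assumes "finite T" "x \<in> T" "\<And>y. y \<in> T \<Longrightarrow> y ^ Q \<in> T" "\<And>y z :: 'a. y ^ Q = z ^ Q \<Longrightarrow> y = z"
  shows "\<exists>e>0. x ^ (Q ^ e) = x"
proof -
  have in_T: "x ^ (Q ^ n) \<in> T" for n
  proof (induction n)
    case (Suc n)
    have "x ^ (Q ^ Suc n) = (x ^ (Q ^ n)) ^ Q" by (simp only: power_Suc2 power_mult)
    then show ?case using assms(3)[OF Suc] by simp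
  qed (use assms(2) in simp)
  have inj: "y = z" if "y ^ (Q ^ n) = z ^ (Q ^ n)" for y z :: 'a and n
    using that by (induction n) (auto simp: power_mult mult.commute[of Q] dest!: assms(4))
  have "\<not> inj_on (\<lambda>n. x ^ (Q ^ n)) UNIV"
    using assms(1) in_T by (meson finite_imageD finite_subset image_subsetI infinite_UNIV_nat)
  then obtain m n where "m \<noteq> n" "x ^ (Q ^ m) = x ^ (Q ^ n)" by (auto simp: inj_on_def)
  then obtain m n where mn: "m < n" "x ^ (Q ^ m) = x ^ (Q ^ n)" by (metis linorder_neqE_nat)
  have "x ^ (Q ^ n) = (x ^ (Q ^ (n - m))) ^ (Q ^ m)"
    using mn(1) by (simp add: power_add[symmetric] power_mult[symmetric])
  then have "x ^ (Q ^ (n - m)) = x" using inj[of "x ^ (Q ^ (n - m))" m x] mn(2) by simp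
  then show ?thesis using mn(1) by (intro exI[of _ "n - m"]) auto
qed

text \<open>Multiplication by \<open>c\<close> permutes the nonzero elements and so preserves their product.\<close>
lemma finite_subfield_power_card:
  assumes "subfield C (RT :: 'a::field ring)" "finite C" "c \<in> C" "c \<noteq> 0"
  shows "c ^ (card C - 1) = 1"
proof -
  interpret C: subfield_of_type C by (rule subfield_of_type.intro) fact
  let ?U = "C - {0}"
  have "bij_betw ((*) c) ?U ?U"
    by (rule bij_betw_byWitness[of _ "\<lambda>x. inverse c * x"]) (use assms in auto)
  then have "(\<Prod>x\<in>?U. c * x) = (\<Prod>x\<in>?U. x)"
    by (rule prod.reindex_bij_betw)
  then have "c ^ card ?U * (\<Prod>x\<in>?U. x) = 1 * (\<Prod>x\<in>?U. x)" by (simp add: prod.distrib)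
  then have "c ^ card ?U = 1" using assms(2) by (subst (asm) mult_right_cancel) auto
  then show ?thesis using assms(2) by simp
qed

section \<open>The absolute value at infinity\<close>

context infinite_place
begin

abbreviation A where "A \<equiv> ring_A Fr k"
abbreviation K where "K \<equiv> field_K k"
abbreviation C where "C \<equiv> const_inf Fr k"
abbreviation q where "q \<equiv> card (const_inf Fr k)"

lemma abs_mult: "abs_inf (x * y :: 'c) = abs_inf x * abs_inf y"
  and abs_add_le: "abs_inf (x + y :: 'c) \<le> max (abs_inf x) (abs_inf y)"
  using nonarch_abs by (auto simp: nonarch_abs_def)

lemma abs_1 [simp]: "abs_inf (1 :: 'c) = 1"
  using abs_mult[of 1 1] by (metis mult_cancel_right1 mult_1 dist_eq_0_iff zero_neq_one)

lemma abs_power: "abs_inf (x ^ n :: 'c) = abs_inf x ^ n"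
  by (induction n) (auto simp: abs_mult)

lemma abs_uminus [simp]: "abs_inf (- x :: 'c) = abs_inf x"
proof -
  have "abs_inf (- 1 :: 'c) ^ 2 = 1" by (simp flip: abs_power)
  then have "abs_inf (- 1 :: 'c) = 1" by (metis zero_le_dist power2_eq_1_iff zero_le_one neg_0_le_iff_le not_one_le_zero)
  then show ?thesis using abs_mult[of "- 1" x] by simp
qed

lemma abs_diff_le: "abs_inf (x - y :: 'c) \<le> max (abs_inf x) (abs_inf y)"
  using abs_add_le[of x "- y"] by simp

lemma abs_diff_commute: "abs_inf (x - y :: 'c) = abs_inf (y - x)"
  using abs_uminus[of "x - y"] by simp

lemma abs_inverse: "abs_inf (inverse x :: 'c) = inverse (abs_inf x)"
proof (cases "x = 0")
  case False
  then have "abs_inf x * abs_inf (inverse x) = 1" by (simp flip: abs_mult)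
  then show ?thesis by (metis inverse_unique)
qed auto

lemma abs_divide: "abs_inf (x / y :: 'c) = abs_inf x / abs_inf y"
  by (simp add: divide_inverse abs_mult abs_inverse)

lemma abs_sum_le: "(\<And>i. i \<in> I \<Longrightarrow> abs_inf (f i :: 'c) \<le> c) \<Longrightarrow> 0 \<le> c \<Longrightarrow> abs_inf (sum f I) \<le> c"
proof (induction I rule: infinite_finite_induct)
  case (insert i I)
  then show ?case using abs_add_le[of "f i" "sum f I"] by (fastforce intro: order_trans)
qed auto

lemma abs_sum_less: "(\<And>i. i \<in> I \<Longrightarrow> abs_inf (f i :: 'c) < c) \<Longrightarrow> 0 < c \<Longrightarrow> abs_inf (sum f I) < c"
proof (induction I rule: infinite_finite_induct)
  case (insert i I)
  then show ?case using abs_add_le[of "f i" "sum f I"] by (fastforce intro: le_less_trans)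
qed auto

lemma abs_add_eq: "abs_inf (x :: 'c) < abs_inf y \<Longrightarrow> abs_inf (x + y) = abs_inf y"
  using abs_add_le[of x y] abs_diff_le[of "x + y" x] by auto

lemma abs_eq_if_close: "abs_inf (x - y :: 'c) < abs_inf y \<Longrightarrow> abs_inf x = abs_inf y"
  using abs_add_eq[of "x - y" y] by simp

lemma abs_close_trans:
  "abs_inf (x - y :: 'c) < e \<Longrightarrow> abs_inf (y - z) < e \<Longrightarrow> abs_inf (x - z) < e"
  using abs_add_le[of "x - y" "y - z"] by simp

lemma abs_of_nat_le: "abs_inf (of_nat n :: 'c) \<le> 1"
proof (induction n)
  case (Suc n)
  then show ?case using abs_add_le[of 1 "of_nat n"] by simp
qed auto

text \<open>
  The type class relates the metric in no way to the field operations. Their continuity comes from the ultrametric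
  inequality and the multiplicativity of the absolute value.
\<close>
lemma tendsto_iff_abs: "((f \<longlongrightarrow> (l :: 'c)) F) \<longleftrightarrow> ((\<lambda>n. abs_inf (f n - l)) \<longlongrightarrow> 0) F"
  by (subst tendsto_dist_iff) (subst dist_abs, simp)

lemma tendsto_diff_abs:
  assumes "(f \<longlongrightarrow> (a :: 'c)) F" "(g \<longlongrightarrow> b) F"
  shows "((\<lambda>n. f n - g n) \<longlongrightarrow> a - b) F"
  unfolding tendsto_iff_abs
proof (rule tendsto_sandwich[OF _ _ tendsto_const])
  show "\<forall>\<^sub>F n in F. abs_inf (f n - g n - (a - b)) \<le> abs_inf (f n - a) + abs_inf (g n - b)"
  proof (rule always_eventually, rule allI)
    fix n
    have "f n - g n - (a - b) = (f n - a) - (g n - b)" by simp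
    then have "abs_inf (f n - g n - (a - b)) \<le> max (abs_inf (f n - a)) (abs_inf (g n - b))"
      using abs_diff_le[of "f n - a" "g n - b"] by (simp only:)
    also have "\<dots> \<le> abs_inf (f n - a) + abs_inf (g n - b)" by simp
    finally show "abs_inf (f n - g n - (a - b)) \<le> abs_inf (f n - a) + abs_inf (g n - b)" .
  qed
  show "((\<lambda>n. abs_inf (f n - a) + abs_inf (g n - b)) \<longlongrightarrow> 0) F"
    using tendsto_add[OF assms[unfolded tendsto_iff_abs]] by simp
qed simp

lemma tendsto_mult_abs:
  assumes "(f \<longlongrightarrow> (a :: 'c)) F" "(g \<longlongrightarrow> b) F"
  shows "((\<lambda>n. f n * g n) \<longlongrightarrow> a * b) F"
  unfolding tendsto_iff_abs
proof (rule tendsto_sandwich[OF _ _ tendsto_const])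
  let ?u = "\<lambda>n. abs_inf (f n) * abs_inf (g n - b) + abs_inf (f n - a) * abs_inf b"
  show "\<forall>\<^sub>F n in F. abs_inf (f n * g n - a * b) \<le> ?u n"
  proof (rule always_eventually, rule allI)
    fix n
    have "f n * g n - a * b = f n * (g n - b) + (f n - a) * b" by (simp add: algebra_simps)
    then have "abs_inf (f n * g n - a * b) \<le> max (abs_inf (f n) * abs_inf (g n - b)) (abs_inf (f n - a) * abs_inf b)"
      using abs_add_le[of "f n * (g n - b)" "(f n - a) * b"] by (simp add: abs_mult)
    also have "\<dots> \<le> ?u n" by simp
    finally show "abs_inf (f n * g n - a * b) \<le> ?u n" .
  qed
  have "((\<lambda>n. abs_inf (f n)) \<longlongrightarrow> abs_inf a) F"
    by (intro tendsto_intros assms)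
  then have "(?u \<longlongrightarrow> abs_inf a * 0 + 0 * abs_inf b) F"
    by (intro tendsto_add tendsto_mult tendsto_const assms[unfolded tendsto_iff_abs])
  then show "(?u \<longlongrightarrow> 0) F" by simp
qed simp

lemma tendsto_power_abs: "(f \<longlongrightarrow> (a :: 'c)) F \<Longrightarrow> ((\<lambda>n. f n ^ m) \<longlongrightarrow> a ^ m) F"
  by (induction m) (auto intro: tendsto_mult_abs)

lemma tendsto_inverse_abs:
  assumes "(f \<longlongrightarrow> (a :: 'c)) F" "a \<noteq> 0"
  shows "((\<lambda>n. inverse (f n)) \<longlongrightarrow> inverse a) F"
  unfolding tendsto_iff_abs
proof (rule Lim_transform_eventually)
  show "((\<lambda>n. abs_inf (f n - a) / (abs_inf a * abs_inf a)) \<longlongrightarrow> 0) F"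
    using tendsto_divide[OF assms(1)[unfolded tendsto_iff_abs] tendsto_const, of "abs_inf a * abs_inf a"] assms(2)
    by simp
  have "\<forall>\<^sub>F n in F. abs_inf (f n - a) < abs_inf a"
    using assms by (intro order_tendstoD(2)[OF assms(1)[unfolded tendsto_iff_abs]]) auto
  then show "\<forall>\<^sub>F n in F. abs_inf (f n - a) / (abs_inf a * abs_inf a) = abs_inf (inverse (f n) - inverse a)"
  proof eventually_elim
    case (elim n)
    then have eq: "abs_inf (f n) = abs_inf a" by (rule abs_eq_if_close)
    then have "f n \<noteq> 0" using assms(2) by (metis dist_eq_0_iff)
    then have "inverse (f n) - inverse a = (a - f n) / (f n * a)"
      using assms(2) by (simp add: field_simps)
    then show ?case by (simp add: abs_divide abs_mult eq abs_diff_commute)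
  qed
qed

section \<open>The tower of fields\<close>

lemma subfield_Fr: "subfield Fr RT" and subfield_k: "subfield k RT" and finite_Fr: "finite Fr"
  and Fr_k: "Fr \<subseteq> k"
  using function_field by (auto simp: function_field_def)

sublocale Fr: subfield_of_type Fr by (rule subfield_of_type.intro) (rule subfield_Fr)
sublocale k: subfield_of_type k by (rule subfield_of_type.intro) (rule subfield_k)

lemma k_K: "k \<subseteq> K"
  by (simp add: field_K_def closure_subset)

lemma K_limits: "x \<in> K \<longleftrightarrow> (\<exists>f. (\<forall>n. f n \<in> k) \<and> f \<longlonglongrightarrow> x)"
  by (simp add: field_K_def closure_sequential)

lemma closed_K: "(\<And>n. f n \<in> K) \<Longrightarrow> f \<longlonglongrightarrow> x \<Longrightarrow> x \<in> K"
  unfolding field_K_def using closed_sequentially[OF closed_closure] by blast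

lemma subfield_K: "subfield K RT"
  unfolding subfield_iff subring_iff
proof (intro conjI ballI)
  show "1 \<in> K" using k_K by auto
next
  fix x y assume "x \<in> K" "y \<in> K"
  then obtain f g where "\<forall>n. f n \<in> k" "f \<longlonglongrightarrow> x" "\<forall>n. g n \<in> k" "g \<longlonglongrightarrow> y"
    by (auto simp: K_limits)
  then show "x - y \<in> K" "x * y \<in> K"
    unfolding K_limits
    by (intro exI[of _ "\<lambda>n. f n - g n"] exI[of _ "\<lambda>n. f n * g n"] conjI tendsto_diff_abs tendsto_mult_abs; auto)+
next
  fix x assume "x \<in> K"
  then obtain f where "\<forall>n. f n \<in> k" "f \<longlonglongrightarrow> x" by (auto simp: K_limits)
  then show "inverse x \<in> K"
    by (cases "x = 0") (use \<open>x \<in> K\<close> in \<open>auto simp: K_limits intro!: exI[of _ "\<lambda>n. inverse (f n)"] tendsto_inverse_abs\<close>)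
qed

sublocale K: subfield_of_type K by (rule subfield_of_type.intro) (rule subfield_K)

lemma K_approx: "x \<in> K \<Longrightarrow> e > 0 \<Longrightarrow> \<exists>y\<in>k. abs_inf (x - y) < e"
  unfolding field_K_def closure_approachable by (metis dist_abs dist_commute)

lemma card_Fr_ge_2: "card Fr \<ge> 2"
  using card_mono[OF finite_Fr, of "{0, 1}"] by auto

lemma prime_CHAR: "prime CHAR('c)"
proof -
  have "range (of_nat :: nat \<Rightarrow> 'c) \<subseteq> Fr" by auto
  then have "finite (range (of_nat :: nat \<Rightarrow> 'c))" using finite_Fr finite_subset by blast
  then have "\<not> inj (of_nat :: nat \<Rightarrow> 'c)" using finite_imageD infinite_UNIV_nat by blast
  then obtain m n :: nat where "of_nat m = (of_nat n :: 'c)" "m < n"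
    by (metis injI linorder_neqE_nat)
  then have "of_nat (n - m) = (0 :: 'c)" "n - m > 0" by (auto simp: of_nat_diff)
  then have "CHAR('c) > 0" unfolding CHAR_pos_iff by blast
  then show ?thesis by (rule prime_CHAR_semidom)
qed

lemma frobenius_diff: "(x - y :: 'c) ^ (CHAR('c) ^ n) = x ^ (CHAR('c) ^ n) - y ^ (CHAR('c) ^ n)"
  using freshmans_dream'[OF prime_CHAR refl, of "x - y" y n] by (simp add: algebra_simps)

lemma frobenius_inj: "x ^ (CHAR('c) ^ n) = y ^ (CHAR('c) ^ n) \<Longrightarrow> x = (y :: 'c)"
  using frobenius_diff[of x y n] by simp

lemma point_inf_ring: "subring (point_inf k) RT" "Fr \<subseteq> point_inf k" "point_inf k \<noteq> k"
  using point_inf by (auto simp: closed_points_def)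

lemma exists_large: "\<exists>x\<in>k. abs_inf x > 1"
  using point_inf_ring(3) by (fastforce simp: point_inf_def)

lemma abs_Fr: "c \<in> Fr \<Longrightarrow> c \<noteq> 0 \<Longrightarrow> abs_inf c = 1"
proof -
  assume c: "c \<in> Fr" "c \<noteq> 0"
  then have "abs_inf c \<le> 1" "abs_inf (inverse c) \<le> 1"
    using point_inf_ring(2) by (auto simp: point_inf_def)
  then show "abs_inf c = 1" using c(2) by (auto simp: abs_inverse inverse_le_1_iff)
qed

text \<open>Outside the unit disc the leading term dominates a polynomial whose coefficients have absolute value at most 1.\<close>
lemma poly_dominant:
  assumes "\<And>i. abs_inf (coeff p i) \<le> 1" "1 < abs_inf (x :: 'c)"
  shows "abs_inf (poly p x - lead_coeff p * x ^ degree p) < abs_inf x ^ degree p"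
proof -
  have "poly p x - lead_coeff p * x ^ degree p = (\<Sum>i<degree p. coeff p i * x ^ i)"
    by (simp add: poly_altdef lessThan_Suc_atMost[symmetric])
  also have "abs_inf \<dots> < abs_inf x ^ degree p"
  proof (rule abs_sum_less)
    fix i assume i: "i \<in> {..<degree p}"
    have "abs_inf (coeff p i * x ^ i) \<le> 1 * abs_inf x ^ i"
      unfolding abs_mult abs_power using assms(1) by (intro mult_right_mono) auto
    also have "\<dots> < abs_inf x ^ degree p" using i assms(2) by (simp add: power_strict_increasing)
    finally show "abs_inf (coeff p i * x ^ i) < abs_inf x ^ degree p" .
  next
    show "0 < abs_inf x ^ degree p" using assms(2) by (intro zero_less_power) linarith
  qed
  finally show ?thesis .
qed

lemma root_abs_le:
  assumes "\<And>i. abs_inf (coeff p i) \<le> 1" "abs_inf (lead_coeff p) = 1" "poly p (x :: 'c) = 0"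
  shows "abs_inf x \<le> 1"
proof (rule ccontr)
  assume "\<not> abs_inf x \<le> 1"
  then have "abs_inf (poly p x - lead_coeff p * x ^ degree p) < abs_inf x ^ degree p"
    by (intro poly_dominant assms(1)) auto
  then show False using assms(2,3) by (simp add: abs_mult abs_power)
qed

lemma abs_polys_Fr: "p \<in> polys Fr \<Longrightarrow> abs_inf (coeff p i) \<le> 1"
  using abs_Fr[OF polysD, of p i] by (cases "coeff p i = 0") auto

lemma abs_lead_coeff_Fr: "p \<in> polys Fr \<Longrightarrow> p \<noteq> 0 \<Longrightarrow> abs_inf (lead_coeff p) = 1"
  by (rule abs_Fr) (auto dest: polysD)

lemma const_inf_eq: "C = {x \<in> K. algebraic_over Fr x}"
  by (simp add: const_inf_def algebraic_iff Fr.subring)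

lemma subfield_C: "subfield C RT"
proof -
  have *: "{x. algebraic_over Fr x} = {x \<in> carrier RT. (RT.algebraic over Fr) x}"
    by (simp add: algebraic_iff Fr.subring over_def)
  have "subfield {x. algebraic_over Fr x} RT"
    unfolding * by (rule field.subfield_of_algebraics[OF field_RT subfield_Fr])
  then show ?thesis using subfield_K by (auto simp: const_inf_eq subfield_iff subring_iff)
qed

sublocale C: subfield_of_type C by (rule subfield_of_type.intro) (rule subfield_C)

lemma C_K: "C \<subseteq> K" by (auto simp: const_inf_eq)

lemma algebraic_Fr: "c \<in> Fr \<Longrightarrow> algebraic_over Fr c"
  unfolding algebraic_over_def by (intro bexI[of _ "[:- c, 1:]"]) auto

lemma Fr_C: "Fr \<subseteq> C"
  using Fr_k k_K by (auto simp: const_inf_eq algebraic_Fr)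

text \<open>The bound for roots applies to both \<open>c\<close> and its inverse.\<close>
lemma abs_C: "c \<in> C \<Longrightarrow> c \<noteq> 0 \<Longrightarrow> abs_inf c = 1"
proof -
  have le: "abs_inf x \<le> 1" if "x \<in> C" for x
  proof -
    obtain p where "p \<in> polys Fr" "p \<noteq> 0" "poly p x = 0"
      using \<open>x \<in> C\<close> by (auto simp: const_inf_eq algebraic_over_def)
    then show ?thesis using root_abs_le[of p x] abs_polys_Fr abs_lead_coeff_Fr by blast
  qed
  assume c: "c \<in> C" "c \<noteq> 0"
  then have "abs_inf c \<le> 1" "abs_inf (inverse c) \<le> 1" using le by auto
  then show "abs_inf c = 1" using c(2) by (auto simp: abs_inverse inverse_le_1_iff)
qed

lemma abs_value_group: "x \<in> K \<Longrightarrow> x \<noteq> 0 \<Longrightarrow> \<exists>n::int. abs_inf x = real q powi n"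
  using abs_normalized by blast

text \<open>
  For \<open>q\<close> equal to 0 (the value for infinitely many constants) or 1, no power of \<open>q\<close> would exceed 1, but the local
  ring at infinity is smaller than \<open>k\<close>.
\<close>
lemma q_ge_2: "q \<ge> 2"
proof (rule ccontr)
  assume "\<not> q \<ge> 2"
  then have "q = 0 \<or> q = 1" by auto
  then have "real q powi n \<le> 1" for n :: int by (auto simp: power_int_0_left_if)
  then show False
    using exists_large abs_value_group k_K by (metis dist_self leD subsetD zero_le_one less_le_trans)
qed

lemma finite_C: "finite C"
  using q_ge_2 by (metis card.infinite not_numeral_le_zero)

lemma card_C: "\<exists>D. q = card Fr ^ D"
  by (rule card_subspace[OF subfield_Fr _ finite_C finite_Fr])
     (use Fr_C in \<open>auto simp: submodule_of_def\<close>)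

lemma q_powi_eq: "real q powi m = real q powi n \<longleftrightarrow> m = n"
proof -
  have "1 < real q" using q_ge_2 by simp
  then show ?thesis by (metis linorder_neqE power_int_strict_increasing less_irrefl)
qed

lemma v_inf_eqI: "abs_inf x = real q powi (- n) \<Longrightarrow> v_inf Fr k x = n"
  unfolding v_inf_def by (rule the_equality) (auto simp: q_powi_eq)

lemma abs_v_inf: "x \<in> K \<Longrightarrow> x \<noteq> 0 \<Longrightarrow> abs_inf x = real q powi (- v_inf Fr k x)"
  using abs_value_group[of x] v_inf_eqI[of x] by (metis minus_minus)

section \<open>Residues\<close>

text \<open>The value at \<open>x\<close> is, up to a unit, the product of the distances from \<open>x\<close> to the roots.\<close>
lemma poly_small_root:
  assumes "p \<noteq> 0" "abs_inf (lead_coeff p) = 1" "abs_inf (poly p (x :: 'c)) < 1"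
  shows "\<exists>y. poly p y = 0 \<and> abs_inf (x - y) < 1"
proof -
  obtain M where M: "p = smult (lead_coeff p) (\<Prod>y\<in>#M. [:-y, 1:])"
    using alg_closed_imp_factorization[OF assms(1)] by blast
  have "poly (\<Prod>y\<in>#M. [:-y, 1:]) x = (\<Prod>y\<in>#M. x - y)" for M
    by (induction M) (auto simp: algebra_simps)
  then have "poly p x = lead_coeff p * (\<Prod>y\<in>#M. x - y)"
    by (subst M) simp
  then have small: "abs_inf (\<Prod>y\<in>#M. x - y) < 1"
    using assms(2,3) by (simp add: abs_mult)
  have "\<exists>y\<in>#M. abs_inf (x - y) < 1" if "abs_inf (\<Prod>y\<in>#M. x - y) < 1" for M
    using that
  proof (induction M)
    case (add y M)
    show ?case
    proof (cases "abs_inf (x - y) < 1")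
      case False
      then have "abs_inf (\<Prod>y\<in>#M. x - y) \<le> abs_inf (x - y) * abs_inf (\<Prod>y\<in>#M. x - y)"
        by (simp add: mult_le_cancel_right1)
      then show ?thesis using add by (auto simp: abs_mult)
    qed auto
  qed auto
  then obtain y where y: "y \<in># M" "abs_inf (x - y) < 1" using small by blast
  have "poly (\<Prod>z\<in>#M. [:-z, 1:]) y = 0" if "y \<in># M" for M
    using that by (induction M) auto
  then have "poly p y = 0" using y(1) by (subst M) simp
  then show ?thesis using y(2) by blast
qed

text \<open>
  Some power of the Frobenius map fixes the finite field \<open>Fr\<close>. It then permutes the finitely many roots of a
  polynomial over \<open>Fr\<close>.
\<close>
lemma algebraic_Fr_frobenius_fixed:
  assumes "algebraic_over Fr x"
  shows "\<exists>e>0. x ^ (CHAR('c) ^ e) = x"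
proof -
  let ?p = "CHAR('c)"
  have "\<exists>e>0. c ^ (?p ^ e) = c" if "c \<in> Fr" for c
    using finite_Fr that frobenius_inj[of _ 1] by (intro power_fixed_of_finite[of Fr]) auto
  then obtain e where e: "\<And>c. c \<in> Fr \<Longrightarrow> e c > 0 \<and> c ^ (?p ^ e c) = c" by metis
  have fixed: "c ^ (?p ^ (e c * n)) = c" if "c \<in> Fr" for c n
  proof (induction n)
    case (Suc n)
    have "c ^ (?p ^ (e c * Suc n)) = (c ^ (?p ^ e c)) ^ (?p ^ (e c * n))"
      by (simp only: mult_Suc_right power_add power_mult)
    then show ?case using Suc e[OF that] by simp
  qed simp
  \<comment> \<open>a common multiple of the periods \<open>e c\<close>\<close>
  define E where "E = (\<Prod>c\<in>Fr. e c)"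
  have "E > 0" unfolding E_def using e by (intro prod_pos) blast
  have E: "c ^ (?p ^ E) = c" if "c \<in> Fr" for c
    using fixed[OF that, of "\<Prod>d\<in>Fr - {c}. e d"] that finite_Fr by (simp add: E_def prod.remove[of Fr c])
  obtain p where p: "p \<in> polys Fr" "p \<noteq> 0" "poly p x = 0" using assms by (auto simp: algebraic_over_def)
  have "\<exists>m>0. x ^ ((?p ^ E) ^ m) = x"
  proof (rule power_fixed_of_finite[of "{y. poly p y = 0}"])
    show "finite {y. poly p y = 0}" using p(2) by (rule poly_roots_finite)
    show "x \<in> {y. poly p y = 0}" using p by simp
    show "y ^ (?p ^ E) \<in> {y. poly p y = 0}" if "y \<in> {y. poly p y = 0}" for y
    proof -
      have "0 = (poly p y) ^ (?p ^ E)" using that prime_CHAR by (simp add: prime_gt_0_nat)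
      also have "\<dots> = (\<Sum>i\<le>degree p. (coeff p i * y ^ i) ^ (?p ^ E))"
        unfolding poly_altdef by (rule freshmans_dream_sum'[OF prime_CHAR refl])
      also have "\<dots> = poly p (y ^ (?p ^ E))"
        using E polysD[OF p(1)]
        by (simp add: poly_altdef power_mult_distrib power_mult[symmetric] mult.commute)
      finally show ?thesis by simp
    qed
    show "y = z" if "y ^ (?p ^ E) = z ^ (?p ^ E)" for y z :: 'c using frobenius_inj[OF that] .
  qed
  then obtain m where "m > 0" "x ^ (?p ^ (E * m)) = x" by (auto simp: power_mult)
  then show ?thesis using \<open>E > 0\<close> by (intro exI[of _ "E * m"]) auto
qed

text \<open>
  The constants represent all residue classes of \<open>K\<close>. If no polynomial over \<open>Fr\<close> were small at \<open>y \<in> k\<close>, then all nonzero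
  elements of \<open>Fr[y]\<close> would have absolute value 1, and so all of \<open>k\<close>, being algebraic over \<open>Fr(y)\<close>, would be bounded by 1.
  Hence \<open>y\<close> is close to an element \<open>c\<close> algebraic over \<open>Fr\<close>, and \<open>c\<close> is in \<open>K\<close> as the limit of the
  powers of \<open>y\<close> with exponents \<open>Q\<^sup>n\<close>, where \<open>c\<^sup>Q = c\<close> (the Teichmueller representative).
\<close>
lemma residue:
  assumes "x \<in> K" "abs_inf x \<le> 1"
  shows "\<exists>c\<in>C. abs_inf (x - c) < 1"
proof -
  obtain y where y: "y \<in> k" "abs_inf (x - y) < 1" using K_approx[OF assms(1), of 1] by auto
  have y1: "abs_inf y \<le> 1"
    using abs_diff_le[of x "x - y"] y(2) assms(2) by simp
  show ?thesis
  proof (cases "y \<in> Fr")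
    case True
    then show ?thesis using y(2) Fr_C by blast
  next
    case False
    have "\<exists>g\<in>polys Fr. g \<noteq> 0 \<and> abs_inf (poly g y) < 1"
    proof (rule ccontr)
      assume no: "\<not> (\<exists>g\<in>polys Fr. g \<noteq> 0 \<and> abs_inf (poly g y) < 1)"
      have le: "abs_inf (poly g y) \<le> 1" if "g \<in> polys Fr" for g
        unfolding poly_altdef
        by (intro abs_sum_le) (use that y1 in \<open>auto simp: abs_mult abs_power intro!: mult_le_one abs_polys_Fr power_le_one\<close>)
      obtain z where z: "z \<in> k" "abs_inf z > 1" using exists_large by blast
      obtain p where p: "p \<in> polys ((\<lambda>p. poly p y) ` polys Fr)" "p \<noteq> 0" "poly p z = 0"
        using function_field_algebraic[OF function_field y(1) False z(1)] by (auto simp: algebraic_over_def)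
      have "abs_inf (coeff p i) \<le> 1" for i
        using polysD[OF p(1), of i] le by auto
      moreover have "abs_inf (lead_coeff p) = 1"
      proof -
        obtain g where g: "g \<in> polys Fr" "lead_coeff p = poly g y" using polysD[OF p(1)] by blast
        then have "g \<noteq> 0" using p(2) by auto
        then have "\<not> abs_inf (poly g y) < 1" using no g(1) by blast
        then show ?thesis using le[OF g(1)] g(2) by simp
      qed
      ultimately have "abs_inf z \<le> 1" using p(3) by (rule root_abs_le)
      then show False using z(2) by simp
    qed
    then obtain g where g: "g \<in> polys Fr" "g \<noteq> 0" "abs_inf (poly g y) < 1" by blast
    then obtain c where c: "poly g c = 0" "abs_inf (y - c) < 1"
      using poly_small_root[of g y] abs_lead_coeff_Fr by blast
    have alg: "algebraic_over Fr c" using c g by (auto simp: algebraic_over_def)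
    then obtain e where e: "e > 0" "c ^ (CHAR('c) ^ e) = c" using algebraic_Fr_frobenius_fixed by blast
    have fixed: "c ^ (CHAR('c) ^ (e * n)) = c" for n
    proof (induction n)
      case (Suc n)
      have "c ^ (CHAR('c) ^ (e * Suc n)) = (c ^ (CHAR('c) ^ e)) ^ (CHAR('c) ^ (e * n))"
        by (simp only: mult_Suc_right power_add power_mult)
      then show ?case using Suc e(2) by simp
    qed simp
    have "(\<lambda>n. y ^ (CHAR('c) ^ (e * n))) \<longlonglongrightarrow> c"
      unfolding tendsto_iff_abs
    proof (rule tendsto_sandwich[OF _ _ tendsto_const])
      show "(\<lambda>n. abs_inf (y - c) ^ n) \<longlonglongrightarrow> 0" using c(2) by (intro LIMSEQ_realpow_zero) auto
      show "\<forall>\<^sub>F n in sequentially. abs_inf (y ^ CHAR('c) ^ (e * n) - c) \<le> abs_inf (y - c) ^ n"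
      proof (rule always_eventually, rule allI)
        fix n
        have p2: "2 \<le> CHAR('c)" by (rule prime_ge_2_nat[OF prime_CHAR])
        have "n \<le> e * n" using e(1) by simp
        also have "\<dots> < 2 ^ (e * n)" by simp
        also have "\<dots> \<le> CHAR('c) ^ (e * n)" using p2 by (rule power_mono) simp
        finally have "abs_inf (y - c) ^ (CHAR('c) ^ (e * n)) \<le> abs_inf (y - c) ^ n"
          using c(2) by (intro power_decreasing) auto
        then show "abs_inf (y ^ CHAR('c) ^ (e * n) - c) \<le> abs_inf (y - c) ^ n"
          using frobenius_diff[of y c "e * n"] by (simp add: fixed flip: abs_power)
      qed
    qed simp
    then have "c \<in> K"
      by (rule closed_K[rotated]) (use k_K k.power_in[OF y(1)] in blast)
    then have "c \<in> C" using alg by (simp add: const_inf_eq)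
    then show ?thesis using abs_close_trans[OF y(2) c(2)] by blast
  qed
qed

end

section \<open>Counting cosets\<close>

definition coset :: "'a::ab_group_add \<Rightarrow> 'a set \<Rightarrow> 'a set" where
  "coset x W = (+) x ` W"

definition add_subgroup :: "'a::ab_group_add set \<Rightarrow> bool" where
  "add_subgroup W \<longleftrightarrow> 0 \<in> W \<and> (\<forall>x\<in>W. \<forall>y\<in>W. x - y \<in> W)"

definition cosets :: "'a::ab_group_add set \<Rightarrow> 'a set \<Rightarrow> 'a set set" where
  "cosets V W = (\<lambda>x. coset x W) ` V"

definition index :: "'a::ab_group_add set \<Rightarrow> 'a set \<Rightarrow> nat" where
  "index V W = card (cosets V W)"

lemma add_subgroupD:
  assumes "add_subgroup W"
  shows "0 \<in> W" "x \<in> W \<Longrightarrow> y \<in> W \<Longrightarrow> x - y \<in> W" "x \<in> W \<Longrightarrow> - x \<in> W" "x \<in> W \<Longrightarrow> y \<in> W \<Longrightarrow> x + y \<in> W"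
proof -
  show *: "0 \<in> W" "x \<in> W \<Longrightarrow> y \<in> W \<Longrightarrow> x - y \<in> W" for x y
    using assms by (auto simp: add_subgroup_def)
  show uminus: "x \<in> W \<Longrightarrow> - x \<in> W" for x using *(1) *(2)[of 0 x] by simp
  show "x \<in> W \<Longrightarrow> y \<in> W \<Longrightarrow> x + y \<in> W" using *(2)[of x "- y"] uminus by simp
qed

lemma mem_coset: "add_subgroup W \<Longrightarrow> y \<in> coset x W \<longleftrightarrow> y - x \<in> W"
proof
  assume "y - x \<in> W"
  then show "y \<in> coset x W" unfolding coset_def by (intro image_eqI[of _ _ "y - x"]) auto
qed (auto simp: coset_def)

lemma coset_eq_iff:
  assumes "add_subgroup W"
  shows "coset x W = coset y W \<longleftrightarrow> x - y \<in> W"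
proof
  assume "coset x W = coset y W"
  moreover have "x \<in> coset x W" using mem_coset[OF assms, of x x] add_subgroupD[OF assms] by simp
  ultimately show "x - y \<in> W" using mem_coset[OF assms, of x y] by simp
next
  assume *: "x - y \<in> W"
  have "z - x \<in> W \<longleftrightarrow> z - y \<in> W" for z
    using add_subgroupD(2)[OF assms, of "z - y" "x - y"] add_subgroupD(4)[OF assms, of "z - x" "x - y"] *
    by (auto simp: algebra_simps)
  then show "coset x W = coset y W" by (auto simp: mem_coset[OF assms])
qed

lemma card_image_eq_if_same_fibres:
  assumes "\<And>u v. u \<in> U \<Longrightarrow> v \<in> U \<Longrightarrow> g u = g v \<longleftrightarrow> h u = h v"
  shows "card (g ` U) = card (h ` U) \<and> (finite (g ` U) \<longleftrightarrow> finite (h ` U))"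
proof -
  have "bij_betw (\<lambda>y. h (inv_into U g y)) (g ` U) (h ` U)"
    unfolding bij_betw_def
  proof
    have h: "h (inv_into U g (g u)) = h u" if "u \<in> U" for u
      using assms[of "inv_into U g (g u)" u] that by (auto simp: inv_into_into f_inv_into_f)
    show "inj_on (\<lambda>y. h (inv_into U g y)) (g ` U)"
      by (rule inj_onI) (use assms h in auto)
    show "(\<lambda>y. h (inv_into U g y)) ` g ` U = h ` U"
      using h by (auto simp: image_image)
  qed
  then show ?thesis using bij_betw_same_card bij_betw_finite by blast
qed

text \<open>
  The common form of the isomorphism theorems for quotients used below: it suffices that \<open>f\<close> respects and reflects
  congruence and is surjective up to congruence.
\<close>
lemma index_eq:
  assumes "add_subgroup W'" "add_subgroup W" "\<And>u. u \<in> U \<Longrightarrow> f u \<in> V"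
    and "\<And>u v. u \<in> U \<Longrightarrow> v \<in> U \<Longrightarrow> u - v \<in> W' \<longleftrightarrow> f u - f v \<in> W"
    and "\<And>v. v \<in> V \<Longrightarrow> \<exists>u\<in>U. f u - v \<in> W"
  shows "index U W' = index V W" "finite (cosets U W') \<longleftrightarrow> finite (cosets V W)"
proof -
  have *: "cosets V W = (\<lambda>u. coset (f u) W) ` U"
    unfolding cosets_def
  proof (intro subset_antisym subsetI)
    fix Y assume "Y \<in> (\<lambda>x. coset x W) ` V"
    then obtain v where v: "v \<in> V" "Y = coset v W" by blast
    then obtain u where "u \<in> U" "f u - v \<in> W" using assms(5) by blast
    then show "Y \<in> (\<lambda>u. coset (f u) W) ` U" using v coset_eq_iff[OF assms(2)] by blast
  qed (use assms(3) in auto)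
  have "card (cosets U W') = card (cosets V W) \<and> (finite (cosets U W') \<longleftrightarrow> finite (cosets V W))"
    unfolding * unfolding cosets_def
    by (rule card_image_eq_if_same_fibres) (simp add: coset_eq_iff assms)
  then show "index U W' = index V W" "finite (cosets U W') \<longleftrightarrow> finite (cosets V W)"
    by (auto simp: index_def)
qed

text \<open>
  With a chosen representative \<open>\<rho>\<close> of each coset of \<open>U\<close>, an element \<open>v\<close> modulo \<open>W\<close> amounts to \<open>v\<close> modulo \<open>U\<close> together with
  \<open>v - \<rho> v\<close> modulo \<open>W\<close>.
\<close>
lemma index_tower:
  assumes "add_subgroup W" "add_subgroup U" "add_subgroup V" "W \<subseteq> U" "U \<subseteq> V"
  shows "index V W = index V U * index U W"
    and "finite (cosets V W) \<longleftrightarrow> finite (cosets V U \<times> cosets U W)"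
proof -
  define \<rho> where "\<rho> v = (SOME r. r \<in> coset v U)" for v
  have \<rho>: "\<rho> v - v \<in> U" for v
  proof -
    have "v \<in> coset v U" using add_subgroupD(1)[OF assms(2)] by (simp add: mem_coset[OF assms(2)])
    then have "\<rho> v \<in> coset v U" unfolding \<rho>_def by (rule someI)
    then show ?thesis by (simp add: mem_coset[OF assms(2)])
  qed
  have \<rho>': "v - \<rho> v \<in> U" for v using add_subgroupD(3)[OF assms(2) \<rho>[of v]] by simp
  have \<rho>_V: "\<rho> v \<in> V" if "v \<in> V" for v
    using add_subgroupD(4)[OF assms(3), of "\<rho> v - v" v] \<rho>[of v] assms(5) that by auto
  have \<rho>_eq: "\<rho> v = \<rho> v'" if "v - v' \<in> U" for v v'
    using that coset_eq_iff[OF assms(2), of v v'] by (simp add: \<rho>_def)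
  define g where "g v = (coset v U, coset (v - \<rho> v) W)" for v
  have img: "g ` V = cosets V U \<times> cosets U W"
  proof (intro subset_antisym subsetI)
    fix Y assume "Y \<in> g ` V"
    then show "Y \<in> cosets V U \<times> cosets U W" using \<rho>' by (auto simp: g_def cosets_def)
  next
    fix Y assume "Y \<in> cosets V U \<times> cosets U W"
    then obtain v u where Y: "v \<in> V" "u \<in> U" "Y = (coset v U, coset u W)" by (auto simp: cosets_def)
    have e: "\<rho> v + u - v \<in> U" using add_subgroupD(4)[OF assms(2) \<rho>[of v] Y(2)] by (simp add: algebra_simps)
    then have "\<rho> (\<rho> v + u) = \<rho> v" by (rule \<rho>_eq)
    then have "g (\<rho> v + u) = Y"
      using coset_eq_iff[OF assms(2), of "\<rho> v + u" v] e by (simp add: g_def Y(3))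
    moreover have "\<rho> v + u \<in> V" using \<rho>_V[OF Y(1)] Y(2) assms(5) add_subgroupD(4)[OF assms(3)] by auto
    ultimately show "Y \<in> g ` V" by blast
  qed
  have "g v = g v' \<longleftrightarrow> coset v W = coset v' W" for v v'
  proof
    assume eq: "g v = g v'"
    then have "v - v' \<in> U" "(v - \<rho> v) - (v' - \<rho> v') \<in> W"
      by (auto simp: g_def coset_eq_iff assms)
    then show "coset v W = coset v' W" using \<rho>_eq[of v v'] by (simp add: coset_eq_iff assms)
  next
    assume "coset v W = coset v' W"
    then have "v - v' \<in> W" by (simp add: coset_eq_iff assms)
    then have *: "v - v' \<in> W" "v - v' \<in> U" using assms(4) by auto
    then show "g v = g v'" using \<rho>_eq[of v v'] by (simp add: g_def coset_eq_iff assms)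
  qed
  then have "card (g ` V) = card (cosets V W) \<and> (finite (g ` V) \<longleftrightarrow> finite (cosets V W))"
    unfolding cosets_def by (intro card_image_eq_if_same_fibres) blast
  then show "index V W = index V U * index U W" "finite (cosets V W) \<longleftrightarrow> finite (cosets V U \<times> cosets U W)"
    by (simp_all add: img index_def card_cartesian_product)
qed

lemma index_trivial: "index V {0} = card V"
  by (auto simp: index_def cosets_def coset_def intro!: card_image inj_onI)

lemma card_eq_index_mult:
  assumes "add_subgroup W" "add_subgroup V" "W \<subseteq> V"
  shows "card V = index V W * card W"
  using index_tower(1)[of "{0}" W V] assms add_subgroupD(1)[OF assms(1)]
  by (auto simp: index_trivial add_subgroup_def)

lemma index_self: "add_subgroup V \<Longrightarrow> index V V = 1"
proof -
  assume V: "add_subgroup V"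
  have "cosets V V = {V}"
  proof -
    have "coset x V = coset 0 V" if "x \<in> V" for x using that by (simp add: coset_eq_iff V)
    moreover have "coset 0 V = V" by (auto simp: coset_def)
    ultimately show ?thesis using add_subgroupD(1)[OF V] by (auto simp: cosets_def)
  qed
  then show ?thesis by (simp add: index_def)
qed

lemma (in subring_of_type) submodule_add_subgroup: "submodule_of S M \<Longrightarrow> add_subgroup M"
proof -
  assume M: "submodule_of S M"
  have "x + (- 1) * y \<in> M" if "x \<in> M" "y \<in> M" for x y
    using M that uminus_in[OF one_in] unfolding submodule_of_def by blast
  then show ?thesis using M by (simp add: add_subgroup_def submodule_of_def)
qed

section \<open>The ring of functions regular outside infinity\<close>

context infinite_place
begin

lemma A_k: "A \<subseteq> k" by (auto simp: ring_A_def)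

lemma subring_A: "subring A RT"
proof -
  have "subring R RT" if "R \<in> closed_points Fr k" for R using that by (auto simp: closed_points_def)
  then show ?thesis unfolding ring_A_def subring_iff by auto
qed

sublocale A: subring_of_type A by (rule subring_of_type.intro) (rule subring_A)

lemma Fr_A: "Fr \<subseteq> A" using Fr_k by (auto simp: ring_A_def closed_points_def)

lemma A_K: "A \<subseteq> K" using A_k k_K by blast

text \<open>\<open>A\<close> is an intersection of valuation rings.\<close>
lemma A_integrally_closed:
  assumes "x \<in> k" "integral_over A x"
  shows "x \<in> A"
proof -
  have "x \<in> R" if R: "R \<in> closed_points Fr k" "R \<noteq> point_inf k" for R
  proof -
    interpret R: subring_of_type R
      by (rule subring_of_type.intro) (use R in \<open>simp add: closed_points_def\<close>)
    have "A \<subseteq> R" using R by (auto simp: ring_A_def)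
    then have "integral_over R x" using A.integral_over_mono assms(2) by blast
    moreover have "x \<in> R \<or> inverse x \<in> R" using R(1) assms(1) by (auto simp: closed_points_def)
    ultimately show ?thesis by (intro R.integral_in_valuation_ring)
  qed
  then show ?thesis using assms(1) by (auto simp: ring_A_def)
qed

text \<open>
  A non-constant \<open>x\<close> is transcendental over \<open>Fr\<close>, so some valuation ring of \<open>k\<close> does not contain it. For \<open>x \<in> A\<close> this can
  only be the one at infinity.
\<close>
lemma abs_A_nonconstant:
  assumes "x \<in> A" "x \<notin> Fr"
  shows "abs_inf x > 1"
proof -
  have xk: "x \<in> k" using assms(1) A_k by blast
  have "\<not> algebraic_over Fr x"
    using function_field xk assms(2) algebraic_iff[OF Fr.subring, of x] by (auto simp: function_field_def)
  then have "\<not> integral_over Fr x"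
    unfolding Fr.integral_over_iff algebraic_over_def by fastforce
  then obtain R where R: "subring R RT" "Fr \<subseteq> R" "R \<subseteq> k" "x \<notin> R" "\<forall>y\<in>k. y \<in> R \<or> inverse y \<in> R"
    using exists_valuation_ring[OF subfield_k Fr.subring Fr_k xk] by blast
  then have "R \<in> closed_points Fr k" using xk by (auto simp: closed_points_def)
  then have "R = point_inf k" using R(4) assms(1) by (auto simp: ring_A_def)
  then show ?thesis using R(4) xk by (auto simp: point_inf_def)
qed

lemma abs_A_ge_1: "x \<in> A \<Longrightarrow> x \<noteq> 0 \<Longrightarrow> abs_inf x \<ge> 1"
  using abs_A_nonconstant[of x] abs_Fr[of x] by fastforce

lemma abs_A: "x \<in> A \<Longrightarrow> x \<noteq> 0 \<Longrightarrow> \<exists>n::nat. abs_inf x = real q ^ n"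
proof -
  assume x: "x \<in> A" "x \<noteq> 0"
  obtain n where n: "abs_inf x = real q powi n" using abs_value_group x A_K by blast
  have "n \<ge> 0"
  proof (rule ccontr)
    assume "\<not> n \<ge> 0"
    then have "real q powi n < real q powi 0" using q_ge_2 by (intro power_int_strict_increasing) auto
    then show False using abs_A_ge_1[OF x] n by simp
  qed
  then show ?thesis using n by (intro exI[of _ "nat n"]) (simp add: power_int_def)
qed

lemma abs_gap: "x \<in> K \<Longrightarrow> abs_inf x < real q ^ Suc m \<Longrightarrow> abs_inf x \<le> real q ^ m"
proof (cases "x = 0")
  case False
  assume x: "x \<in> K" "abs_inf x < real q ^ Suc m"
  obtain n where n: "abs_inf x = real q powi n" using abs_value_group x False by blast
  have q1: "1 < real q" using q_ge_2 by simp
  have "n < int (Suc m)"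
  proof (rule ccontr)
    assume "\<not> n < int (Suc m)"
    then have "real q powi int (Suc m) \<le> real q powi n" using q1 by (intro power_int_increasing) auto
    then show False using x(2) n by (simp only: power_int_of_nat)
  qed
  then have "real q powi n \<le> real q powi int m" using q1 by (intro power_int_increasing) auto
  then show ?thesis using n by (simp only: power_int_of_nat)
qed simp

text \<open>The Riemann-Roch spaces of the multiples of the point at infinity.\<close>
definition A_le :: "nat \<Rightarrow> 'c set" where
  "A_le m = {x \<in> A. abs_inf x \<le> real q ^ m}"

lemma A_le_submodule: "submodule_of Fr (A_le m)"
proof -
  have "abs_inf (x + y) \<le> real q ^ m" if "abs_inf x \<le> real q ^ m" "abs_inf y \<le> real q ^ m" for x y :: 'c
    using abs_add_le[of x y] that by linarith
  moreover have "abs_inf (c * x) \<le> real q ^ m" if "c \<in> Fr" "abs_inf x \<le> real q ^ m" for c x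
    using abs_Fr[of c] that by (cases "c = 0") (auto simp: abs_mult)
  ultimately show ?thesis using Fr_A by (auto simp: A_le_def submodule_of_def)
qed

lemma A_le_subgroup: "add_subgroup (A_le m)"
  using Fr.submodule_add_subgroup A_le_submodule .

text \<open>
  Each step from \<open>m\<close> to \<open>m + 1\<close> adds at most as many cosets as there are leading terms, that is, residues of
  \<open>x/x\<^sub>0\<close> for one \<open>x\<^sub>0\<close> of the new absolute value.
\<close>
lemma finite_A_le: "finite (A_le m)"
proof (induction m)
  case 0
  have "A_le 0 \<subseteq> Fr" using abs_A_nonconstant by (fastforce simp: A_le_def)
  then show ?case using finite_Fr finite_subset by blast
next
  case (Suc m)
  show ?case
  proof (cases "\<exists>x\<in>A. abs_inf x = real q ^ Suc m")
    case False
    have "A_le (Suc m) \<subseteq> A_le m"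
    proof
      fix x assume "x \<in> A_le (Suc m)"
      then have x: "x \<in> A" "abs_inf x \<le> real q ^ Suc m" by (auto simp: A_le_def)
      then have "abs_inf x < real q ^ Suc m" using False by force
      then show "x \<in> A_le m" using abs_gap x(1) A_K by (auto simp: A_le_def)
    qed
    then show ?thesis using Suc finite_subset by blast
  next
    case True
    then obtain x0 where x0: "x0 \<in> A" "abs_inf x0 = real q ^ Suc m" by blast
    have pos: "real q ^ Suc m > 0" using q_ge_2 by simp
    then have x0_0: "x0 \<noteq> 0" using x0(2) by (metis dist_self less_irrefl)
    define B where "B c = {x \<in> A_le (Suc m). abs_inf (x - c * x0) < real q ^ Suc m}" for c
    have "A_le (Suc m) \<subseteq> (\<Union>c\<in>C. B c)"
    proof
      fix x assume x: "x \<in> A_le (Suc m)"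
      then have "x / x0 \<in> K" "abs_inf (x / x0) \<le> 1"
        using x0 A_K pos by (auto simp: A_le_def abs_divide divide_le_eq)
      then obtain c where c: "c \<in> C" "abs_inf (x / x0 - c) < 1" using residue by blast
      have "x - c * x0 = (x / x0 - c) * x0" using x0_0 by (simp add: field_simps)
      then have "abs_inf (x - c * x0) < real q ^ Suc m"
        using c(2) x0(2) q_ge_2 by (simp only: abs_mult) simp
      then show "x \<in> (\<Union>c\<in>C. B c)" using x c(1) by (auto simp: B_def)
    qed
    moreover have "finite (B c)" for c
    proof (cases "B c = {}")
      case False
      then obtain y where y: "y \<in> B c" by blast
      have "B c \<subseteq> (+) y ` A_le m"
      proof
        fix x assume x: "x \<in> B c"
        have "abs_inf (x - y) < real q ^ Suc m"
          using abs_diff_le[of "x - c * x0" "y - c * x0"] x y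
          by (simp add: B_def max_def split: if_splits)
        moreover have "x - y \<in> A" using x y by (auto simp: B_def A_le_def)
        ultimately have "x - y \<in> A_le m" using abs_gap A_K by (auto simp: A_le_def)
        then show "x \<in> (+) y ` A_le m" by (intro image_eqI[of _ _ "x - y"]) auto
      qed
      then show ?thesis using Suc finite_subset by blast
    qed auto
    ultimately show ?thesis using finite_C finite_subset by blast
  qed
qed

lemma card_A_le_pos: "card (A_le m) > 0"
  using finite_A_le add_subgroupD(1)[OF A_le_subgroup] by (auto simp: card_gt_0_iff)

text \<open>
  If every leading term of degree \<open>m + 1\<close> is attained in \<open>A\<close>, the constants \<open>c \<in> C\<close>, through elements of \<open>A\<close> with the leading
  term \<open>c x\<^sub>0\<close>, represent the cosets of \<open>A_le m\<close>.
\<close>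
lemma card_A_le_Suc:
  assumes full: "\<And>z. z \<in> k \<Longrightarrow> abs_inf z = real q ^ Suc m \<Longrightarrow> \<exists>y\<in>A. abs_inf (z - y) < abs_inf z"
  shows "card (A_le (Suc m)) = q * card (A_le m)"
proof -
  have "real q ^ Suc m \<in> abs_inf ` (K - {0})"
    unfolding abs_normalized by (intro range_eqI[of _ _ "int (Suc m)"]) (simp only: power_int_of_nat)
  then obtain x0 where x0: "x0 \<in> K" "abs_inf x0 = real q ^ Suc m" by fastforce
  have pos: "real q ^ Suc m > 0" using q_ge_2 by simp
  then have x0_0: "x0 \<noteq> 0" using x0(2) by (metis dist_self less_irrefl)
  have "\<exists>y\<in>A. abs_inf (y - c * x0) < real q ^ Suc m" if c: "c \<in> C" for c
  proof (cases "c = 0")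
    case True
    then show ?thesis using pos by (intro bexI[of _ 0]) auto
  next
    case False
    have "c * x0 \<in> K" using c C_K x0(1) by auto
    then obtain z where z: "z \<in> k" "abs_inf (c * x0 - z) < real q ^ Suc m" using K_approx pos by blast
    have cx: "abs_inf (c * x0) = real q ^ Suc m" by (simp add: abs_mult abs_C[OF c False] x0(2))
    then have "abs_inf z = real q ^ Suc m"
      using abs_eq_if_close[of z "c * x0"] z(2) by (simp add: abs_diff_commute)
    moreover obtain y where "y \<in> A" "abs_inf (z - y) < abs_inf z" using full[OF z(1)] calculation by blast
    ultimately have "abs_inf (c * x0 - y) < real q ^ Suc m" using abs_close_trans[OF z(2), of y] by simp
    then show ?thesis using \<open>y \<in> A\<close> by (metis abs_diff_commute)
  qed
  then obtain y where y: "\<And>c. c \<in> C \<Longrightarrow> y c \<in> A" "\<And>c. c \<in> C \<Longrightarrow> abs_inf (y c - c * x0) < real q ^ Suc m"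
    by metis
  have le: "real q ^ m < real q ^ Suc m" using q_ge_2 by (intro power_strict_increasing) auto
  have "index C {0} = index (A_le (Suc m)) (A_le m)"
  proof (rule index_eq(1)[where f = y])
    fix c assume c: "c \<in> C"
    have "abs_inf (c * x0) \<le> real q ^ Suc m"
      using abs_C[OF c] x0(2) pos by (cases "c = 0") (auto simp: abs_mult)
    then have "abs_inf (y c) \<le> real q ^ Suc m"
      using abs_add_le[of "y c - c * x0" "c * x0"] y(2)[OF c] by simp
    then show "y c \<in> A_le (Suc m)" using y(1)[OF c] by (simp add: A_le_def)
  next
    fix c d assume cd: "c \<in> C" "d \<in> C"
    show "c - d \<in> {0} \<longleftrightarrow> y c - y d \<in> A_le m"
    proof (cases "c = d")
      case True
      then show ?thesis using add_subgroupD(1)[OF A_le_subgroup] by simp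
    next
      case False
      have cdx: "abs_inf (c * x0 - d * x0) = real q ^ Suc m"
        using abs_C[of "c - d"] cd False x0(2) by (auto simp: abs_mult simp flip: left_diff_distrib)
      have "y c - y d - (c * x0 - d * x0) = (y c - c * x0) - (y d - d * x0)" by simp
      then have "abs_inf (y c - y d - (c * x0 - d * x0)) < real q ^ Suc m"
        using abs_diff_le[of "y c - c * x0" "y d - d * x0"] y(2)[OF cd(1)] y(2)[OF cd(2)] by (simp only:)
      then have "abs_inf (y c - y d) = real q ^ Suc m"
        using abs_eq_if_close[of "y c - y d" "c * x0 - d * x0"] cdx by simp
      then have "y c - y d \<notin> A_le m" using le by (simp add: A_le_def)
      then show ?thesis using False by simp
    qed
  next
    fix u assume u: "u \<in> A_le (Suc m)"
    then have "u / x0 \<in> K" "abs_inf (u / x0) \<le> 1"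
      using x0 A_K pos by (auto simp: A_le_def abs_divide divide_le_eq)
    then obtain c where c: "c \<in> C" "abs_inf (u / x0 - c) < 1" using residue by blast
    have "u - c * x0 = (u / x0 - c) * x0" using x0_0 by (simp add: field_simps)
    then have "abs_inf (u - c * x0) < real q ^ Suc m"
      using mult_strict_right_mono[OF c(2) pos] x0(2) by (simp only: abs_mult mult_1)
    then have "abs_inf (y c - u) < real q ^ Suc m"
      using abs_close_trans[OF y(2)[OF c(1)], of u] by (simp add: abs_diff_commute)
    moreover have "y c - u \<in> A" using u y(1)[OF c(1)] by (auto simp: A_le_def)
    ultimately have "y c - u \<in> A_le m" using abs_gap A_K by (auto simp: A_le_def)
    then show "\<exists>c\<in>C. y c - u \<in> A_le m" using c(1) by blast
  qed (auto simp: A_le_subgroup add_subgroup_def[of "{0}"])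
  moreover have "card (A_le (Suc m)) = index (A_le (Suc m)) (A_le m) * card (A_le m)"
    by (rule card_eq_index_mult[OF A_le_subgroup A_le_subgroup]) (use le in \<open>auto simp: A_le_def\<close>)
  ultimately show ?thesis by (simp add: index_trivial)
qed

end

section \<open>Cocompactness and the product formula\<close>

locale affine_curve = infinite_place Fr k
  for Fr k :: "'c::{alg_closed_field, complete_space} set" +
  fixes a :: 'c
  assumes a_A: "a \<in> A" and a_Fr: "a \<notin> Fr"
begin

text \<open>
  A multiple \<open>b z\<close> with \<open>b \<in> Fr[a]\<close> is integral over \<open>Fr[a]\<close> and hence in \<open>A\<close>. The leading term of \<open>b\<close> is \<open>c a\<^sup>n\<close> with \<open>c \<in> Fr\<close>,
  so \<open>b z/c\<close> has the leading term of \<open>a\<^sup>n z\<close>.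
\<close>
lemma leading_terms:
  assumes "z \<in> k" "z \<noteq> 0"
  shows "\<exists>s0. \<forall>s\<ge>s0. \<exists>y\<in>A. abs_inf (a ^ s * z - y) < abs_inf (a ^ s * z)"
proof -
  have ak: "a \<in> k" using a_A A_k by blast
  have a1: "abs_inf a > 1" using abs_A_nonconstant[OF a_A a_Fr] .
  have a0: "a \<noteq> 0" using a_Fr by auto
  have "algebraic_over (Fr.adjoin a) z"
    using function_field_algebraic[OF function_field ak a_Fr assms(1)] by (simp add: Fr.adjoin_def)
  then obtain b where b: "b \<in> Fr.adjoin a" "b \<noteq> 0" "integral_over (Fr.adjoin a) (b * z)"
    using subring_of_type.integral_multiple[OF subring_of_type.intro[OF Fr.subring_adjoin]] by blast
  have sub: "Fr.adjoin a \<subseteq> A" by (rule Fr.adjoin_minimal) (use subring_A Fr_A a_A in auto)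
  have "integral_over A (b * z)"
    using subring_of_type.integral_over_mono[OF subring_of_type.intro[OF Fr.subring_adjoin] sub b(3)] .
  moreover have "b * z \<in> k" using b(1) sub A_k assms(1) by auto
  ultimately have bz: "b * z \<in> A" by (intro A_integrally_closed)
  obtain g where g: "g \<in> polys Fr" "b = poly g a" using b(1) by (auto simp: Fr.adjoin_def)
  have g0: "g \<noteq> 0" using g b(2) by auto
  define c where "c = lead_coeff g"
  have c: "c \<in> Fr" "c \<noteq> 0" using g(1) g0 by (auto simp: c_def dest: polysD)
  have dom: "abs_inf (b - c * a ^ degree g) < abs_inf a ^ degree g"
    unfolding c_def g(2) by (rule poly_dominant) (use abs_polys_Fr[OF g(1)] a1 in auto)
  show ?thesis
  proof (intro exI[of _ "degree g"] allI impI)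
    fix s assume s: "s \<ge> degree g"
    define y where "y = inverse c * a ^ (s - degree g) * (b * z)"
    have "y \<in> A" unfolding y_def using c Fr_A a_A bz Fr.inverse_in[OF c(1)] by auto
    moreover have "abs_inf (a ^ s * z - y) < abs_inf (a ^ s * z)"
    proof -
      have "a ^ s = a ^ (s - degree g) * a ^ degree g" using s by (simp flip: power_add)
      then have "a ^ s * z - y = - (inverse c * a ^ (s - degree g) * z) * (b - c * a ^ degree g)"
        using c(2) by (simp add: y_def field_simps)
      then have "abs_inf (a ^ s * z - y) = abs_inf (a ^ (s - degree g) * z) * abs_inf (b - c * a ^ degree g)"
        using abs_Fr[OF c] by (simp add: abs_mult abs_inverse)
      also have "\<dots> < abs_inf (a ^ (s - degree g) * z) * abs_inf a ^ degree g"
        using dom assms(2) a0 by (intro mult_strict_left_mono) (auto simp: abs_mult abs_power)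
      also have "\<dots> = abs_inf (a ^ s * z)"
        using \<open>a ^ s = _\<close> by (simp add: abs_mult abs_power)
      finally show ?thesis .
    qed
    ultimately show "\<exists>y\<in>A. abs_inf (a ^ s * z - y) < abs_inf (a ^ s * z)" by blast
  qed
qed

text \<open>
  Up to powers of \<open>a\<close> there are only finitely many leading terms \<open>c u\<^sup>j\<close>, with \<open>c\<close> a nonzero constant, \<open>u\<close> of absolute value \<open>q\<close>
  and \<open>j\<close> below the degree \<open>e\<close> of \<open>a\<close>. So one power \<open>a\<^sup>S\<close> works for all of them.
\<close>
lemma A_cofinite:
  "\<exists>j0. \<forall>N\<ge>j0. \<forall>z\<in>k. abs_inf z = real q ^ N \<longrightarrow> (\<exists>y\<in>A. abs_inf (z - y) < abs_inf z)"
proof -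
  have a0: "a \<noteq> 0" using a_Fr by auto
  have a1: "abs_inf a > 1" using abs_A_nonconstant[OF a_A a_Fr] .
  obtain e where e: "abs_inf a = real q ^ e" using abs_A[OF a_A a0] by blast
  have e0: "e > 0" using e a1 by (cases e) auto
  have "real q ^ 1 \<in> abs_inf ` (K - {0})"
    unfolding abs_normalized by (intro range_eqI[of _ _ 1]) simp
  then obtain u where u: "u \<in> K" "abs_inf u = real q" by fastforce
  then have u0: "u \<noteq> 0" using q_ge_2 by auto
  have qpos: "real q ^ j > 0" for j using q_ge_2 by simp
  have "\<exists>z\<in>k. abs_inf (c * u ^ j - z) < real q ^ j" if "c \<in> C" for c j
    using K_approx[of "c * u ^ j" "real q ^ j"] that u(1) C_K qpos by blast
  then obtain Z where Z: "\<And>c j. c \<in> C \<Longrightarrow> Z c j \<in> k" "\<And>c j. c \<in> C \<Longrightarrow> abs_inf (c * u ^ j - Z c j) < real q ^ j"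
    by metis
  have absZ: "abs_inf (Z c j) = real q ^ j" if "c \<in> C - {0}" for c j
    using abs_eq_if_close[of "Z c j" "c * u ^ j"] Z(2)[of c j] that abs_C[of c] u(2)
    by (auto simp: abs_mult abs_power abs_diff_commute)
  have "\<exists>s0. \<forall>s\<ge>s0. \<exists>y\<in>A. abs_inf (a ^ s * Z c j - y) < abs_inf (a ^ s * Z c j)" if "c \<in> C - {0}" for c j
  proof (rule leading_terms)
    show "Z c j \<in> k" using Z(1) that by blast
    show "Z c j \<noteq> 0" using absZ[OF that, of j] qpos[of j] by auto
  qed
  then obtain s0 where s0: "\<And>c j s. c \<in> C - {0} \<Longrightarrow> s \<ge> s0 c j \<Longrightarrow>
      \<exists>y\<in>A. abs_inf (a ^ s * Z c j - y) < abs_inf (a ^ s * Z c j)" by metis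
  define S where "S = (\<Sum>c\<in>C - {0}. \<Sum>j<e. s0 c j)"
  have S: "s0 c j \<le> S" if "c \<in> C - {0}" "j < e" for c j
  proof -
    have "s0 c j \<le> (\<Sum>j<e. s0 c j)" using that(2) by (intro member_le_sum) auto
    also have "\<dots> \<le> S" unfolding S_def using that(1) finite_C by (intro member_le_sum) auto
    finally show ?thesis .
  qed
  show ?thesis
  proof (intro exI[of _ "e * S"] allI impI ballI)
    fix N z assume N: "N \<ge> e * S" and z: "z \<in> k" "abs_inf z = real q ^ N"
    define s where "s = N div e"
    define j where "j = N mod e"
    have Nsj: "N = e * s + j" and j: "j < e" using e0 by (auto simp: s_def j_def)
    have sS: "s \<ge> S" unfolding s_def using N e0 by (simp add: less_eq_div_iff_mult_less_eq mult.commute)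
    define w where "w = a ^ s * u ^ j"
    have w: "w \<in> K" "w \<noteq> 0" "abs_inf w = real q ^ N"
      using a_A A_K u u0 a0 by (auto simp: w_def abs_mult abs_power e Nsj power_add power_mult)
    have "z / w \<in> K" "abs_inf (z / w) \<le> 1"
      using z w k_K qpos[of N] by (auto simp: abs_divide)
    then obtain c where c: "c \<in> C" "abs_inf (z / w - c) < 1" using residue by blast
    have "c \<noteq> 0" using c(2) z(2) w(3) qpos[of N] by (auto simp: abs_divide)
    have "z - c * w = (z / w - c) * w" using w(2) by (simp add: field_simps)
    then have 1: "abs_inf (z - c * w) < real q ^ N"
      using c(2) w(3) qpos[of N] by (simp only: abs_mult) (simp add: mult_less_cancel_right1)
    have "c * w - a ^ s * Z c j = a ^ s * (c * u ^ j - Z c j)" by (simp add: w_def algebra_simps)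
    then have 2: "abs_inf (c * w - a ^ s * Z c j) < real q ^ N"
      using Z(2)[OF c(1), of j] qpos[of "e * s"]
      by (simp add: abs_mult abs_power e Nsj power_add flip: power_mult)
    obtain y where y: "y \<in> A" "abs_inf (a ^ s * Z c j - y) < abs_inf (a ^ s * Z c j)"
      using s0[of c j s] S[of c j] c(1) \<open>c \<noteq> 0\<close> sS j by force
    have "abs_inf (a ^ s * Z c j) = real q ^ N"
      using absZ[of c j] c(1) \<open>c \<noteq> 0\<close> by (simp add: abs_mult abs_power e Nsj power_add power_mult)
    then have "abs_inf (z - y) < real q ^ N"
      using abs_close_trans[OF abs_close_trans[OF 1 2]] y(2) by simp
    then show "\<exists>y\<in>A. abs_inf (z - y) < abs_inf z" using y(1) z(2) by auto
  qed
qed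

text \<open>A degree from which on all leading terms are attained in \<open>A\<close>.\<close>
definition j\<^sub>0 where
  "j\<^sub>0 = (SOME j0. \<forall>N\<ge>j0. \<forall>z\<in>k. abs_inf z = real q ^ N \<longrightarrow> (\<exists>y\<in>A. abs_inf (z - y) < abs_inf z))"

lemma A_approx: "N \<ge> j\<^sub>0 \<Longrightarrow> z \<in> k \<Longrightarrow> abs_inf z = real q ^ N \<Longrightarrow> \<exists>y\<in>A. abs_inf (z - y) < abs_inf z"
  using someI_ex[OF A_cofinite] unfolding j\<^sub>0_def by blast

lemma card_A_le: "m \<ge> j\<^sub>0 \<Longrightarrow> card (A_le (m + n)) = q ^ n * card (A_le m)"
proof (induction n)
  case (Suc n)
  have "card (A_le (Suc (m + n))) = q * card (A_le (m + n))"
    by (rule card_A_le_Suc) (use A_approx[of "Suc (m + n)"] Suc.prems in auto)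
  then show ?case using Suc by simp
qed simp

text \<open>Division with remainder by \<open>\<alpha>\<close>: as long as the remainder is large, its leading term can be cancelled.\<close>
lemma A_reduction:
  assumes "\<alpha> \<in> A" "\<alpha> \<noteq> 0" "abs_inf \<alpha> = real q ^ v" "m \<ge> j\<^sub>0" "x \<in> A"
  shows "\<exists>y\<in>A. x - \<alpha> * y \<in> A_le (m + v)"
proof -
  have "\<exists>y\<in>A. x - \<alpha> * y \<in> A_le (m + v)" if "x \<in> A" "abs_inf x \<le> real q ^ N" for N x
    using that
  proof (induction N arbitrary: x rule: less_induct)
    case (less N)
    show ?case
    proof (cases "x \<in> A_le (m + v)")
      case True
      then show ?thesis by (intro bexI[of _ 0]) auto
    next
      case False
      then have x0: "x \<noteq> 0" using add_subgroupD(1)[OF A_le_subgroup] by auto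
      obtain n where n: "abs_inf x = real q ^ n" using abs_A[OF less.prems(1) x0] by blast
      have q1: "1 < real q" using q_ge_2 by simp
      have mn: "m + v < n" using False less.prems(1) n q1 by (auto simp: A_le_def not_le)
      have nN: "n \<le> N" using less.prems(2) n q1 by simp
      have "x / \<alpha> \<in> k" using less.prems(1) assms(1) A_k by auto
      moreover have xa: "abs_inf (x / \<alpha>) = real q ^ (n - v)"
        using n assms(3) mn q1 by (simp add: abs_divide power_diff)
      moreover have "n - v \<ge> j\<^sub>0" using mn assms(4) by simp
      ultimately obtain y where y: "y \<in> A" "abs_inf (x / \<alpha> - y) < abs_inf (x / \<alpha>)"
        using A_approx by blast
      have "x - \<alpha> * y = \<alpha> * (x / \<alpha> - y)" using assms(2) by (simp add: field_simps)
      then have "abs_inf (x - \<alpha> * y) < abs_inf \<alpha> * abs_inf (x / \<alpha>)"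
        using y(2) assms(2) by (simp add: abs_mult)
      also have "\<dots> = real q ^ Suc (n - 1)" using assms(2) n mn by (simp add: abs_divide)
      finally have "abs_inf (x - \<alpha> * y) \<le> real q ^ (n - 1)"
        using abs_gap[of "x - \<alpha> * y" "n - 1"] less.prems(1) y(1) assms(1) A_K by blast
      moreover have "x - \<alpha> * y \<in> A" using less.prems(1) y(1) assms(1) by auto
      moreover have "n - 1 < N" using nN mn by linarith
      ultimately obtain y' where "y' \<in> A" "x - \<alpha> * y - \<alpha> * y' \<in> A_le (m + v)"
        using less.IH[of "n - 1" "x - \<alpha> * y"] \<open>n - 1 < N\<close> by blast
      then show ?thesis using y(1) by (intro bexI[of _ "y + y'"]) (auto simp: algebra_simps)
    qed
  qed
  moreover have "\<exists>N. abs_inf x \<le> real q ^ N"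
    using abs_A[of x] assms(5) by (cases "x = 0") (auto intro: exI[of _ 0])
  ultimately show ?thesis using assms(5) by blast
qed

lemma principal_submodule: "c \<in> k \<Longrightarrow> submodule_of A ((*) c ` A)"
  unfolding submodule_of_def
proof (intro conjI ballI)
  show "0 \<in> (*) c ` A" by (rule image_eqI[of _ _ 0]) auto
  fix x y assume "x \<in> (*) c ` A" "y \<in> (*) c ` A"
  then obtain b d where "b \<in> A" "d \<in> A" "x = c * b" "y = c * d" by blast
  then show "x + y \<in> (*) c ` A" by (intro image_eqI[of _ _ "b + d"]) (auto simp: algebra_simps)
next
  fix b x assume "b \<in> A" "x \<in> (*) c ` A"
  then obtain d where "d \<in> A" "x = c * d" by blast
  then show "b * x \<in> (*) c ` A" using \<open>b \<in> A\<close> by (intro image_eqI[of _ _ "b * d"]) (auto simp: algebra_simps)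
qed

text \<open>Because \<open>A = A_le (m + v) + I\<close>, cosets of \<open>I\<close> can be counted inside the finite group \<open>A_le (m + v)\<close>.\<close>
lemma finite_index_via_A_le:
  assumes "submodule_of A I" "I \<subseteq> A" "\<alpha> \<in> I" "\<alpha> \<noteq> 0" "abs_inf \<alpha> = real q ^ v" "m \<ge> j\<^sub>0"
  shows "index A I = index (A_le (m + v)) (A_le (m + v) \<inter> I)" "finite (cosets A I)"
    "card (A_le (m + v)) = index A I * card (A_le (m + v) \<inter> I)"
proof -
  let ?U = "A_le (m + v)"
  have I: "add_subgroup I" using A.submodule_add_subgroup assms(1) .
  have UI: "add_subgroup (?U \<inter> I)" using I A_le_subgroup by (auto simp: add_subgroup_def)
  have U: "?U \<subseteq> A" by (auto simp: A_le_def)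
  have cover: "\<exists>u\<in>?U. u - x \<in> I" if x: "x \<in> A" for x
  proof -
    obtain y where y: "y \<in> A" "x - \<alpha> * y \<in> ?U"
      using A_reduction[of \<alpha> v m x] assms x by blast
    have "(- y) * \<alpha> \<in> I" using assms(1,3) A.uminus_in[OF y(1)] by (auto simp: submodule_of_def)
    then show ?thesis using y(2) by (intro bexI[of _ "x - \<alpha> * y"]) (auto simp: mult.commute)
  qed
  have "index ?U (?U \<inter> I) = index A I \<and> (finite (cosets ?U (?U \<inter> I)) \<longleftrightarrow> finite (cosets A I))"
    using index_eq[of "?U \<inter> I" I ?U "\<lambda>x. x" A] UI I U cover add_subgroupD(2)[OF A_le_subgroup] by auto
  then show 1: "index A I = index ?U (?U \<inter> I)" "finite (cosets A I)"
    using finite_A_le by (auto simp: cosets_def)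
  show "card ?U = index A I * card (?U \<inter> I)"
    unfolding 1 by (rule card_eq_index_mult) (use UI A_le_subgroup in auto)
qed

text \<open>
  The product formula. The multiples of \<open>\<alpha>\<close> in \<open>A_le (j\<^sub>0 + v)\<close> are the products of \<open>\<alpha>\<close> with elements of \<open>A_le j\<^sub>0\<close>, and
  the cardinalities of the two spaces have the ratio \<open>q\<^sup>v\<close>.
\<close>
lemma index_principal:
  assumes "\<alpha> \<in> A" "\<alpha> \<noteq> 0"
  shows "real (index A ((*) \<alpha> ` A)) = abs_inf \<alpha>"
proof -
  obtain v where v: "abs_inf \<alpha> = real q ^ v" using abs_A[OF assms] by blast
  let ?I = "(*) \<alpha> ` A"
  have "\<alpha> \<in> ?I" by (rule image_eqI[of _ _ 1]) auto
  then have "card (A_le (j\<^sub>0 + v)) = index A ?I * card (A_le (j\<^sub>0 + v) \<inter> ?I)"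
    using assms v A_k by (intro finite_index_via_A_le(3)[where \<alpha> = \<alpha>] principal_submodule) auto
  moreover have "A_le (j\<^sub>0 + v) \<inter> ?I = (*) \<alpha> ` A_le j\<^sub>0"
  proof -
    have "abs_inf (\<alpha> * b) \<le> real q ^ (j\<^sub>0 + v) \<longleftrightarrow> abs_inf b \<le> real q ^ j\<^sub>0" for b
      using q_ge_2 by (simp add: abs_mult v power_add mult.commute)
    then show ?thesis using assms(1) by (auto simp: A_le_def)
  qed
  moreover have "card ((*) \<alpha> ` A_le j\<^sub>0) = card (A_le j\<^sub>0)"
    using assms(2) by (intro card_image inj_onI) auto
  ultimately have "index A ?I = q ^ v" using card_A_le[of j\<^sub>0 v] card_A_le_pos[of j\<^sub>0] by simp
  then show ?thesis by (simp add: v)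
qed

lemma index_ideal:
  assumes "submodule_of A I" "I \<subseteq> A" "I \<noteq> {0}"
  shows "finite (cosets A I)" "index A I > 0" "\<exists>d. index A I = card Fr ^ d"
proof -
  obtain \<alpha> where \<alpha>: "\<alpha> \<in> I" "\<alpha> \<noteq> 0" using assms(1,3) by (auto simp: submodule_of_def)
  obtain v where v: "abs_inf \<alpha> = real q ^ v" using abs_A[of \<alpha>] \<alpha> assms(2) by blast
  note * = finite_index_via_A_le[OF assms(1,2) \<alpha> v order_refl]
  let ?U = "A_le (j\<^sub>0 + v)"
  show fin: "finite (cosets A I)" using * by blast
  have "submodule_of Fr (?U \<inter> I)"
    using A_le_submodule assms(1) Fr_A by (auto simp: submodule_of_def)
  moreover have "finite (?U \<inter> I)" using finite_A_le by blast
  ultimately obtain j where j: "card (?U \<inter> I) = card Fr ^ j"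
    using card_subspace[OF subfield_Fr _ _ finite_Fr] by blast
  obtain i where i: "card ?U = card Fr ^ i"
    using card_subspace[OF subfield_Fr A_le_submodule finite_A_le finite_Fr] by blast
  note r = card_Fr_ge_2
  have e: "card Fr ^ i = index A I * card Fr ^ j" using *(3) i j by simp
  then show pos: "index A I > 0" using r by (cases "index A I") auto
  have "card Fr ^ j \<le> card Fr ^ i" using e pos by simp
  then have "j \<le> i" using r by simp
  then have "card Fr ^ i = card Fr ^ (i - j) * card Fr ^ j" by (simp flip: power_add)
  then have "index A I = card Fr ^ (i - j)" using e r by simp
  then show "\<exists>d. index A I = card Fr ^ d" by blast
qed

end

section \<open>Ideals and their powers\<close>

abbreviation prod_ideal :: "'a::field set \<Rightarrow> 'a set \<Rightarrow> 'a set"  (infixl \<open>\<odot>\<close> 70) where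
  "I \<odot> J \<equiv> ideal_prod RT I J"

lemma prod_ideal_mem: "i \<in> I \<Longrightarrow> j \<in> J \<Longrightarrow> i * j \<in> I \<odot> J"
  using ideal_prod.prod[of i I j J RT] by simp

lemma prod_ideal_add: "x \<in> I \<odot> J \<Longrightarrow> y \<in> I \<odot> J \<Longrightarrow> x + y \<in> I \<odot> J"
  using ideal_prod.sum[of x RT I J y] by simp

lemma prod_ideal_subset:
  assumes "\<And>i j. i \<in> I \<Longrightarrow> j \<in> J \<Longrightarrow> i * j \<in> M" "\<And>x y. x \<in> M \<Longrightarrow> y \<in> M \<Longrightarrow> x + y \<in> M"
  shows "I \<odot> J \<subseteq> M"
proof
  fix x assume "x \<in> I \<odot> J"
  then show "x \<in> M" by induction (use assms in auto)
qed

lemma prod_ideal_mono: "I \<subseteq> I' \<Longrightarrow> J \<subseteq> J' \<Longrightarrow> I \<odot> J \<subseteq> I' \<odot> J'"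
  by (rule prod_ideal_subset) (auto intro: prod_ideal_mem prod_ideal_add)

lemma prod_ideal_commute: "I \<odot> J = J \<odot> I"
proof -
  have "i * j \<in> J \<odot> I" if "i \<in> I" "j \<in> J" for i j and I J :: "'b::field set"
    using prod_ideal_mem[OF that(2,1)] by (simp add: mult.commute)
  then show ?thesis by (intro subset_antisym prod_ideal_subset prod_ideal_add)
qed

lemma prod_ideal_assoc_subset: "I \<odot> J \<odot> L \<subseteq> I \<odot> (J \<odot> L)"
proof (rule prod_ideal_subset)
  fix s l assume "s \<in> I \<odot> J" "l \<in> L"
  then show "s * l \<in> I \<odot> (J \<odot> L)"
  proof (induction s)
    case (prod i j)
    then have "i * (j * l) \<in> I \<odot> (J \<odot> L)" by (intro prod_ideal_mem)
    then show ?case by (simp add: mult.assoc)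
  next
    case (sum s1 s2)
    then show ?case using prod_ideal_add by (fastforce simp: distrib_right)
  qed
qed (rule prod_ideal_add)

lemma prod_ideal_assoc: "I \<odot> J \<odot> L = I \<odot> (J \<odot> L)"
proof
  have "L \<odot> J \<odot> I \<subseteq> L \<odot> (J \<odot> I)" by (rule prod_ideal_assoc_subset)
  then show "I \<odot> (J \<odot> L) \<subseteq> I \<odot> J \<odot> L" by (simp add: prod_ideal_commute)
qed (rule prod_ideal_assoc_subset)

lemma prod_ideal_scale: "(*) c ` I \<odot> J = (*) (c :: 'a::field) ` (I \<odot> J)"
proof
  show "(*) c ` I \<odot> J \<subseteq> (*) c ` (I \<odot> J)"
  proof (rule prod_ideal_subset)
    fix i j assume "i \<in> (*) c ` I" "j \<in> J"
    then show "i * j \<in> (*) c ` (I \<odot> J)" by (auto simp: mult.assoc intro: prod_ideal_mem)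
  next
    fix x y assume "x \<in> (*) c ` (I \<odot> J)" "y \<in> (*) c ` (I \<odot> J)"
    then show "x + y \<in> (*) c ` (I \<odot> J)"
      by (auto simp flip: distrib_left intro: prod_ideal_add)
  qed
  show "(*) c ` (I \<odot> J) \<subseteq> (*) c ` I \<odot> J"
  proof clarify
    fix s assume "s \<in> I \<odot> J"
    then show "c * s \<in> (*) c ` I \<odot> J"
    proof induction
      case (prod i j)
      then have "c * i * j \<in> (*) c ` I \<odot> J" by (intro prod_ideal_mem) auto
      then show ?case by (simp add: mult.assoc)
    next
      case (sum s1 s2)
      then show ?case using prod_ideal_add by (fastforce simp: distrib_left)
    qed
  qed
qed

lemma scale_inverse:
  assumes "c \<noteq> 0"
  shows "(*) (inverse c) ` (*) c ` M = (M :: 'a::field set)" "(*) c ` (*) (inverse c) ` M = M"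
  using assms by (simp_all add: image_image flip: mult.assoc)

context subring_of_type
begin

lemma submodule_prod:
  assumes "submodule_of S I" "submodule_of S J"
  shows "submodule_of S (I \<odot> J)"
  unfolding submodule_of_def
proof (intro conjI ballI)
  show "0 \<in> I \<odot> J" using prod_ideal_mem[of 0 I 0 J] assms by (simp add: submodule_of_def)
next
  fix c x assume c: "c \<in> S" "x \<in> I \<odot> J"
  show "c * x \<in> I \<odot> J" using c(2)
  proof induction
    case (prod i j)
    then have "c * i * j \<in> I \<odot> J" using assms(1) c(1) by (intro prod_ideal_mem) (auto simp: submodule_of_def)
    then show ?case by (simp add: mult.assoc)
  next
    case (sum s1 s2)
    then show ?case using prod_ideal_add by (fastforce simp: distrib_left)
  qed
qed (rule prod_ideal_add)

lemma prod_ideal_one: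
  assumes "submodule_of S I"
  shows "S \<odot> I = I"
proof
  show "S \<odot> I \<subseteq> I" using assms by (intro prod_ideal_subset) (auto simp: submodule_of_def)
  show "I \<subseteq> S \<odot> I" using prod_ideal_mem[of 1 S] by fastforce
qed

lemma submodule_self: "submodule_of S S"
  by (auto simp: submodule_of_def)

lemma submodule_scale: "submodule_of S I \<Longrightarrow> submodule_of S ((*) c ` I)"
  unfolding submodule_of_def
proof (intro conjI ballI; elim conjE)
  assume *: "0 \<in> I" "\<forall>x\<in>I. \<forall>y\<in>I. x + y \<in> I" "\<forall>c\<in>S. \<forall>x\<in>I. c * x \<in> I"
  show "0 \<in> (*) c ` I" by (rule image_eqI[of _ _ 0]) (use * in auto)
  show "x + y \<in> (*) c ` I" if "x \<in> (*) c ` I" "y \<in> (*) c ` I" for x y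
    using that * by (auto simp flip: distrib_left)
  show "d * x \<in> (*) c ` I" if "d \<in> S" "x \<in> (*) c ` I" for d x
    using that * by (auto simp: mult.left_commute)
qed

abbreviation ideal_pow :: "'a set \<Rightarrow> nat \<Rightarrow> 'a set" where
  "ideal_pow I n \<equiv> I [^]\<^bsub>frac_ideals S\<^esub> n"

lemma frac_ideals_simps [simp]: "\<one>\<^bsub>frac_ideals S\<^esub> = S" "I \<otimes>\<^bsub>frac_ideals S\<^esub> J = I \<odot> J"
  by (simp_all add: frac_ideals_def)

lemma submodule_pow: "submodule_of S I \<Longrightarrow> submodule_of S (ideal_pow I n)"
  by (induction n) (auto intro: submodule_self submodule_prod)

lemma ideal_pow_add: "submodule_of S I \<Longrightarrow> ideal_pow I (m + n) = ideal_pow I m \<odot> ideal_pow I n"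
proof (induction n)
  case 0
  then show ?case using prod_ideal_one[OF submodule_pow[OF 0], of m] by (simp add: prod_ideal_commute)
qed (simp add: prod_ideal_assoc)

lemma ideal_pow_mult: "submodule_of S I \<Longrightarrow> ideal_pow I (m * n) = ideal_pow (ideal_pow I m) n"
  by (induction n) (simp_all add: ideal_pow_add prod_ideal_commute add.commute)

lemma ideal_pow_principal: "ideal_pow ((*) c ` S) n = (*) (c ^ n) ` S"
proof (induction n)
  case (Suc n)
  have "(*) (c ^ n) ` S \<odot> (*) c ` S = (*) (c ^ n) ` ((*) c ` S)"
    by (simp only: prod_ideal_scale prod_ideal_one[OF submodule_scale[OF submodule_self]])
  then show ?case using Suc by (simp add: image_image mult.assoc mult.left_commute)
qed simp

lemma ideal_pow_nonzero: "submodule_of S I \<Longrightarrow> I \<noteq> {0} \<Longrightarrow> ideal_pow I n \<noteq> {0}"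
proof -
  assume "submodule_of S I" "I \<noteq> {0}"
  then obtain x where x: "x \<in> I" "x \<noteq> 0" by (auto simp: submodule_of_def)
  have "x ^ n \<in> ideal_pow I n"
  proof (induction n)
    case (Suc n)
    show ?case
      unfolding nat_pow_Suc frac_ideals_simps power_Suc2
      by (rule prod_ideal_mem[OF Suc x(1)])
  qed simp
  moreover have "x ^ n \<noteq> 0" using x(2) by simp
  ultimately show "ideal_pow I n \<noteq> {0}" by (metis singletonD)
qed

lemma ideal_pow_subset: "submodule_of S I \<Longrightarrow> I \<subseteq> S \<Longrightarrow> ideal_pow I n \<subseteq> S"
proof (induction n)
  case (Suc n)
  then have "ideal_pow I n \<odot> I \<subseteq> S \<odot> S" by (intro prod_ideal_mono) auto
  then show ?case using prod_ideal_one[OF submodule_self] by simp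
qed simp

end

text \<open>A subgroup containing \<open>W\<close> is determined by the cosets of \<open>W\<close> in it.\<close>
lemma finite_intermediate_subgroups:
  assumes "add_subgroup W" "finite (cosets V W)"
  shows "finite {J. add_subgroup J \<and> W \<subseteq> J \<and> J \<subseteq> V}"
proof (rule finite_imageD)
  show "finite ((\<lambda>J. cosets J W) ` {J. add_subgroup J \<and> W \<subseteq> J \<and> J \<subseteq> V})"
    by (rule finite_subset[of _ "Pow (cosets V W)"]) (use assms(2) in \<open>auto simp: cosets_def\<close>)
  show "inj_on (\<lambda>J. cosets J W) {J. add_subgroup J \<and> W \<subseteq> J \<and> J \<subseteq> V}"
  proof (rule inj_onI)
    have *: "x \<in> J \<longleftrightarrow> coset x W \<in> cosets J W" if J: "add_subgroup J" "W \<subseteq> J" for J x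
    proof
      assume "coset x W \<in> cosets J W"
      then obtain y where "y \<in> J" "x - y \<in> W" by (auto simp: cosets_def coset_eq_iff[OF assms(1)])
      then show "x \<in> J" using J add_subgroupD(4)[OF J(1), of "x - y" y] by auto
    qed (auto simp: cosets_def)
    fix J J' assume "J \<in> {J. add_subgroup J \<and> W \<subseteq> J \<and> J \<subseteq> V}" "J' \<in> {J. add_subgroup J \<and> W \<subseteq> J \<and> J \<subseteq> V}"
      "cosets J W = cosets J' W"
    then show "J = J'" using *[of J] *[of J'] by blast
  qed
qed

lemma pigeonhole_cosets:
  assumes "add_subgroup W" "finite (cosets V W)" "finite T \<Longrightarrow> index V W < card T" "f ` T \<subseteq> V"
  shows "\<exists>x\<in>T. \<exists>y\<in>T. x \<noteq> y \<and> f x - f y \<in> W"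
proof -
  have img: "(\<lambda>x. coset (f x) W) ` T \<subseteq> cosets V W" using assms(4) by (auto simp: cosets_def)
  have "\<not> inj_on (\<lambda>x. coset (f x) W) T"
  proof
    assume inj: "inj_on (\<lambda>x. coset (f x) W) T"
    then have "finite T" using img assms(2) by (meson finite_imageD finite_subset)
    then have "card T \<le> index V W"
      unfolding index_def by (intro card_inj_on_le[OF inj img assms(2)])
    then show False using assms(3) \<open>finite T\<close> by simp
  qed
  then show ?thesis by (auto simp: inj_on_def coset_eq_iff[OF assms(1)])
qed

section \<open>Finiteness of the class number\<close>

context affine_curve
begin

definition nonzero_ideal :: "'c set \<Rightarrow> bool" where
  "nonzero_ideal I \<longleftrightarrow> submodule_of A I \<and> I \<subseteq> A \<and> I \<noteq> {0}"

lemma nonzero_idealD: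
  assumes "nonzero_ideal I"
  shows "submodule_of A I" "I \<subseteq> A" "\<exists>x\<in>I. x \<noteq> 0" "add_subgroup I" "finite (cosets A I)"
    "x \<in> I \<Longrightarrow> y \<in> I \<Longrightarrow> x + y \<in> I" "b \<in> A \<Longrightarrow> x \<in> I \<Longrightarrow> b * x \<in> I" "0 \<in> I"
  using assms A.submodule_add_subgroup[of I] index_ideal(1)[of I]
  by (auto simp: nonzero_ideal_def submodule_of_def)

lemma nonzero_ideal_pow: "nonzero_ideal I \<Longrightarrow> nonzero_ideal (A.ideal_pow I n)"
  using A.submodule_pow A.ideal_pow_subset A.ideal_pow_nonzero by (auto simp: nonzero_ideal_def)

lemma nonzero_ideal_principal: "x \<in> A \<Longrightarrow> x \<noteq> 0 \<Longrightarrow> nonzero_ideal ((*) x ` A)"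
  unfolding nonzero_ideal_def using principal_submodule[of x] A_k
  by (auto intro!: exI[of _ x] image_eqI[of x _ 1])

lemma principal_subset: "nonzero_ideal I \<Longrightarrow> x \<in> I \<Longrightarrow> (*) x ` A \<subseteq> I"
  using nonzero_idealD(7)[of I _ x] by (auto simp: mult.commute)

lemma finite_cosets_sub:
  assumes "nonzero_ideal I" "x \<in> I" "x \<noteq> 0"
  shows "finite (cosets I ((*) x ` A))" "index A ((*) x ` A) = index A I * index I ((*) x ` A)"
proof -
  have x: "nonzero_ideal ((*) x ` A)"
    using assms nonzero_idealD(2)[OF assms(1)] by (intro nonzero_ideal_principal) auto
  note t = index_tower[OF nonzero_idealD(4)[OF x] nonzero_idealD(4)[OF assms(1)]
     A.submodule_add_subgroup[OF A.submodule_self] principal_subset[OF assms(1,2)] nonzero_idealD(2)[OF assms(1)]]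
  have "cosets A I \<noteq> {}" by (auto simp: cosets_def)
  moreover have "finite (cosets A I \<times> cosets I ((*) x ` A))"
    using t(2) nonzero_idealD(5)[OF x] by blast
  ultimately show "finite (cosets I ((*) x ` A))" by (metis finite_cartesian_productD2)
  show "index A ((*) x ` A) = index A I * index I ((*) x ` A)" by (rule t(1))
qed

text \<open>
  Minkowski's argument: if \<open>A_le\<close> has more elements than there are residues modulo \<open>I\<close>, two of them differ by an
  element of \<open>I\<close>. The bound is uniform because cardinalities in \<open>A_le\<close> grow by the factor \<open>q\<close> only.
\<close>
lemma small_element:
  "\<exists>B. \<forall>I. nonzero_ideal I \<longrightarrow> (\<exists>x\<in>I. x \<noteq> 0 \<and> index I ((*) x ` A) \<le> B)"
proof (intro exI[of _ "q ^ Suc j\<^sub>0"] allI impI)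
  fix I assume I: "nonzero_ideal I"
  have pos: "index A I > 0" using I by (intro index_ideal) (auto simp: nonzero_ideal_def)
  define n where "n = (LEAST n. index A I < q ^ n)"
  have "index A I < 2 ^ index A I" by simp
  also have "\<dots> \<le> q ^ index A I" using q_ge_2 by (rule power_mono) simp
  finally have n: "index A I < q ^ n" unfolding n_def by (rule LeastI)
  have "n \<noteq> 0" using n pos by (cases n) auto
  then obtain n' where n': "n = Suc n'" by (cases n) auto
  have "\<not> index A I < q ^ n'" using not_less_Least[of n' "\<lambda>n. index A I < q ^ n"] n' unfolding n_def by simp
  then have qn: "q ^ n \<le> q * index A I" using n' by simp
  have "q ^ n \<le> card (A_le (j\<^sub>0 + n))" using card_A_le[of j\<^sub>0 n] card_A_le_pos[of j\<^sub>0] by simp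
  then obtain x y where xy: "x \<in> A_le (j\<^sub>0 + n)" "y \<in> A_le (j\<^sub>0 + n)" "x \<noteq> y" "x - y \<in> I"
    using pigeonhole_cosets[OF nonzero_idealD(4,5)[OF I], of "A_le (j\<^sub>0 + n)" "\<lambda>x. x"] n
    by (auto simp: A_le_def)
  define z where "z = x - y"
  have z: "z \<in> A_le (j\<^sub>0 + n)" "z \<in> I" "z \<noteq> 0"
    using xy add_subgroupD(2)[OF A_le_subgroup] by (auto simp: z_def)
  have "real (index A I * index I ((*) z ` A)) = real (index A ((*) z ` A))"
    using finite_cosets_sub(2)[OF I z(2,3)] by simp
  also have "\<dots> = abs_inf z" using z by (intro index_principal) (auto simp: A_le_def)
  also have "\<dots> \<le> real (q ^ (j\<^sub>0 + n))" using z(1) by (simp add: A_le_def)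
  also have "q ^ (j\<^sub>0 + n) \<le> q ^ j\<^sub>0 * (q * index A I)"
    unfolding power_add using qn by (rule mult_le_mono2)
  finally have "index A I * index I ((*) z ` A) \<le> index A I * q ^ Suc j\<^sub>0"
    by (simp only: of_nat_le_iff) (simp add: mult_ac)
  then have "index I ((*) z ` A) \<le> q ^ Suc j\<^sub>0" using pos by simp
  then show "\<exists>x\<in>I. x \<noteq> 0 \<and> index I ((*) x ` A) \<le> q ^ Suc j\<^sub>0" using z by blast
qed

lemma exists_large_A_le: "\<exists>m. B < card (A_le m)"
proof -
  have "B < 2 ^ B" by simp
  moreover have "2 ^ B \<le> q ^ B" using q_ge_2 by (rule power_mono) simp
  moreover have "q ^ B \<le> q ^ B * card (A_le j\<^sub>0)" using card_A_le_pos[of j\<^sub>0] by simp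
  ultimately have "B < card (A_le (j\<^sub>0 + B))" unfolding card_A_le[OF order_refl] by linarith
  then show ?thesis by blast
qed

text \<open>
  Let \<open>x \<in> I\<close> with \<open>I/xA\<close> of order at most \<open>B\<close>. For \<open>y \<in> I\<close> the map \<open>b \<mapsto> b y\<close> from a set \<open>A_le m\<close> with more than \<open>B\<close> elements to
  \<open>I/xA\<close> is not injective, so \<open>y\<close> is annihilated modulo \<open>xA\<close> by a nonzero element of \<open>A_le m\<close>, and hence by their product \<open>Q\<close>.
  Thus \<open>(Q/x) I\<close> is one of the finitely many groups between \<open>QA\<close> and \<open>A\<close>.
\<close>
lemma finitely_many_ideal_classes:
  "\<exists>\<J>. finite \<J> \<and> (\<forall>I. nonzero_ideal I \<longrightarrow> (\<exists>c\<in>k. c \<noteq> 0 \<and> (\<exists>J\<in>\<J>. I = (*) c ` J)))"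
proof -
  obtain B where B: "\<And>I. nonzero_ideal I \<Longrightarrow> \<exists>x\<in>I. x \<noteq> 0 \<and> index I ((*) x ` A) \<le> B"
    using small_element by blast
  obtain m where m: "B < card (A_le m)" using exists_large_A_le by blast
  define Q where "Q = \<Prod>(A_le m - {0})"
  have fin: "finite (A_le m - {0})" using finite_A_le by blast
  have Q: "Q \<in> A" "Q \<noteq> 0"
    unfolding Q_def using fin by (auto simp: A_le_def)
  define \<J> where "\<J> = {J. add_subgroup J \<and> (*) Q ` A \<subseteq> J \<and> J \<subseteq> A}"
  have QA: "nonzero_ideal ((*) Q ` A)" using Q by (rule nonzero_ideal_principal)
  have "finite \<J>"
    unfolding \<J>_def by (rule finite_intermediate_subgroups) (use nonzero_idealD[OF QA] in auto)
  moreover have "\<exists>c\<in>k. c \<noteq> 0 \<and> (\<exists>J\<in>\<J>. I = (*) c ` J)" if I: "nonzero_ideal I" for I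
  proof -
    obtain x where x: "x \<in> I" "x \<noteq> 0" "index I ((*) x ` A) \<le> B" using B[OF I] by blast
    have xA: "nonzero_ideal ((*) x ` A)"
      using x nonzero_idealD(2)[OF I] by (intro nonzero_ideal_principal) auto
    have kill: "Q * y \<in> (*) x ` A" if y: "y \<in> I" for y
    proof -
      have "\<exists>b\<in>A_le m. \<exists>b'\<in>A_le m. b \<noteq> b' \<and> b * y - b' * y \<in> (*) x ` A"
        by (rule pigeonhole_cosets[OF nonzero_idealD(4)[OF xA] finite_cosets_sub(1)[OF I x(1,2)]])
           (use m x(3) y nonzero_idealD(7)[OF I] in \<open>auto simp: A_le_def\<close>)
      then obtain b b' where b: "b \<in> A_le m" "b' \<in> A_le m" "b \<noteq> b'" "b * y - b' * y \<in> (*) x ` A" by blast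
      then have e: "b - b' \<in> A_le m - {0}" using add_subgroupD(2)[OF A_le_subgroup] by auto
      then have "Q = (b - b') * \<Prod>(A_le m - {0} - {b - b'})"
        unfolding Q_def by (rule prod.remove[OF fin])
      then have "Q * y = (b - b') * \<Prod>(A_le m - {0} - {b - b'}) * y" by simp
      also have "\<dots> = \<Prod>(A_le m - {0} - {b - b'}) * (b * y - b' * y)" by (simp add: algebra_simps)
      finally have "Q * y = \<Prod>(A_le m - {0} - {b - b'}) * (b * y - b' * y)" .
      moreover have "\<Prod>(A_le m - {0} - {b - b'}) \<in> A" by (auto simp: A_le_def)
      ultimately show ?thesis using nonzero_idealD(7)[OF xA] b(4) by simp
    qed
    define J where "J = (*) (Q / x) ` I"
    have "J \<in> \<J>"
      unfolding \<J>_def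
    proof (intro CollectI conjI)
      show "add_subgroup J" unfolding J_def
        by (intro A.submodule_add_subgroup A.submodule_scale nonzero_idealD(1)[OF I])
      show "J \<subseteq> A"
      proof
        fix u assume "u \<in> J"
        then obtain y where y: "y \<in> I" "u = Q * y / x" by (auto simp: J_def)
        then show "u \<in> A" using kill[OF y(1)] x(2) by auto
      qed
      show "(*) Q ` A \<subseteq> J"
      proof clarify
        fix b assume b: "b \<in> A"
        show "Q * b \<in> J" unfolding J_def
          by (rule image_eqI[of _ _ "b * x"]) (use b x nonzero_idealD(7)[OF I] in auto)
      qed
    qed
    moreover have "I = (*) (x / Q) ` J"
      using Q(2) x(2) by (simp add: J_def image_image)
    moreover have "x / Q \<in> k" "x / Q \<noteq> 0" using x Q nonzero_idealD(2)[OF I] A_k by auto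
    ultimately show ?thesis by blast
  qed
  ultimately show ?thesis by blast
qed

text \<open>The quotient \<open>M/mA\<close> is finite for \<open>0 \<noteq> m \<in> M\<close>; its representatives and \<open>m\<close> generate \<open>M\<close>.\<close>
lemma ideal_finitely_generated:
  assumes M: "nonzero_ideal M"
  shows "\<exists>n g. (\<forall>i<n. g i \<in> M) \<and> (\<forall>x\<in>M. \<exists>b. (\<forall>i<n. b i \<in> A) \<and> x = (\<Sum>i<(n::nat). b i * g i))"
proof -
  obtain m where m: "m \<in> M" "m \<noteq> 0" using nonzero_idealD(3)[OF M] by blast
  have mA: "nonzero_ideal ((*) m ` A)"
    using m nonzero_idealD(2)[OF M] by (intro nonzero_ideal_principal) auto
  obtain G where G: "G \<subseteq> M" "finite G" "cosets M ((*) m ` A) = (\<lambda>x. coset x ((*) m ` A)) ` G"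
    using finite_subset_image[OF finite_cosets_sub(1)[OF M m], of "\<lambda>x. coset x ((*) m ` A)" M]
    by (auto simp: cosets_def)
  obtain n :: nat and g where g: "insert m G = g ` {i. i < n}"
    using finite_imp_nat_seg_image_inj_on[of "insert m G"] G(2) by auto
  have "\<exists>b. (\<forall>i<n. b i \<in> A) \<and> x = (\<Sum>i<n. b i * g i)" if x: "x \<in> M" for x
  proof -
    have "coset x ((*) m ` A) \<in> cosets M ((*) m ` A)" using x by (auto simp: cosets_def)
    then obtain y where y: "y \<in> G" "x - y \<in> (*) m ` A"
      unfolding G(3) by (auto simp: coset_eq_iff[OF nonzero_idealD(4)[OF mA]])
    obtain b0 where b0: "b0 \<in> A" "x = y + b0 * m" using y(2) by (auto simp: algebra_simps)
    have "y \<in> g ` {i. i < n}" "m \<in> g ` {i. i < n}" using y(1) by (auto simp flip: g)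
    then obtain i j where ij: "i < n" "j < n" "y = g i" "m = g j" by auto
    define b where "b = (\<lambda>l. (if l = i then 1 else 0) + (if l = j then b0 else 0))"
    have "(\<Sum>l<n. b l * g l) = (\<Sum>l<n. (if l = i then g l else 0) + (if l = j then b0 * g l else 0))"
      by (intro sum.cong) (auto simp: b_def algebra_simps)
    also have "\<dots> = g i + b0 * g j" using ij by (simp add: sum.distrib)
    finally have "x = (\<Sum>l<n. b l * g l)" using b0(2) ij by simp
    moreover have "\<forall>l<n. b l \<in> A" using b0(1) by (auto simp: b_def)
    ultimately show ?thesis by blast
  qed
  moreover have "\<forall>i<n. g i \<in> M" using g G(1) m(1) by auto
  ultimately show ?thesis by blast
qed

lemma nakayama_ideal:
  assumes N: "submodule_of A N" "N \<subseteq> A" and M: "nonzero_ideal M" "M \<subseteq> N \<odot> M"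
  shows "1 \<in> N"
proof -
  obtain n g where g: "\<forall>i<n. g i \<in> M" "\<forall>x\<in>M. \<exists>b. (\<forall>i<n. b i \<in> A) \<and> x = (\<Sum>i<(n::nat). b i * g i)"
    using ideal_finitely_generated[OF M(1)] by blast
  have N_add: "x + y \<in> N" if "x \<in> N" "y \<in> N" for x y using N(1) that by (auto simp: submodule_of_def)
  have N_mult: "c * x \<in> N" if "c \<in> A" "x \<in> N" for c x using N(1) that by (auto simp: submodule_of_def)
  define T where "T = {x. \<exists>b. (\<forall>i<n. b i \<in> N) \<and> x = (\<Sum>i<n. b i * g i)}"
  have "N \<odot> M \<subseteq> T"
  proof (rule prod_ideal_subset)
    fix c x assume c: "c \<in> N" and "x \<in> M"
    then obtain b where b: "\<forall>i<n. b i \<in> A" "x = (\<Sum>i<n. b i * g i)" using g(2) by blast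
    then have "c * x = (\<Sum>i<n. (b i * c) * g i)" by (simp add: sum_distrib_left mult_ac)
    moreover have "\<forall>i<n. b i * c \<in> N" using b(1) c N_mult by blast
    ultimately show "c * x \<in> T"
      unfolding T_def by (intro CollectI exI[of _ "\<lambda>i. b i * c"] conjI)
  next
    fix x y assume "x \<in> T" "y \<in> T"
    then obtain b b' where "\<forall>i<n. b i \<in> N" "x = (\<Sum>i<n. b i * g i)" "\<forall>i<n. b' i \<in> N" "y = (\<Sum>i<n. b' i * g i)"
      unfolding T_def by blast
    then show "x + y \<in> T"
      unfolding T_def using N_add by (intro CollectI exI[of _ "\<lambda>i. b i + b' i"]) (auto simp: sum.distrib distrib_right)
  qed
  then have "\<forall>i. \<exists>b. i < n \<longrightarrow> (\<forall>l<n. b l \<in> N) \<and> g i = (\<Sum>l<n. b l * g l)"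
    using g(1) M(2) unfolding T_def by blast
  then obtain b where b: "\<And>i. i < n \<Longrightarrow> (\<forall>l<n. b i l \<in> N) \<and> g i = (\<Sum>l<n. b i l * g l)" by metis
  have "1 \<in> N \<or> (\<forall>i<n. g i = 0)"
    by (rule nakayama[OF subring_A N(2) N_add N_mult, of 1 n g b])
       (use b N(1) in \<open>auto simp: submodule_of_def\<close>)
  moreover have "\<not> (\<forall>i<n. g i = 0)"
  proof
    assume z: "\<forall>i<n. g i = 0"
    obtain x where "x \<in> M" "x \<noteq> 0" using nonzero_idealD(3)[OF M(1)] by blast
    then show False using g(2) z by (metis (no_types, lifting) mult_zero_right sum.neutral lessThan_iff)
  qed
  ultimately show ?thesis by blast
qed

text \<open>
  The groups \<open>V n = m (A + A c + \<dots> + A c\<^sup>n)\<close> lie between \<open>mA\<close> and \<open>A\<close>, so two of them coincide, and this is an integral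
  equation for \<open>c\<close>.
\<close>
lemma multiplier_in_A:
  assumes M: "nonzero_ideal M" and c: "c \<in> k" "\<And>x. x \<in> M \<Longrightarrow> c * x \<in> M"
  shows "c \<in> A"
proof -
  obtain m where m: "m \<in> M" "m \<noteq> 0" using nonzero_idealD(3)[OF M] by blast
  have mA: "nonzero_ideal ((*) m ` A)"
    using m nonzero_idealD(2)[OF M] by (intro nonzero_ideal_principal) auto
  define V where "V n = {m * poly p c | p. p \<in> polys A \<and> degree p \<le> n}" for n
  have V: "m * poly p c \<in> V n" if "p \<in> polys A" "degree p \<le> n" for p n
    using that by (auto simp: V_def)
  have "add_subgroup (V n) \<and> (*) m ` A \<subseteq> V n \<and> V n \<subseteq> A" for n
  proof (intro conjI)
    show "add_subgroup (V n)"
      unfolding add_subgroup_def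
    proof (intro conjI ballI)
      show "0 \<in> V n" using V[of 0] by simp
      fix x y assume "x \<in> V n" "y \<in> V n"
      then obtain p p' where "p \<in> polys A" "degree p \<le> n" "x = m * poly p c"
        "p' \<in> polys A" "degree p' \<le> n" "y = m * poly p' c" by (auto simp: V_def)
      then show "x - y \<in> V n" using V[of "p - p'" n] by (auto simp: algebra_simps degree_diff_le)
    qed
    show "(*) m ` A \<subseteq> V n" using V[of "[:b:]" n for b] by auto
    have cm: "m * c ^ i \<in> M" for i
      by (induction i) (use m c(2) in \<open>auto simp: mult.left_commute\<close>)
    have sum_M: "sum f T \<in> M" if "\<And>i. i \<in> T \<Longrightarrow> f i \<in> M" for f :: "nat \<Rightarrow> 'c" and T
      using that by (induction T rule: infinite_finite_induct) (use nonzero_idealD[OF M] in auto)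
    have "V n \<subseteq> M"
    proof
      fix x assume "x \<in> V n"
      then obtain p where p: "p \<in> polys A" "x = m * poly p c" by (auto simp: V_def)
      have "x = (\<Sum>i\<le>degree p. coeff p i * (m * c ^ i))"
        by (simp add: p(2) poly_altdef sum_distrib_left mult_ac)
      also have "\<dots> \<in> M" by (intro sum_M nonzero_idealD(7)[OF M] polysD[OF p(1)] cm)
      finally show "x \<in> M" .
    qed
    then show "V n \<subseteq> A" using nonzero_idealD(2)[OF M] by blast
  qed
  then have "range V \<subseteq> {J. add_subgroup J \<and> (*) m ` A \<subseteq> J \<and> J \<subseteq> A}" by blast
  then have "finite (range V)"
    using finite_subset finite_intermediate_subgroups[OF nonzero_idealD(4,5)[OF mA]] by blast
  then have "\<not> inj V" using finite_imageD infinite_UNIV_nat by blast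
  then obtain i n where "V i = V n" and "i < n" by (metis injI linorder_neqE_nat)
  moreover have "m * c ^ n \<in> V n" using V[of "monom 1 n" n] by (auto simp: poly_monom degree_monom_eq)
  ultimately have "m * c ^ n \<in> V i" by simp
  then obtain p where p: "p \<in> polys A" "degree p \<le> i" "m * c ^ n = m * poly p c"
    unfolding V_def by blast
  have dp: "degree (- p) < degree (monom (1::'c) n)" using p(2) \<open>i < n\<close> by (simp add: degree_monom_eq)
  have "integral_over A c"
    unfolding A.integral_over_iff
  proof (intro bexI[of _ "monom 1 n + - p"] conjI)
    show "lead_coeff (monom 1 n + - p) = 1"
      unfolding degree_add_eq_left[OF dp] using dp by (simp add: degree_monom_eq coeff_eq_0)
    show "poly (monom 1 n + - p) c = 0" using p(3) m(2) by (simp add: poly_monom)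
    show "monom 1 n + - p \<in> polys A" using p(1) by auto
  qed
  then show ?thesis using c(1) by (intro A_integrally_closed)
qed

text \<open>
  Two powers of \<open>I\<close> are in the same class: \<open>L M = \<beta> M\<close> with \<open>M = I\<^sup>m\<close> and \<open>L = I\<^bsup>n-m\<^esup>\<close>. So the elements of
  \<open>N = \<beta>\<^sup>-\<^sup>1 L\<close> multiply \<open>M\<close> into itself, which puts \<open>N\<close> inside \<open>A\<close>, and \<open>N M = M\<close> forces \<open>N = A\<close>.
\<close>
lemma ideal_power_principal:
  assumes I: "nonzero_ideal I"
  shows "\<exists>n>0. \<exists>\<alpha>\<in>A. \<alpha> \<noteq> 0 \<and> A.ideal_pow I n = (*) \<alpha> ` A"
proof -
  obtain \<J> where J: "finite \<J>"
    "\<And>I. nonzero_ideal I \<Longrightarrow> \<exists>c\<in>k. c \<noteq> 0 \<and> (\<exists>J\<in>\<J>. I = (*) c ` J)"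
    using finitely_many_ideal_classes by blast
  have "\<forall>n. \<exists>c J. c \<in> k \<and> c \<noteq> 0 \<and> J \<in> \<J> \<and> A.ideal_pow I n = (*) c ` J"
    using J(2)[OF nonzero_ideal_pow[OF I]] by blast
  then obtain c J where cJ: "\<And>n. c n \<in> k \<and> c n \<noteq> 0 \<and> J n \<in> \<J> \<and> A.ideal_pow I n = (*) (c n) ` J n" by metis
  have "finite (range J)" using J(1) cJ finite_subset[of "range J" \<J>] by blast
  then have "\<not> inj J" using finite_imageD infinite_UNIV_nat by blast
  then obtain m n where mn: "J m = J n" "m < n" by (metis injI linorder_neqE_nat)
  define \<beta> where "\<beta> = c n / c m"
  have \<beta>: "\<beta> \<in> k" "\<beta> \<noteq> 0" using cJ by (auto simp: \<beta>_def)
  define M where "M = A.ideal_pow I m"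
  define L where "L = A.ideal_pow I (n - m)"
  define N where "N = (*) (inverse \<beta>) ` L"
  have M: "nonzero_ideal M" and L: "nonzero_ideal L" using nonzero_ideal_pow[OF I] by (auto simp: M_def L_def)
  have "A.ideal_pow I n = (*) \<beta> ` M"
    using cJ[of n] cJ[of m] by (simp add: \<beta>_def M_def image_image mn(1))
  moreover have "A.ideal_pow I n = L \<odot> M"
    using A.ideal_pow_add[OF nonzero_idealD(1)[OF I], of "n - m" m] mn(2) by (simp add: L_def M_def)
  ultimately have "L \<odot> M = (*) \<beta> ` M" by simp
  then have NM: "N \<odot> M = M" using \<beta>(2) by (simp add: N_def prod_ideal_scale scale_inverse)
  have N_sub: "submodule_of A N" unfolding N_def by (rule A.submodule_scale) (rule nonzero_idealD(1)[OF L])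
  have "N \<subseteq> A"
  proof
    fix x assume x: "x \<in> N"
    have "x \<in> k" using x \<beta>(1) nonzero_idealD(2)[OF L] A_k by (auto simp: N_def)
    then show "x \<in> A"
      using prod_ideal_mem[OF x, of _ M] NM by (intro multiplier_in_A[OF M]) auto
  qed
  then have "1 \<in> N" using nakayama_ideal[OF N_sub _ M] NM by simp
  then have "N = A" using N_sub \<open>N \<subseteq> A\<close> by (fastforce simp: submodule_of_def)
  then have "L = (*) \<beta> ` A" using scale_inverse(2)[OF \<beta>(2), of L] by (simp add: N_def)
  moreover from this have "\<beta> \<in> A" using nonzero_idealD(2)[OF L] by force
  ultimately show ?thesis
    using mn(2) \<beta>(2) by (intro exI[of _ "n - m"] conjI bexI[of _ \<beta>]) (auto simp: L_def)
qed

section \<open>Degrees of powers of a prime ideal\<close>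

text \<open>
  As \<open>A/p\<close> is finite, two powers of \<open>y\<close> are congruent modulo \<open>p\<close>; if \<open>y\<close> is not in \<open>p\<close>, it follows that some positive power
  of \<open>y\<close> is congruent to 1.
\<close>
lemma prime_ideal_maximal:
  assumes p: "nonzero_ideal p" "1 \<notin> p" "\<And>x y. x \<in> A \<Longrightarrow> y \<in> A \<Longrightarrow> x * y \<in> p \<Longrightarrow> x \<in> p \<or> y \<in> p"
    and Y: "submodule_of A Y" "p \<subseteq> Y" "Y \<subseteq> A" "Y \<noteq> p"
  shows "Y = A"
proof -
  obtain y where y: "y \<in> Y" "y \<notin> p" using Y by blast
  then have yA: "y \<in> A" using Y by blast
  have "\<exists>i\<in>UNIV. \<exists>j\<in>UNIV. i \<noteq> j \<and> y ^ i - y ^ j \<in> p"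
    by (rule pigeonhole_cosets[OF nonzero_idealD(4,5)[OF p(1)]]) (use yA in auto)
  then obtain i j where "i < j" "y ^ i - y ^ j \<in> p"
    using add_subgroupD(3)[OF nonzero_idealD(4)[OF p(1)]] by (metis linorder_neqE_nat minus_diff_eq)
  moreover have "y ^ i - y ^ j = y ^ i * (1 - y ^ (j - i))"
    using \<open>i < j\<close> by (simp add: algebra_simps flip: power_add)
  moreover have "y ^ n \<notin> p" for n
    by (induction n) (use p(2,3) y(2) yA in auto)
  ultimately have "1 - y ^ (j - i) \<in> Y" using p(3)[of "y ^ i" "1 - y ^ (j - i)"] yA Y(2) by auto
  moreover have "y ^ (j - i) \<in> Y"
  proof -
    have "y ^ (j - i) = y ^ (j - i - 1) * y" using power_minus_mult[of "j - i" y] \<open>i < j\<close> by simp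
    then show ?thesis using Y(1) y(1) yA by (auto simp: submodule_of_def)
  qed
  ultimately have "1 \<in> Y" using add_subgroupD(4)[OF A.submodule_add_subgroup[OF Y(1)]] by fastforce
  then show ?thesis using Y(1,3) by (fastforce simp: submodule_of_def)
qed

lemma submodule_sum:
  assumes "submodule_of A I" "submodule_of A J"
  shows "submodule_of A {i + j | i j. i \<in> I \<and> j \<in> J}" (is "submodule_of A ?S")
proof -
  have S: "u \<in> ?S" if "u = i + j" "i \<in> I" "j \<in> J" for u i j using that by blast
  show ?thesis
    unfolding submodule_of_def
  proof (intro conjI ballI)
    show "0 \<in> ?S" by (rule S[of _ 0 0]) (use assms in \<open>auto simp: submodule_of_def\<close>)
  next
    fix x y assume "x \<in> ?S" "y \<in> ?S"
    then obtain i j i' j' where "x = i + j" "i \<in> I" "j \<in> J" "y = i' + j'" "i' \<in> I" "j' \<in> J" by blast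
    then show "x + y \<in> ?S" by (intro S[of _ "i + i'" "j + j'"]) (use assms in \<open>auto simp: submodule_of_def\<close>)
  next
    fix b x assume "b \<in> A" "x \<in> ?S"
    then obtain i j where "x = i + j" "i \<in> I" "j \<in> J" by blast
    then show "b * x \<in> ?S"
      by (intro S[of _ "b * i" "b * j"]) (use assms \<open>b \<in> A\<close> in \<open>auto simp: submodule_of_def algebra_simps\<close>)
  qed
qed

text \<open>
  By invertibility of \<open>p\<close>, an ideal strictly between \<open>p\<^bsup>i+1\<^esup>\<close> and \<open>p\<^sup>i\<close> would give one strictly between \<open>p\<close> and \<open>A\<close>. So any
  \<open>x \<in> p\<^sup>i\<close> outside \<open>p\<^bsup>i+1\<^esup>\<close> generates \<open>p\<^sup>i\<close> modulo \<open>p\<^bsup>i+1\<^esup>\<close>, and multiplication by \<open>x\<close> identifies \<open>A/p\<close> with \<open>p\<^sup>i/p\<^bsup>i+1\<^esup>\<close>.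
\<close>
lemma index_prime_power:
  assumes p: "nonzero_ideal p" "1 \<notin> p" "\<And>x y. x \<in> A \<Longrightarrow> y \<in> A \<Longrightarrow> x * y \<in> p \<Longrightarrow> x \<in> p \<or> y \<in> p"
  shows "index A (A.ideal_pow p f) = index A p ^ f"
proof -
  let ?P = "A.ideal_pow p"
  have sub: "submodule_of A p" using p(1) by (rule nonzero_idealD)
  have P: "nonzero_ideal (?P i)" for i by (rule nonzero_ideal_pow[OF p(1)])
  have Suc_sub: "?P (Suc i) \<subseteq> ?P i" for i
    using prod_ideal_mono[OF order_refl nonzero_idealD(2)[OF p(1)], of "?P i"]
      A.prod_ideal_one[OF nonzero_idealD(1)[OF P[of i]]] by (simp add: prod_ideal_commute)
  obtain n \<alpha> where n: "n > 0" "\<alpha> \<in> A" "\<alpha> \<noteq> 0" "?P n = (*) \<alpha> ` A"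
    using ideal_power_principal[OF p(1)] by blast
  have step: "index (?P i) (?P (Suc i)) = index A p" for i
  proof -
    \<comment> \<open>up to the scalar \<open>\<alpha>\<^sup>i\<close>, the ideal \<open>W\<close> is inverse to \<open>p\<^sup>i\<close>\<close>
    define W where "W = ?P (n * i - i)"
    have W: "submodule_of A W" using nonzero_idealD(1)[OF P] by (simp add: W_def)
    have "?P i \<odot> W = ?P (n * i)"
      using A.ideal_pow_add[OF sub, of i "n * i - i"] n(1) by (simp add: W_def)
    then have PW: "?P i \<odot> W = (*) (\<alpha> ^ i) ` A"
      by (simp add: A.ideal_pow_mult[OF sub] n(4) A.ideal_pow_principal)
    have \<alpha>i: "\<alpha> ^ i \<noteq> 0" using n(3) by simp
    have PW_p: "?P (Suc i) \<odot> W = (*) (\<alpha> ^ i) ` p"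
    proof -
      have "?P (Suc i) \<odot> W = p \<odot> (?P i \<odot> W)"
        by (simp add: prod_ideal_commute[of "?P i" p] prod_ideal_assoc)
      also have "\<dots> = (*) (\<alpha> ^ i) ` (A \<odot> p)"
        unfolding PW by (simp only: prod_ideal_commute[of p] prod_ideal_scale)
      finally show ?thesis by (simp add: A.prod_ideal_one[OF sub])
    qed
    \<comment> \<open>multiplication by \<open>W\<close> is injective on ideals\<close>
    have cancel: "Z = Z'" if "Z \<odot> W = Z' \<odot> W" "submodule_of A Z" "submodule_of A Z'" for Z Z'
    proof -
      have "(*) (\<alpha> ^ i) ` Z'' = Z'' \<odot> W \<odot> ?P i" if "submodule_of A Z''" for Z''
      proof -
        have "Z'' \<odot> W \<odot> ?P i = Z'' \<odot> (*) (\<alpha> ^ i) ` A"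
          unfolding prod_ideal_assoc prod_ideal_commute[of W "?P i"] PW ..
        also have "\<dots> = (*) (\<alpha> ^ i) ` A \<odot> Z''" by (rule prod_ideal_commute)
        also have "\<dots> = (*) (\<alpha> ^ i) ` Z''" by (simp only: prod_ideal_scale A.prod_ideal_one[OF that])
        finally show ?thesis ..
      qed
      then have "(*) (\<alpha> ^ i) ` Z = (*) (\<alpha> ^ i) ` Z'" using that by simp
      moreover have "inj ((*) (\<alpha> ^ i))" using \<alpha>i by (auto intro: injI)
      ultimately show ?thesis by (simp add: inj_image_eq_iff)
    qed
    have "?P i \<noteq> ?P (Suc i)"
    proof
      assume "?P i = ?P (Suc i)"
      then have "(*) (\<alpha> ^ i) ` A = (*) (\<alpha> ^ i) ` p" using PW PW_p by simp
      then have "1 \<in> p" using \<alpha>i A.one_in by (metis (no_types, lifting) imageE image_eqI mult_left_cancel)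
      then show False using p(2) by simp
    qed
    then obtain x where x: "x \<in> ?P i" "x \<notin> ?P (Suc i)" using Suc_sub by blast
    have xA: "x \<in> A" using x(1) nonzero_idealD(2)[OF P] by blast
    define Z where "Z = {u + v | u v. u \<in> (*) x ` A \<and> v \<in> ?P (Suc i)}"
    have Z: "submodule_of A Z" unfolding Z_def
      by (intro submodule_sum A.submodule_scale A.submodule_self nonzero_idealD(1)[OF P])
    have Z_mem: "x * b + v \<in> Z" if "b \<in> A" "v \<in> ?P (Suc i)" for b v using that by (auto simp: Z_def)
    have xZ: "x \<in> Z" using Z_mem[of 1 0] nonzero_idealD(8)[OF P, of "Suc i"] by auto
    have PZ: "?P (Suc i) \<subseteq> Z" using Z_mem[of 0] by auto
    have ZP: "Z \<subseteq> ?P i"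
    proof
      fix z assume "z \<in> Z"
      then obtain b v where "b \<in> A" "v \<in> ?P (Suc i)" "z = x * b + v" by (auto simp: Z_def)
      moreover from this have "x * b \<in> ?P i" "v \<in> ?P i"
        using principal_subset[OF P x(1)] Suc_sub by blast+
      ultimately show "z \<in> ?P i" using nonzero_idealD(6)[OF P] by blast
    qed
    define Y where "Y = (*) (inverse (\<alpha> ^ i)) ` (Z \<odot> W)"
    have ZW: "Z \<odot> W = (*) (\<alpha> ^ i) ` Y" unfolding Y_def scale_inverse(2)[OF \<alpha>i] ..
    have "Y = A"
    proof (rule prime_ideal_maximal[OF p])
      show "submodule_of A Y" unfolding Y_def by (intro A.submodule_scale A.submodule_prod Z W)
      show "p \<subseteq> Y"
      proof
        fix b assume "b \<in> p"
        then have "\<alpha> ^ i * b \<in> ?P (Suc i) \<odot> W" unfolding PW_p by blast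
        then have "\<alpha> ^ i * b \<in> Z \<odot> W" using prod_ideal_mono[OF PZ order_refl] by blast
        then show "b \<in> Y" unfolding Y_def using \<alpha>i by (intro image_eqI[of _ _ "\<alpha> ^ i * b"]) auto
      qed
      show "Y \<subseteq> A"
      proof
        fix b assume "b \<in> Y"
        then have "\<alpha> ^ i * b \<in> Z \<odot> W" unfolding ZW by blast
        then have "\<alpha> ^ i * b \<in> (*) (\<alpha> ^ i) ` A" using prod_ideal_mono[OF ZP order_refl] PW by blast
        then show "b \<in> A" using \<alpha>i by auto
      qed
      show "Y \<noteq> p"
      proof
        assume "Y = p"
        have "Z \<odot> W = ?P (Suc i) \<odot> W" unfolding ZW PW_p \<open>Y = p\<close> ..
        then have "Z = ?P (Suc i)" by (rule cancel[OF _ Z nonzero_idealD(1)[OF P]])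
        then show False using xZ x(2) by simp
      qed
    qed
    then have "Z \<odot> W = ?P i \<odot> W" unfolding ZW PW by simp
    then have Z_eq: "Z = ?P i" by (rule cancel[OF _ Z nonzero_idealD(1)[OF P]])
    define Y' where "Y' = {b \<in> A. b * x \<in> ?P (Suc i)}"
    have px: "b * x \<in> ?P (Suc i)" if "b \<in> p" for b
      using prod_ideal_mem[OF x(1) that] by (simp add: mult.commute)
    have "Y' = p"
    proof (rule ccontr)
      assume "Y' \<noteq> p"
      have "Y' = A"
        by (rule prime_ideal_maximal[OF p])
           (use \<open>Y' \<noteq> p\<close> px nonzero_idealD[OF P[of "Suc i"]] nonzero_idealD(2)[OF p(1)]
             in \<open>auto simp: Y'_def submodule_of_def distrib_right mult.assoc\<close>)
      then have "1 * x \<in> ?P (Suc i)" using A.one_in unfolding Y'_def by blast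
      then show False using x(2) by simp
    qed
    have "index A p = index (?P i) (?P (Suc i))"
    proof (rule index_eq(1)[where f = "\<lambda>b. b * x"])
      fix b b' assume "b \<in> A" "b' \<in> A"
      then have "b - b' \<in> p \<longleftrightarrow> (b - b') * x \<in> ?P (Suc i)" using \<open>Y' = p\<close> by (auto simp: Y'_def)
      then show "b - b' \<in> p \<longleftrightarrow> b * x - b' * x \<in> ?P (Suc i)" by (simp add: left_diff_distrib)
    next
      fix v assume "v \<in> ?P i"
      then have "v \<in> Z" by (simp add: Z_eq)
      then obtain b w where b: "b \<in> A" "w \<in> ?P (Suc i)" "v = x * b + w" by (auto simp: Z_def)
      then have "b * x - v = - w" by (simp add: mult.commute)
      then show "\<exists>u\<in>A. u * x - v \<in> ?P (Suc i)"
        using b add_subgroupD(3)[OF nonzero_idealD(4)[OF P]] by metis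
    qed (use nonzero_idealD[OF P] nonzero_idealD(4)[OF P[of "Suc i"]] nonzero_idealD(4)[OF p(1)] x(1) in auto)
    then show ?thesis ..
  qed
  show ?thesis
  proof (induction f)
    case 0
    show ?case using index_self[OF A.submodule_add_subgroup[OF A.submodule_self]] by simp
  next
    case (Suc f)
    have "index A (?P (Suc f)) = index A (?P f) * index (?P f) (?P (Suc f))"
      by (intro index_tower nonzero_idealD[OF P] A.submodule_add_subgroup[OF A.submodule_self] Suc_sub)
    then show ?case using Suc step by simp
  qed
qed

lemma index_eq_card_Quot: "index A I = card (carrier (ring_on A Quot I))"
proof -
  have "carrier (ring_on A Quot I) = cosets A I"
    by (auto simp: FactRing_def A_RCOSETS_def' a_r_coset_def' cosets_def coset_def add.commute ring_of_type_algebra_def)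
  then show ?thesis by (simp add: index_def)
qed

lemma ideal_deg_eq: "index A I = card Fr ^ d \<Longrightarrow> ideal_deg Fr k I = d"
proof -
  assume d: "index A I = card Fr ^ d"
  note r = card_Fr_ge_2
  show ?thesis
    unfolding ideal_deg_def index_eq_card_Quot[symmetric] d
    by (rule the_equality) (use r in auto)
qed

lemma prime_ideal_powers:
  assumes p: "nonzero_ideal p" "1 \<notin> p" "\<And>x y. x \<in> A \<Longrightarrow> y \<in> A \<Longrightarrow> x * y \<in> p \<Longrightarrow> x \<in> p \<or> y \<in> p"
  shows "\<exists>d n \<alpha>. n > 0 \<and> \<alpha> \<in> A \<and> \<alpha> \<noteq> 0 \<and> A.ideal_pow p n = (*) \<alpha> ` A \<and>
    abs_inf \<alpha> = real (card Fr) ^ (d * n) \<and> (\<forall>f. ideal_deg Fr k (A.ideal_pow p f) = d * f)"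
proof -
  obtain n \<alpha> where n: "n > 0" "\<alpha> \<in> A" "\<alpha> \<noteq> 0" "A.ideal_pow p n = (*) \<alpha> ` A"
    using ideal_power_principal[OF p(1)] by blast
  obtain d where d: "index A p = card Fr ^ d"
    using index_ideal(3)[of p] p(1) by (auto simp: nonzero_ideal_def)
  have idx: "index A (A.ideal_pow p f) = card Fr ^ (d * f)" for f
    using index_prime_power[OF p] d by (simp add: power_mult)
  have "abs_inf \<alpha> = real (card Fr) ^ (d * n)"
    using index_principal[OF n(2,3)] idx[of n] n(4) by simp
  then show ?thesis using n ideal_deg_eq[OF idx] by blast
qed

lemma frac_ideal_nonzero_ideal: "nonzero_ideal I \<Longrightarrow> I \<in> carrier (frac_ideals A)"
proof -
  assume I: "nonzero_ideal I"
  have "subgroup I (add_monoid RT)"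
    by (rule RT.add.subgroupI) (use nonzero_idealD[OF I] add_subgroupD(3)[OF nonzero_idealD(4)[OF I]] in auto)
  then show ?thesis
    using nonzero_idealD[OF I] unfolding frac_ideals_def frac_ideal_def
    by (auto simp: additive_subgroup_def intro!: bexI[of _ 1])
qed

end

section \<open>One-units\<close>

context infinite_place
begin

definition one_unit :: "'c \<Rightarrow> bool" where
  "one_unit u \<longleftrightarrow> abs_inf (u - 1) < 1"

lemma one_unit_abs: "one_unit u \<Longrightarrow> abs_inf u = 1"
  using abs_eq_if_close[of u 1] by (simp add: one_unit_def)

lemma one_unit_nonzero: "one_unit u \<Longrightarrow> u \<noteq> 0"
  using one_unit_abs by fastforce

lemma one_unit_1 [simp]: "one_unit 1" by (simp add: one_unit_def)

lemma one_unit_mult: "one_unit u \<Longrightarrow> one_unit v \<Longrightarrow> one_unit (u * v)"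
proof -
  assume uv: "one_unit u" "one_unit v"
  have "u * v - 1 = u * (v - 1) + (u - 1)" by (simp add: algebra_simps)
  then have "abs_inf (u * v - 1) \<le> max (abs_inf (u * (v - 1))) (abs_inf (u - 1))"
    using abs_add_le[of "u * (v - 1)" "u - 1"] by (simp only:)
  then show "one_unit (u * v)"
    using uv one_unit_abs[OF uv(1)] by (simp add: one_unit_def abs_mult max_def split: if_splits)
qed

lemma one_unit_power: "one_unit u \<Longrightarrow> one_unit (u ^ n)"
  by (induction n) (auto intro: one_unit_mult)

lemma one_unit_divide: "one_unit u \<Longrightarrow> one_unit v \<Longrightarrow> one_unit (u / v)"
proof -
  assume uv: "one_unit u" "one_unit v"
  have "u / v - 1 = ((u - 1) - (v - 1)) / v" using one_unit_nonzero[OF uv(2)] by (simp add: field_simps)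
  then show "one_unit (u / v)"
    using abs_diff_le[of "u - 1" "v - 1"] uv one_unit_abs[OF uv(2)]
    by (simp add: one_unit_def abs_divide max_def split: if_splits)
qed

text \<open>
  The \<open>p\<close>-part of \<open>n\<close> is removed by injectivity of the Frobenius map. For \<open>m\<close> prime to \<open>p\<close>, the sum \<open>1 + u + \<dots> + u\<^bsup>m-1\<^esup>\<close> is
  close to \<open>m\<close>, hence nonzero.
\<close>
lemma one_unit_torsion_free:
  assumes u: "one_unit u" and n: "n > 0" "u ^ n = 1"
  shows "u = 1"
proof -
  let ?p = "CHAR('c)"
  obtain m where m: "n = ?p ^ multiplicity ?p n * m" "\<not> ?p dvd m"
    using n(1) prime_CHAR by (metis multiplicity_decompose' neq0_conv not_prime_unit)
  have "(u ^ m) ^ (?p ^ multiplicity ?p n) = 1"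
    using n(2) by (subst (asm) m(1)) (simp add: power_mult[symmetric] mult.commute)
  then have um: "u ^ m = 1" using frobenius_inj[of "u ^ m" _ 1] by simp
  have "(of_nat m :: 'c) \<noteq> 0" using m(2) by (simp add: of_nat_eq_0_iff_char_dvd)
  then have abs_m: "abs_inf (of_nat m :: 'c) = 1" using abs_Fr Fr.of_nat_in by blast
  have "abs_inf (\<Sum>i<m. u ^ i - 1) < 1"
    using one_unit_power[OF u] by (intro abs_sum_less) (auto simp: one_unit_def)
  moreover have "(\<Sum>i<m. u ^ i) = (\<Sum>i<m. u ^ i - 1) + of_nat m" by (simp add: sum_subtractf)
  ultimately have "abs_inf (\<Sum>i<m. u ^ i) = 1"
    using abs_add_eq[of "\<Sum>i<m. u ^ i - 1" "of_nat m"] abs_m by simp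
  moreover have "(u - 1) * (\<Sum>i<m. u ^ i) = 0" using um power_diff_1_eq[of u m] by simp
  ultimately show ?thesis by auto
qed

lemma one_unit_tendsto: "one_unit u \<Longrightarrow> (\<lambda>n. u ^ (CHAR('c) ^ n)) \<longlonglongrightarrow> 1"
  unfolding tendsto_iff_abs
proof (rule tendsto_sandwich[OF _ _ tendsto_const])
  assume u: "one_unit u"
  then show "(\<lambda>n. abs_inf (u - 1) ^ n) \<longlonglongrightarrow> 0" by (intro LIMSEQ_realpow_zero) (auto simp: one_unit_def)
  show "\<forall>\<^sub>F n in sequentially. abs_inf (u ^ CHAR('c) ^ n - 1) \<le> abs_inf (u - 1) ^ n"
  proof (rule always_eventually, rule allI)
    fix n
    have "n < CHAR('c) ^ n" using prime_gt_1_nat[OF prime_CHAR] by (intro power_gt_expt) simp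
    then have "abs_inf (u - 1) ^ (CHAR('c) ^ n) \<le> abs_inf (u - 1) ^ n"
      using u by (intro power_decreasing) (auto simp: one_unit_def)
    then show "abs_inf (u ^ CHAR('c) ^ n - 1) \<le> abs_inf (u - 1) ^ n"
      using frobenius_diff[of u 1 n] by (simp flip: abs_power)
  qed
qed simp

text \<open>
  Write \<open>M = p\<^sup>t m\<close> with \<open>m\<close> prime to \<open>p\<close>. The \<open>m\<close>-th root \<open>\<rho>\<close> of \<open>w\<close> that is a one-unit lies in the complete field
  \<open>K\<close>, so only the \<open>p\<^sup>t\<close>-th root of \<open>\<rho>\<close> may lead out of \<open>K\<close>.
\<close>
lemma one_unit_root:
  assumes w: "one_unit w" "w \<in> K" and M: "M > 0"
  shows "\<exists>u. one_unit u \<and> u ^ M = w \<and> (\<exists>t. u ^ (CHAR('c) ^ t) \<in> K)"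
proof -
  let ?p = "CHAR('c)"
  define t where "t = multiplicity ?p M"
  obtain m where m: "M = ?p ^ t * m" "\<not> ?p dvd m"
    unfolding t_def using M prime_CHAR by (metis multiplicity_decompose' neq0_conv not_prime_unit)
  have m0: "m > 0" using m(2) by (cases m) auto
  let ?f = "monom 1 m - [:w:]"
  have deg: "degree ?f = m" "lead_coeff ?f = 1"
  proof -
    have "degree [:w:] < degree (monom (1 :: 'c) m)" using m0 by (simp add: degree_monom_eq)
    then have "degree (monom 1 m + - [:w:]) = degree (monom (1 :: 'c) m)"
      by (intro degree_add_eq_left) simp
    then show 1: "degree ?f = m" by (simp only: diff_conv_add_uminus degree_monom_eq[OF one_neq_zero])
    show "lead_coeff ?f = 1" unfolding 1 using m0 by (simp add: coeff_pCons split: nat.splits)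
  qed
  have "?f \<noteq> 0" using deg(2) by (metis leading_coeff_0_iff zero_neq_one)
  moreover have "abs_inf (poly ?f 1) < 1"
    using w(1) by (simp add: poly_monom one_unit_def abs_diff_commute)
  ultimately obtain \<rho> where \<rho>: "poly ?f \<rho> = 0" "abs_inf (1 - \<rho>) < 1"
    using poly_small_root[of ?f 1] deg(2) by auto
  have \<rho>m: "\<rho> ^ m = w" using \<rho>(1) by (simp add: poly_monom)
  have \<rho>1: "one_unit \<rho>" using \<rho>(2) by (simp add: one_unit_def abs_diff_commute)
  have \<rho>0: "\<rho> \<noteq> 0" using one_unit_nonzero[OF \<rho>1] .
  \<comment> \<open>\<open>p\<close> has finite order \<open>N\<close> modulo \<open>m\<close>, so \<open>\<rho>\<close> agrees with \<open>\<rho>\<^bsup>Q\<^esup>\<close> up to a factor in \<open>K\<close>, where \<open>Q = p\<^sup>N\<close>;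
    iterating, \<open>\<rho>\<close> is a limit of elements of \<open>K\<close>\<close>
  have "coprime ?p m" using m(2) prime_CHAR prime_imp_coprime by blast
  then have cong: "[?p ^ totient m = 1] (mod m)" by (rule euler_theorem)
  have N0: "totient m > 0" using m0 by simp
  define Q where "Q = ?p ^ totient m"
  have Q2: "Q \<ge> 1" using prime_CHAR by (simp add: Q_def prime_gt_0_nat Suc_leI)
  obtain e where e: "Q = 1 + m * e"
    using cong Q2 unfolding Q_def by (metis cong_le_nat add.commute mult.commute)
  have \<rho>Q: "\<rho> ^ Q = \<rho> * w ^ e" unfolding e by (simp add: power_add power_mult \<rho>m)
  have ratio: "\<exists>c\<in>K. \<rho> = c * \<rho> ^ (Q ^ n)" for n
  proof (induction n)
    case (Suc n)
    then obtain c where c: "c \<in> K" "\<rho> = c * \<rho> ^ (Q ^ n)" by blast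
    have "\<rho> = \<rho> ^ Q * inverse (w ^ e)"
      using \<rho>Q one_unit_nonzero[OF w(1)] by simp
    then have "\<rho> ^ (Q ^ n) = (\<rho> ^ Q * inverse (w ^ e)) ^ (Q ^ n)" by simp
    also have "\<dots> = \<rho> ^ (Q ^ Suc n) * inverse (w ^ e) ^ (Q ^ n)"
      by (simp only: power_mult_distrib power_Suc power_mult[symmetric])
    finally have "\<rho> = (c * inverse (w ^ e) ^ (Q ^ n)) * \<rho> ^ (Q ^ Suc n)"
      using c(2) by (simp add: mult_ac)
    moreover have "c * inverse (w ^ e) ^ (Q ^ n) \<in> K" using c(1) w(2) by auto
    ultimately show ?case by blast
  qed (auto intro: bexI[of _ 1])
  have "(\<lambda>n. \<rho> ^ (Q ^ n)) \<longlonglongrightarrow> 1"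
  proof -
    have "strict_mono (\<lambda>n. totient m * n)" using N0 by (simp add: strict_mono_def)
    then have "((\<lambda>n. \<rho> ^ (?p ^ n)) \<circ> (\<lambda>n. totient m * n)) \<longlonglongrightarrow> 1"
      by (rule LIMSEQ_subseq_LIMSEQ[OF one_unit_tendsto[OF \<rho>1]])
    then show ?thesis by (simp add: Q_def o_def power_mult)
  qed
  then have "(\<lambda>n. \<rho> * inverse (\<rho> ^ (Q ^ n))) \<longlonglongrightarrow> \<rho> * inverse 1"
    by (intro tendsto_mult_abs tendsto_inverse_abs tendsto_const) auto
  then have "(\<lambda>n. \<rho> * inverse (\<rho> ^ (Q ^ n))) \<longlonglongrightarrow> \<rho>" by simp
  moreover have "\<rho> * inverse (\<rho> ^ (Q ^ n)) \<in> K" for n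
  proof -
    obtain c where "c \<in> K" "\<rho> = c * \<rho> ^ (Q ^ n)" using ratio by blast
    moreover from this have "\<rho> * inverse (\<rho> ^ (Q ^ n)) = c"
      using \<rho>0 by (metis divide_inverse nonzero_mult_div_cancel_right power_not_zero)
    ultimately show ?thesis by simp
  qed
  ultimately have \<rho>K: "\<rho> \<in> K" by (rule closed_K[rotated])
  obtain u where u: "u ^ (?p ^ t) = \<rho>"
    using nth_root_exists[of "?p ^ t" \<rho>] prime_CHAR by (auto simp: prime_gt_0_nat)
  have "abs_inf (u - 1) ^ (?p ^ t) < 1"
    using \<rho>1 frobenius_diff[of u 1 t] by (simp add: one_unit_def u flip: abs_power)
  then have "one_unit u"
    unfolding one_unit_def by (meson one_le_power not_le zero_le_dist)
  moreover have "u ^ M = w" by (simp add: m(1) power_mult u \<rho>m)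
  ultimately show ?thesis using u \<rho>K by blast
qed

section \<open>Exponentiation by \<open>p\<close>-adic integers\<close>

lemma padic_int_mod: "padic_int p y \<Longrightarrow> n \<le> m \<Longrightarrow> y m mod p ^ n = y n"
proof (induction "m - n" arbitrary: m)
  case 0
  then show ?case by (simp add: padic_int_def)
next
  case (Suc d)
  then obtain m' where m': "m = Suc m'" by (cases m) auto
  have "y m mod p ^ n = (y m mod p ^ m') mod p ^ n"
    using Suc m' by (intro mod_mod_cancel[symmetric] le_imp_power_dvd) auto
  also have "\<dots> = y m' mod p ^ n" using Suc.prems(1) by (simp add: padic_int_def m')
  also have "\<dots> = y n" using Suc m' by (intro Suc.hyps(1)) auto
  finally show ?case .
qed

text \<open>Modulo \<open>p\<close>, the power \<open>(1 + X)\<^sup>P\<close> is \<open>1 + X\<^sup>P\<close> for \<open>P = p\<^sup>n\<close>, which does not affect coefficients below \<open>P\<close>.\<close>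
lemma binomial_stable:
  assumes "j < CHAR('c) ^ n" "b mod CHAR('c) ^ n = c mod CHAR('c) ^ n"
  shows "(of_nat (b choose j) :: 'c) = of_nat (c choose j)"
proof -
  let ?P = "CHAR('c) ^ n"
  let ?x = "[:1, 1:] :: 'c poly"
  have pow: "coeff (?x ^ N) j = of_nat (N choose j)" for N
  proof (cases "j \<le> N")
    case True
    then show ?thesis by (simp add: coeff_linear_poly_power)
  next
    case False
    then have "degree (?x ^ N) < j" using degree_power_le[of ?x N] by simp
    then show ?thesis using False by (simp add: coeff_eq_0 binomial_eq_0)
  qed
  have "?x = 1 + monom 1 1" by (simp add: monom_altdef one_pCons)
  then have "?x ^ ?P = 1 + monom 1 1 ^ ?P"
    using freshmans_dream'[where 'a = "'c poly", OF _ refl, of 1 "monom 1 1" n] prime_CHAR by simp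
  then have xP: "?x ^ ?P = 1 + monom 1 ?P" by (simp add: monom_power)
  have "\<exists>g. (?x ^ ?P) ^ e = 1 + monom 1 ?P * g" for e
  proof (induction e)
    case (Suc e)
    then obtain g where "(?x ^ ?P) ^ e = 1 + monom 1 ?P * g" by blast
    then show ?case unfolding power_Suc xP
      by (intro exI[of _ "1 + g + monom 1 ?P * g"]) (simp add: algebra_simps)
  qed (auto intro: exI[of _ 0])
  then have "coeff (?x ^ b) j = coeff (?x ^ (b mod ?P)) j" for b
  proof -
    obtain g where g: "(?x ^ ?P) ^ (b div ?P) = 1 + monom 1 ?P * g"
      using \<open>\<And>e. \<exists>g. (?x ^ ?P) ^ e = 1 + monom 1 ?P * g\<close> by blast
    have "?x ^ b = ?x ^ (b mod ?P) * (?x ^ ?P) ^ (b div ?P)"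
      by (simp only: power_mult[symmetric] power_add[symmetric] mod_mult_div_eq)
    also have "\<dots> = ?x ^ (b mod ?P) + monom 1 ?P * (?x ^ (b mod ?P) * g)"
      unfolding g by (simp add: algebra_simps)
    finally show ?thesis using assms(1) by (simp add: coeff_monom_mult)
  qed
  then show ?thesis using pow assms(2) by metis
qed

lemma summable_if_terms_tendsto_0:
  assumes "(\<lambda>j. abs_inf (f j :: 'c)) \<longlonglongrightarrow> 0"
  shows "\<exists>s. f sums s"
proof -
  have "Cauchy (\<lambda>n. \<Sum>j<n. f j)"
  proof (rule metric_CauchyI)
    fix e :: real assume e: "e > 0"
    then have "\<forall>\<^sub>F j in sequentially. abs_inf (f j) < e" using assms by (rule order_tendstoD(2)[rotated])
    then obtain N where N: "\<And>j. j \<ge> N \<Longrightarrow> abs_inf (f j) < e" by (auto simp: eventually_sequentially)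
    have *: "dist (\<Sum>j<m. f j) (\<Sum>j<n. f j) < e" if "m \<ge> N" "n \<ge> m" for m n
    proof -
      have "(\<Sum>j<n. f j) - (\<Sum>j<m. f j) = (\<Sum>j=m..<n. f j)"
        using that(2) by (simp add: sum_diff_nat_ivl lessThan_atLeast0)
      moreover have "abs_inf (\<Sum>j=m..<n. f j) < e" using N that(1) e by (intro abs_sum_less) auto
      ultimately show ?thesis by (metis dist_abs abs_diff_commute)
    qed
    show "\<exists>M. \<forall>m\<ge>M. \<forall>n\<ge>M. dist (\<Sum>j<m. f j) (\<Sum>j<n. f j) < e"
    proof (intro exI[of _ N] allI impI)
      fix m n assume "N \<le> m" "N \<le> n"
      then show "dist (\<Sum>j<m. f j) (\<Sum>j<n. f j) < e"
        using *[of m n] *[of n m] by (cases "m \<le> n") (auto simp: dist_commute)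
    qed
  qed
  then have "convergent (\<lambda>n. \<Sum>j<n. f j)" by (rule Cauchy_convergent)
  then show ?thesis by (auto simp: convergent_def sums_def)
qed

text \<open>
  The partial sums of the binomial series up to \<open>p\<^sup>n\<close> are the ordinary powers with exponent
  the residue \<open>y n\<close>.
\<close>
lemma unit_powp_tendsto:
  assumes "padic_int CHAR('c) y" "one_unit u"
  shows "(\<lambda>n. u ^ y n) \<longlonglongrightarrow> unit_powp u y"
proof -
  let ?p = "CHAR('c)"
  have p2: "2 \<le> ?p" by (rule prime_ge_2_nat[OF prime_CHAR])
  have binom: "padic_binom y j = (of_nat (y n choose j) :: 'c)" if j: "j < ?p ^ n" for j n
    unfolding padic_binom_def
  proof (rule limI, rule tendsto_eventually)
    have "of_nat (y m choose j) = (of_nat (y n choose j) :: 'c)" if "m \<ge> n" for m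
      using padic_int_mod[OF assms(1) that] padic_int_mod[OF assms(1) order_refl, of n]
      by (intro binomial_stable[OF j]) simp
    then show "\<forall>\<^sub>F m in sequentially. of_nat (y m choose j) = (of_nat (y n choose j) :: 'c)"
      unfolding eventually_sequentially by blast
  qed
  define f where "f = (\<lambda>j. padic_binom y j * (u - 1) ^ j)"
  have "\<exists>s. f sums s"
  proof (rule summable_if_terms_tendsto_0, rule tendsto_sandwich[OF _ _ tendsto_const])
    show "(\<lambda>n. abs_inf (u - 1) ^ n) \<longlonglongrightarrow> 0"
      using assms(2) by (intro LIMSEQ_realpow_zero) (auto simp: one_unit_def)
    show "\<forall>\<^sub>F j in sequentially. abs_inf (f j) \<le> abs_inf (u - 1) ^ j"
    proof (rule always_eventually, rule allI)
      fix j
      have "f j = of_nat (y j choose j) * (u - 1) ^ j"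
        unfolding f_def using binom[of j j] power_gt_expt[of ?p j] p2 by simp
      then show "abs_inf (f j) \<le> abs_inf (u - 1) ^ j"
        using abs_of_nat_le[of "y j choose j"] by (simp add: abs_mult abs_power mult_left_le_one_le)
    qed
  qed simp
  then obtain s where s: "f sums s" by blast
  have "unit_powp u y = s" unfolding unit_powp_def using sums_unique[OF s] by (simp add: f_def)
  moreover have "(\<lambda>n. u ^ y n) \<longlonglongrightarrow> s"
  proof -
    have "strict_mono (\<lambda>n. ?p ^ n)" using p2 by (simp add: strict_mono_def)
    then have "((\<lambda>n. \<Sum>j<n. f j) \<circ> (\<lambda>n. ?p ^ n)) \<longlonglongrightarrow> s"
      using s unfolding sums_def by (intro LIMSEQ_subseq_LIMSEQ)
    moreover have "(\<Sum>j<?p ^ n. f j) = u ^ y n" for n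
    proof -
      have "(\<Sum>j<?p ^ n. f j) = (\<Sum>j<?p ^ n. of_nat (y n choose j) * (u - 1) ^ j)"
        by (intro sum.cong) (auto simp: f_def binom)
      also have "\<dots> = (\<Sum>j\<le>y n. of_nat (y n choose j) * (u - 1) ^ j)"
      proof (rule sum.mono_neutral_right)
        have "y n < ?p ^ n" using assms(1) by (simp add: padic_int_def)
        then show "{..y n} \<subseteq> {..<?p ^ n}" by (simp add: subset_iff)
      qed (auto simp: binomial_eq_0)
      also have "\<dots> = ((u - 1) + 1) ^ y n" by (subst binomial_ring) simp
      finally show ?thesis by simp
    qed
    ultimately show ?thesis by (simp add: o_def)
  qed
  ultimately show ?thesis by simp
qed

lemma unit_powp_mult:
  assumes "padic_int CHAR('c) y" "one_unit u" "one_unit v"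
  shows "unit_powp (u * v) y = unit_powp u y * unit_powp v y"
proof (rule LIMSEQ_unique)
  show "(\<lambda>n. (u * v) ^ y n) \<longlonglongrightarrow> unit_powp (u * v) y"
    using assms by (intro unit_powp_tendsto one_unit_mult)
  show "(\<lambda>n. (u * v) ^ y n) \<longlonglongrightarrow> unit_powp u y * unit_powp v y"
    unfolding power_mult_distrib using assms by (intro tendsto_mult_abs unit_powp_tendsto)
qed

lemma unit_powp_power:
  assumes "padic_int CHAR('c) y" "one_unit u"
  shows "unit_powp (u ^ d) y = unit_powp u y ^ d"
proof (rule LIMSEQ_unique)
  show "(\<lambda>n. (u ^ d) ^ y n) \<longlonglongrightarrow> unit_powp (u ^ d) y"
    using assms by (intro unit_powp_tendsto one_unit_power)
  have "(\<lambda>n. (u ^ y n) ^ d) \<longlonglongrightarrow> unit_powp u y ^ d"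
    using assms by (intro tendsto_power_abs unit_powp_tendsto)
  then show "(\<lambda>n. (u ^ d) ^ y n) \<longlonglongrightarrow> unit_powp u y ^ d"
    by (simp add: power_mult[symmetric] mult.commute)
qed

lemma unit_powp_nonzero:
  assumes "padic_int CHAR('c) y" "one_unit u"
  shows "unit_powp u y \<noteq> 0"
proof -
  have "(\<lambda>n. abs_inf (u ^ y n)) \<longlonglongrightarrow> abs_inf (unit_powp u y)"
    using assms by (intro tendsto_dist unit_powp_tendsto tendsto_const)
  moreover have "abs_inf (u ^ y n) = 1" for n using one_unit_abs[OF one_unit_power[OF assms(2)]] .
  ultimately have "abs_inf (unit_powp u y) = 1" by (simp add: LIMSEQ_const_iff)
  then show ?thesis by auto
qed

text \<open>\<open>K\<close> is complete and contains the powers with integral exponents.\<close>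
lemma unit_powp_K:
  assumes "padic_int CHAR('c) y" "one_unit u" "u \<in> K"
  shows "unit_powp u y \<in> K"
  by (rule closed_K[OF _ unit_powp_tendsto[OF assms(1,2)]]) (use assms(3) in auto)

lemma padic_int_uminus:
  assumes "padic_int p y" "p > 0"
  shows "padic_int p (padic_uminus p y)"
  unfolding padic_int_def
proof (intro allI conjI)
  fix n
  show "padic_uminus p y n < p ^ n" using assms(2) by (simp add: padic_uminus_def)
  have y: "y n < p ^ n" "y (Suc n) < p ^ Suc n" "y (Suc n) mod p ^ n = y n"
    using assms(1) by (auto simp: padic_int_def simp del: power_Suc)
  have "padic_uminus p y (Suc n) mod p ^ n = (p ^ Suc n - y (Suc n)) mod p ^ n"
    unfolding padic_uminus_def by (rule mod_mod_cancel) simp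
  also have "\<dots> = (p ^ n - y n) mod p ^ n"
  proof -
    have "int ((p ^ Suc n - y (Suc n)) mod p ^ n) = (int p ^ Suc n - int (y (Suc n))) mod int p ^ n"
      using y(2) by (simp add: zmod_int of_nat_diff)
    also have "\<dots> = (int p ^ n - int (y (Suc n)) mod int p ^ n) mod int p ^ n"
      using mod_mult_self2[of "- int (y (Suc n))" "int p ^ n" "int p"]
        mod_mult_self2[of "- (int (y (Suc n)) mod int p ^ n)" "int p ^ n" 1]
      by (simp add: mod_minus_eq mult.commute)
    also have "int (y (Suc n)) mod int p ^ n = int (y n)" using y(3) by (metis of_nat_mod of_nat_power)
    also have "(int p ^ n - int (y n)) mod int p ^ n = int ((p ^ n - y n) mod p ^ n)"
      using y(1) by (simp add: zmod_int of_nat_diff)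
    finally show ?thesis by simp
  qed
  finally show "padic_uminus p y (Suc n) mod p ^ n = padic_uminus p y n"
    by (simp add: padic_uminus_def)
qed

section \<open>Comparing two exponentiations of ideals\<close>

text \<open>
  The quotient of two uniformizers is congruent to a constant, and the nonzero constants are annihilated by the
  exponent \<open>q - 1\<close>.
\<close>
lemma uniformizer_ratio:
  assumes "positive_uniformizer Fr k sg\<^sub>1 \<pi>\<^sub>1" "positive_uniformizer Fr k sg\<^sub>2 \<pi>\<^sub>2"
  shows "(\<pi>\<^sub>1 / \<pi>\<^sub>2) ^ (q - 1) \<in> K" "one_unit ((\<pi>\<^sub>1 / \<pi>\<^sub>2) ^ (q - 1))"
proof -
  have pi: "\<pi>\<^sub>1 \<in> K" "\<pi>\<^sub>2 \<in> K" "\<pi>\<^sub>1 \<noteq> 0" "\<pi>\<^sub>2 \<noteq> 0" "abs_inf \<pi>\<^sub>1 = abs_inf \<pi>\<^sub>2"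
    using assms abs_v_inf[of \<pi>\<^sub>1] abs_v_inf[of \<pi>\<^sub>2] by (auto simp: positive_uniformizer_def positive_def)
  define x where "x = \<pi>\<^sub>1 / \<pi>\<^sub>2"
  have x: "x \<in> K" "abs_inf x = 1" using pi by (auto simp: x_def abs_divide)
  then obtain c where c: "c \<in> C" "abs_inf (x - c) < 1" using residue[of x] by auto
  have c0: "c \<noteq> 0" using c(2) x(2) by auto
  have "x / c - 1 = (x - c) / c" using c0 by (simp add: field_simps)
  then have "one_unit (x / c)" using c(2) abs_C[OF c(1) c0] by (simp add: one_unit_def abs_divide)
  then have "one_unit ((x / c) ^ (q - 1))" by (rule one_unit_power)
  moreover have "(x / c) ^ (q - 1) = x ^ (q - 1)"
    using finite_subfield_power_card[OF subfield_C finite_C c(1) c0] by (simp add: power_divide)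
  ultimately show "one_unit ((\<pi>\<^sub>1 / \<pi>\<^sub>2) ^ (q - 1))" by (simp add: x_def)
  show "(\<pi>\<^sub>1 / \<pi>\<^sub>2) ^ (q - 1) \<in> K" using x(1) by (auto simp: x_def)
qed

lemma positive_power:
  assumes "sign_function Fr k sg" "x \<in> K" "x \<noteq> 0"
  shows "positive k sg (x ^ (q - 1))"
proof -
  have hom: "sg \<in> hom (mult_of (ring_on K)) (mult_of (ring_on C))" "\<And>c. c \<in> C - {0} \<Longrightarrow> sg c = c"
    using assms(1) by (auto simp: sign_function_def)
  have mult: "sg (u * v) = sg u * sg v" if "u \<in> K - {0}" "v \<in> K - {0}" for u v
    using hom_mult[OF hom(1), of u v] that by (simp add: mult_of_def)
  have sgC: "sg x \<in> C - {0}"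
    using hom_carrier[OF hom(1)] assms(2,3) by (auto simp: mult_of_def)
  have "sg (x ^ n) = sg x ^ n" for n
  proof (induction n)
    case (Suc n)
    have "sg (x * x ^ n) = sg x * sg (x ^ n)" using assms(2,3) by (intro mult) auto
    then show ?case using Suc by simp
  qed (use hom(2)[of 1] in simp)
  then have "sg (x ^ (q - 1)) = 1"
    using finite_subfield_power_card[OF subfield_C finite_C, of "sg x"] sgC by simp
  then show ?thesis using assms(2,3) by (auto simp: positive_def)
qed

end

context affine_curve
begin

text \<open>A generator \<open>\<alpha>\<close> of \<open>p\<^sup>n\<close> need not be positive, but \<open>\<alpha>\<^bsup>q-1\<^esup>\<close> always is. This determines the bracket of \<open>p\<^bsup>n(q-1)\<^esup>\<close>.\<close>
lemma bracket_prime_power: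
  assumes "sign_function Fr k sg" "positive_uniformizer Fr k sg \<pi>" "ideal_bracket Fr k sg \<pi> br"
    and p: "nonzero_ideal p"
    and \<alpha>: "n > 0" "\<alpha> \<in> A" "\<alpha> \<noteq> 0" "A.ideal_pow p n = (*) \<alpha> ` A" "abs_inf \<alpha> = real q ^ s"
  shows "one_unit (br p)" "br p ^ (n * (q - 1)) = \<alpha> ^ (q - 1) * \<pi> ^ (s * (q - 1))"
    "br (A.ideal_pow p f) = br p ^ f"
proof -
  have hom: "br \<in> hom (frac_ideals A) one_units"
    and val: "\<And>\<alpha>. \<alpha> \<in> k \<Longrightarrow> positive k sg \<alpha> \<Longrightarrow> br ((*) \<alpha> ` A) = one_unit_part Fr k \<pi> \<alpha>"
    using assms(3) by (auto simp: ideal_bracket_def)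
  show "one_unit (br p)"
    using hom_carrier[OF hom] frac_ideal_nonzero_ideal[OF p]
    by (auto simp: one_units_def one_unit_def image_subset_iff simp flip: dist_abs)
  have "positive k sg (1 ^ (q - 1))" by (rule positive_power[OF assms(1)]) auto
  then have "br ((*) 1 ` A) = one_unit_part Fr k \<pi> 1" by (intro val) auto
  moreover have "v_inf Fr k 1 = 0" by (rule v_inf_eqI) simp
  ultimately have br_A: "br A = 1" by (simp add: one_unit_part_def)
  have pw: "br (A.ideal_pow p f) = br p ^ f" for f
  proof (induction f)
    case (Suc f)
    have "br (A.ideal_pow p f \<otimes>\<^bsub>frac_ideals A\<^esub> p) = br (A.ideal_pow p f) \<otimes>\<^bsub>one_units\<^esub> br p"
      using hom_mult[OF hom] frac_ideal_nonzero_ideal nonzero_ideal_pow[OF p] p by blast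
    then show ?case using Suc by (simp add: one_units_def mult.commute)
  qed (simp add: br_A)
  then show "br (A.ideal_pow p f) = br p ^ f" .
  define \<beta> where "\<beta> = \<alpha> ^ (q - 1)"
  have "A.ideal_pow p (n * (q - 1)) = (*) \<beta> ` A"
    unfolding A.ideal_pow_mult[OF nonzero_idealD(1)[OF p]] \<alpha>(4) A.ideal_pow_principal \<beta>_def ..
  then have "br p ^ (n * (q - 1)) = br ((*) \<beta> ` A)" by (simp flip: pw)
  also have "\<dots> = \<beta> / \<pi> powi v_inf Fr k \<beta>"
    using val[of \<beta>] positive_power[OF assms(1), of \<alpha>] \<alpha>(2,3) A_k A_K
    by (auto simp: one_unit_part_def \<beta>_def)
  also have "v_inf Fr k \<beta> = - int (s * (q - 1))"
    by (rule v_inf_eqI) (simp only: \<beta>_def abs_power \<alpha>(5) minus_minus power_int_of_nat power_mult)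
  also have "\<beta> / \<pi> powi (- int (s * (q - 1))) = \<beta> * \<pi> ^ (s * (q - 1))"
    unfolding power_int_minus power_int_of_nat by (simp add: divide_inverse)
  finally show "br p ^ (n * (q - 1)) = \<alpha> ^ (q - 1) * \<pi> ^ (s * (q - 1))" by (simp add: \<beta>_def)
qed

text \<open>
  Computing \<open>\<bar>\<alpha>\<bar>\<close> in two ways gives \<open>d n = D s\<close>, where \<open>d\<close> is the degree of \<open>p\<close> and \<open>q\<^sup>s = \<bar>\<alpha>\<bar>\<close>. With it the quotient of the
  formulas for the two brackets becomes an equality of \<open>n(q-1)\<close>-th powers of one-units.
\<close>
lemma brackets_differ_by_degree:
  assumes 1: "sign_function Fr k sg\<^sub>1" "positive_uniformizer Fr k sg\<^sub>1 \<pi>\<^sub>1" "ideal_bracket Fr k sg\<^sub>1 \<pi>\<^sub>1 br\<^sub>1"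
    and 2: "sign_function Fr k sg\<^sub>2" "positive_uniformizer Fr k sg\<^sub>2 \<pi>\<^sub>2" "ideal_bracket Fr k sg\<^sub>2 \<pi>\<^sub>2 br\<^sub>2"
    and p: "nonzero_ideal p" "1 \<notin> p" "\<And>x y. x \<in> A \<Longrightarrow> y \<in> A \<Longrightarrow> x * y \<in> p \<Longrightarrow> x \<in> p \<or> y \<in> p"
    and D: "q = card Fr ^ D"
    and \<kappa>: "one_unit \<kappa>" "\<kappa> ^ (D * (q - 1)) = (\<pi>\<^sub>1 / \<pi>\<^sub>2) ^ (q - 1)"
  shows "br\<^sub>1 (A.ideal_pow p f) = \<kappa> ^ ideal_deg Fr k (A.ideal_pow p f) * br\<^sub>2 (A.ideal_pow p f)"
    "one_unit (br\<^sub>2 (A.ideal_pow p f))"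
proof -
  obtain d n \<alpha> where n: "n > 0" "\<alpha> \<in> A" "\<alpha> \<noteq> 0" "A.ideal_pow p n = (*) \<alpha> ` A"
    and abs_\<alpha>: "abs_inf \<alpha> = real (card Fr) ^ (d * n)"
    and deg: "\<And>f. ideal_deg Fr k (A.ideal_pow p f) = d * f"
    using prime_ideal_powers[OF p] by blast
  obtain s where s: "abs_inf \<alpha> = real q ^ s" using abs_A[OF n(2,3)] by blast
  note r = card_Fr_ge_2
  have "real (card Fr) ^ (d * n) = real (card Fr) ^ (D * s)"
    using abs_\<alpha> s by (simp add: D power_mult)
  then have Ds: "d * n = D * s" using r by simp
  note b1 = bracket_prime_power[OF 1 p(1) n s] and b2 = bracket_prime_power[OF 2 p(1) n s]
  have \<pi>2: "\<pi>\<^sub>2 \<noteq> 0" using 2(2) by (auto simp: positive_uniformizer_def positive_def)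
  have "br\<^sub>1 p ^ (n * (q - 1)) = ((\<pi>\<^sub>1 / \<pi>\<^sub>2) ^ (q - 1)) ^ s * br\<^sub>2 p ^ (n * (q - 1))"
    unfolding b1(2) b2(2) using \<pi>2 by (simp add: power_divide mult.commute[of s] power_mult)
  also have "((\<pi>\<^sub>1 / \<pi>\<^sub>2) ^ (q - 1)) ^ s = \<kappa> ^ (D * s * (q - 1))"
    unfolding \<kappa>(2)[symmetric] power_mult[symmetric] by (simp add: mult_ac)
  also have "\<dots> = (\<kappa> ^ d) ^ (n * (q - 1))"
    unfolding Ds[symmetric] power_mult[symmetric] by (simp add: mult_ac)
  finally have eq: "br\<^sub>1 p ^ (n * (q - 1)) = (\<kappa> ^ d * br\<^sub>2 p) ^ (n * (q - 1))" by (simp add: power_mult_distrib)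
  have unit2: "one_unit (\<kappa> ^ d * br\<^sub>2 p)" using \<kappa>(1) b2(1) by (intro one_unit_mult one_unit_power)
  have "br\<^sub>1 p / (\<kappa> ^ d * br\<^sub>2 p) = 1"
  proof (rule one_unit_torsion_free)
    show "one_unit (br\<^sub>1 p / (\<kappa> ^ d * br\<^sub>2 p))" using b1(1) unit2 by (rule one_unit_divide)
    show "n * (q - 1) > 0" using n(1) q_ge_2 by simp
    show "(br\<^sub>1 p / (\<kappa> ^ d * br\<^sub>2 p)) ^ (n * (q - 1)) = 1"
      using eq one_unit_nonzero[OF unit2] by (simp only: power_divide) simp
  qed
  then have "br\<^sub>1 p = \<kappa> ^ d * br\<^sub>2 p" using one_unit_nonzero[OF unit2] by simp
  then show "br\<^sub>1 (A.ideal_pow p f) = \<kappa> ^ ideal_deg Fr k (A.ideal_pow p f) * br\<^sub>2 (A.ideal_pow p f)"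
    by (simp add: b1(3) b2(3) deg power_mult_distrib power_mult)
  show "one_unit (br\<^sub>2 (A.ideal_pow p f))" unfolding b2(3) by (intro one_unit_power b2(1))
qed

end

section \<open>Primes of the scalar extension\<close>

context scalar_extension
begin

abbreviation OF where "OF \<equiv> integers_of Fr k \<theta> F"

lemma \<theta>_hom: "x \<in> k \<Longrightarrow> y \<in> k \<Longrightarrow> \<theta> (x + y) = \<theta> x + \<theta> y"
  "x \<in> k \<Longrightarrow> y \<in> k \<Longrightarrow> \<theta> (x * y) = \<theta> x * \<theta> y" "\<theta> 1 = 1"
  using scalars by (auto simp: Ring.ring_hom_def)

lemma \<theta>_0: "\<theta> 0 = 0"
  using \<theta>_hom(1)[of 0 0] by (metis add_0 add_cancel_right_right k.zero_in)

lemma \<theta>_diff: "x \<in> k \<Longrightarrow> y \<in> k \<Longrightarrow> \<theta> (x - y) = \<theta> x - \<theta> y"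
  using \<theta>_hom(1)[OF k.diff_in, of x y y] by (simp add: eq_diff_eq)

lemma subring_\<theta>_A: "subring (\<theta> ` A) RT"
  unfolding subring_iff
proof (intro conjI ballI)
  show "1 \<in> \<theta> ` A" by (rule image_eqI[of _ _ 1]) (auto simp: \<theta>_hom)
  fix x y assume "x \<in> \<theta> ` A" "y \<in> \<theta> ` A"
  then obtain u v where uv: "u \<in> A" "v \<in> A" "x = \<theta> u" "y = \<theta> v" by blast
  have "x - y = \<theta> (u - v)" "x * y = \<theta> (u * v)" using uv A_k by (auto simp: \<theta>_diff \<theta>_hom subset_iff)
  then show "x - y \<in> \<theta> ` A" "x * y \<in> \<theta> ` A" using uv by auto
qed

sublocale \<theta>A: subring_of_type "\<theta> ` A" by (rule subring_of_type.intro) (rule subring_\<theta>_A)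

lemma \<theta>_A_OF: "\<theta> ` A \<subseteq> OF"
proof
  fix x assume x: "x \<in> \<theta> ` A"
  then have "x \<in> F" using finite_ext A_k by (auto simp: finite_ext_def)
  moreover have "integral_over (\<theta> ` A) x"
    unfolding \<theta>A.integral_over_iff
    by (intro bexI[of _ "[:- x, 1:]"]) (use x in auto)
  ultimately show "x \<in> OF" by (simp add: integers_of_def)
qed

text \<open>A nonzero element of \<open>P\<close> is integral over \<open>\<theta>(A)\<close>; the constant coefficient of its integral equation lies in \<open>P\<close>.\<close>
lemma prime_below_prime:
  assumes P: "P \<in> primes_of Fr k \<theta> F"
  defines "p \<equiv> prime_below Fr k \<theta> P"
  shows "submodule_of A p" "p \<subseteq> A" "1 \<notin> p" "\<exists>b\<in>p. b \<noteq> 0"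
    "\<And>x y. x \<in> A \<Longrightarrow> y \<in> A \<Longrightarrow> x * y \<in> p \<Longrightarrow> x \<in> p \<or> y \<in> p"
proof -
  interpret P: primeideal P "ring_on OF" using P by (simp add: nonzero_primes_def)
  have P0: "P \<noteq> {0}" using P by (simp add: nonzero_primes_def)
  have P_mult: "x * y \<in> P" if "x \<in> OF" "y \<in> P" for x y using P.I_l_closed[of y x] that by simp
  have P_add: "x + y \<in> P" if "x \<in> P" "y \<in> P" for x y 
    using additive_subgroup.a_closed[OF P.additive_subgroup_axioms, of x y] that by simp
  have P_0: "0 \<in> P" using additive_subgroup.zero_closed[OF P.additive_subgroup_axioms] by simp
  have P_OF: "x \<in> OF" if "x \<in> P" for x using P.Icarr[of x] that by simp
  have P_prime: "x \<in> P \<or> y \<in> P" if "x \<in> OF" "y \<in> OF" "x * y \<in> P" for x y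
    using P.I_prime[of x y] that by simp
  have OF_1: "1 \<in> OF" using \<theta>_A_OF \<theta>A.one_in by blast
  have OF_mult: "x * y \<in> OF" if "x \<in> OF" "y \<in> OF" for x y using P.m_closed[of x y] that by simp
  have P_1: "1 \<notin> P"
  proof
    assume "1 \<in> P"
    then have "x \<in> P" if "x \<in> OF" for x using P_mult[OF that, of 1] by simp
    then have "carrier (ring_on OF) = P" using P_OF by auto
    then show False using P.I_notcarr by simp
  qed
  have mem: "x \<in> p \<longleftrightarrow> x \<in> A \<and> \<theta> x \<in> P" for x by (simp add: p_def prime_below_def)
  have \<theta>_mult: "\<theta> (x * y) = \<theta> x * \<theta> y" if "x \<in> A" "y \<in> A" for x y
    using \<theta>_hom(2)[of x y] A_k that by blast
  have \<theta>_add: "\<theta> (x + y) = \<theta> x + \<theta> y" if "x \<in> A" "y \<in> A" for x y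
    using \<theta>_hom(1)[of x y] A_k that by blast
  show "p \<subseteq> A" by (auto simp: mem)
  show "1 \<notin> p" using P_1 by (simp add: mem \<theta>_hom)
  show "submodule_of A p"
    unfolding submodule_of_def
    using P_0 P_add P_mult \<theta>_A_OF by (auto simp: mem \<theta>_0 \<theta>_add \<theta>_mult)
  show "x \<in> p \<or> y \<in> p" if "x \<in> A" "y \<in> A" "x * y \<in> p" for x y
    using P_prime[of "\<theta> x" "\<theta> y"] that \<theta>_A_OF by (auto simp: mem \<theta>_mult)
  obtain x where x: "x \<in> P" "x \<noteq> 0" using P0 P_0 by blast
  have "integral_over (\<theta> ` A) x" using P_OF[OF x(1)] by (simp add: integers_of_def)
  then obtain g where "g \<in> polys (\<theta> ` A)" "lead_coeff g = 1" "poly g x = 0"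
    unfolding \<theta>A.integral_over_iff by blast
  \<comment> \<open>after division by a power of the variable, the constant coefficient is a nonzero element of \<open>P\<close>\<close>
  then have "\<exists>g\<in>polys (\<theta> ` A). coeff g 0 \<noteq> 0 \<and> poly g x = 0"
  proof (induction "degree g" arbitrary: g rule: less_induct)
    case less
    show ?case
    proof (cases "coeff g 0 = 0")
      case True
      obtain c h where h: "g = pCons c h" by (cases g)
      then have g: "g = pCons 0 h" using True by simp
      have h0: "h \<noteq> 0" using less.prems(2) g by auto
      have "degree h < degree g" using g h0 by simp
      moreover have "h \<in> polys (\<theta> ` A)" using less.prems(1) unfolding g by (rule polys_pConsD)
      moreover have "lead_coeff h = 1" using less.prems(2) g h0 by simp
      moreover have "poly h x = 0" using less.prems(3) g x(2) by simp
      ultimately show ?thesis by (rule less.hyps)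
    qed (use less.prems in blast)
  qed
  then obtain g where g: "g \<in> polys (\<theta> ` A)" "coeff g 0 \<noteq> 0" "poly g x = 0" by blast
  obtain c h where h: "g = pCons c h" by (cases g)
  have h_OF: "poly h x \<in> OF" if "h \<in> polys (\<theta> ` A)" for h
    using that
  proof (induction h)
    case 0
    then show ?case using \<theta>_A_OF \<theta>A.zero_in by auto
  next
    case (pCons c h)
    then have "c \<in> OF" "x * poly h x \<in> OF" 
      using polys_pConsD[OF pCons.prems] \<theta>_A_OF pCons.IH OF_mult P_OF[OF x(1)] by auto
    then show ?case using P.add.m_closed[of c "x * poly h x"] by simp
  qed
  have cA: "c \<in> \<theta> ` A" and hA: "h \<in> polys (\<theta> ` A)" using polys_pConsD g(1) unfolding h by blast+
  have "c = - (x * poly h x)" using g(3) by (simp add: h eq_neg_iff_add_eq_0)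
  also have "\<dots> = (- 1 * poly h x) * x" by simp
  also have "\<dots> \<in> P"
  proof -
    have "- 1 \<in> OF" using \<theta>_A_OF \<theta>A.uminus_in[OF \<theta>A.one_in] by blast
    then show ?thesis using P_mult[OF OF_mult[OF _ h_OF[OF hA]] x(1)] by blast
  qed
  finally have "c \<in> P" .
  moreover obtain b where "b \<in> A" "c = \<theta> b" using cA by blast
  ultimately show "\<exists>b\<in>p. b \<noteq> 0" using g(2) by (intro bexI[of _ b]) (auto simp: mem h \<theta>_0)
qed

section \<open>The zeroes of the L-series\<close>

text \<open>
  A nonzero element of the prime below is not constant, since it is not a unit of \<open>A\<close>; it serves as the coordinate
  on the affine curve.
\<close>
lemma ideal_norm_brackets:
  assumes 1: "sign_function Fr k sg\<^sub>1" "positive_uniformizer Fr k sg\<^sub>1 \<pi>\<^sub>1" "ideal_bracket Fr k sg\<^sub>1 \<pi>\<^sub>1 br\<^sub>1"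
    and 2: "sign_function Fr k sg\<^sub>2" "positive_uniformizer Fr k sg\<^sub>2 \<pi>\<^sub>2" "ideal_bracket Fr k sg\<^sub>2 \<pi>\<^sub>2 br\<^sub>2"
    and D: "q = card Fr ^ D"
    and \<kappa>: "one_unit \<kappa>" "\<kappa> ^ (D * (q - 1)) = (\<pi>\<^sub>1 / \<pi>\<^sub>2) ^ (q - 1)"
    and P: "P \<in> primes_of Fr k \<theta> F"
  defines "N \<equiv> ideal_norm Fr k \<theta> F P"
  shows "br\<^sub>1 N = \<kappa> ^ ideal_deg Fr k N * br\<^sub>2 N" "one_unit (br\<^sub>2 N)"
proof -
  let ?p = "prime_below Fr k \<theta> P"
  note p = prime_below_prime[OF P]
  obtain b where b: "b \<in> ?p" "b \<noteq> 0" using p(4) by blast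
  have "b \<notin> Fr"
  proof
    assume "b \<in> Fr"
    then have "inverse b \<in> A" using Fr_A by auto
    then have "inverse b * b \<in> ?p" using p(1) b(1) by (auto simp: submodule_of_def)
    then show False using p(3) b(2) by simp
  qed
  then interpret affine_curve Fr k b
    using b(1) p(2) by unfold_locales auto
  have "nonzero_ideal ?p" unfolding nonzero_ideal_def using p(1,2) b by auto
  note * = brackets_differ_by_degree[OF 1 2 this p(3,5) D \<kappa>, of "residue_degree Fr k \<theta> F P"]
  show "br\<^sub>1 N = \<kappa> ^ ideal_deg Fr k N * br\<^sub>2 N"
    unfolding N_def ideal_norm_def by (rule *(1))
  show "one_unit (br\<^sub>2 N)"
    unfolding N_def ideal_norm_def by (rule *(2))
qed

end

text \<open>If the constant coefficient of \<open>f\<close> vanishes, both inverses are 0 by convention.\<close>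
lemma fps_compose_scale_inverse:
  "inverse (f oo (fps_const \<mu> * fps_X)) = inverse f oo (fps_const (\<mu> :: 'a::field) * fps_X)"
proof (cases "fps_nth f 0 = 0")
  case True
  then show ?thesis by (simp add: fps_inverse_eq_0 fps_compose_linear fps_eq_iff)
next
  case False
  then show ?thesis by (intro fps_inverse_compose[symmetric]) simp
qed

context scalar_extension
begin

text \<open>
  The factor \<open>\<mu>\<^bsup>deg N\<^esup>\<close> amounts to replacing the variable \<open>x\<^sup>-\<^sup>1\<close> by \<open>\<mu>x\<^sup>-\<^sup>1\<close> in each Euler factor, and so in the
  product.
\<close>
lemma zeroes_scaled:
  assumes \<mu>: "\<mu> \<noteq> 0"
    and br: "\<And>P. P \<in> primes_of Fr k \<theta> F \<Longrightarrow>
      unit_powp (br\<^sub>1 (ideal_norm Fr k \<theta> F P)) (padic_uminus CHAR('c) y) =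
      \<mu> ^ ideal_deg Fr k (ideal_norm Fr k \<theta> F P) * unit_powp (br\<^sub>2 (ideal_norm Fr k \<theta> F P)) (padic_uminus CHAR('c) y)"
  shows "zeroes (L_fps Fr k \<theta> F S Pol br\<^sub>1 y) = (*) \<mu> ` zeroes (L_fps Fr k \<theta> F S Pol br\<^sub>2 y)"
proof -
  let ?s = "fps_const \<mu> * fps_X"
  let ?L1 = "L_fps Fr k \<theta> F S Pol br\<^sub>1 y" and ?L2 = "L_fps Fr k \<theta> F S Pol br\<^sub>2 y"
  have euler: "euler_factor Fr k \<theta> F Pol br\<^sub>1 y P = euler_factor Fr k \<theta> F Pol br\<^sub>2 y P oo ?s"
    if P: "P \<in> primes_of Fr k \<theta> F" for P
  proof -
    define d where "d = ideal_deg Fr k (ideal_norm Fr k \<theta> F P)"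
    define c where "c = unit_powp (br\<^sub>2 (ideal_norm Fr k \<theta> F P)) (padic_uminus CHAR('c) y)"
    have "pcompose (monom c d) [:0, \<mu>:] = monom (\<mu> ^ d * c) d"
      by (induction d) (simp_all add: monom_0 monom_Suc pcompose_pCons smult_monom mult_ac)
    then have "pcompose (Pol P) (monom (\<mu> ^ d * c) d) = pcompose (pcompose (Pol P) (monom c d)) [:0, \<mu>:]"
      by (simp flip: pcompose_assoc)
    moreover have "fps_of_poly [:0, \<mu>:] = ?s" by (simp add: fps_of_poly_pCons)
    ultimately have "fps_of_poly (pcompose (Pol P) (monom (\<mu> ^ d * c) d)) =
        fps_of_poly (pcompose (Pol P) (monom c d)) oo ?s"
      by (metis fps_of_poly_pcompose coeff_pCons_0)
    then show ?thesis
      unfolding euler_factor_def br[OF P] by (simp add: d_def c_def fps_compose_scale_inverse)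
  qed
  have coeff: "fps_nth ?L1 j = \<mu> ^ j * fps_nth ?L2 j" for j
  proof -
    let ?P = "{P \<in> primes_of Fr k \<theta> F - S. ideal_deg Fr k (ideal_norm Fr k \<theta> F P) \<le> j}"
    have "(\<Prod>P\<in>?P. euler_factor Fr k \<theta> F Pol br\<^sub>1 y P) = (\<Prod>P\<in>?P. euler_factor Fr k \<theta> F Pol br\<^sub>2 y P) oo ?s"
      by (subst fps_compose_prod_distrib) (auto intro!: prod.cong euler)
    then show ?thesis by (simp add: L_fps_def fps_compose_linear)
  qed
  have zero: "\<mu> * x \<in> zeroes ?L1 \<longleftrightarrow> x \<in> zeroes ?L2" for x
  proof -
    have "fps_nth ?L1 j * inverse (\<mu> * x) ^ j = fps_nth ?L2 j * inverse x ^ j" for j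
      using \<mu> by (simp add: coeff power_mult_distrib field_simps)
    then show ?thesis using \<mu> by (simp add: zeroes_def)
  qed
  show ?thesis
  proof (intro subset_antisym subsetI)
    fix x assume "x \<in> zeroes ?L1"
    then show "x \<in> (*) \<mu> ` zeroes ?L2"
      using zero[of "x / \<mu>"] \<mu> by (intro image_eqI[of _ _ "x / \<mu>"]) auto
  qed (use zero in auto)
qed

end

context infinite_place
begin

text \<open>
  The elements whose \<open>p\<^sup>t\<close>-th power lies in the second field form a field containing the generators of the first. Those among
  them that are separable over \<open>K\<close> already lie in the second field.
\<close>
lemma max_separable_subfield_purely_inseparable:
  assumes "\<mu> ^ (CHAR('c) ^ t) \<in> K" "Z\<^sub>1 = (*) \<mu> ` Z\<^sub>2"
  shows "max_separable_subfield K (generate_field RT (K \<union> Z\<^sub>1)) \<subseteq>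
    max_separable_subfield K (generate_field RT (K \<union> Z\<^sub>2))"
proof -
  let ?E1 = "generate_field RT (K \<union> Z\<^sub>1)" and ?E2 = "generate_field RT (K \<union> Z\<^sub>2)"
  let ?Q = "CHAR('c) ^ t"
  interpret E2: subfield_of_type ?E2 by (rule subfield_of_type.intro) (rule generate_field_subfield)
  have K_E2: "K \<subseteq> ?E2" and Z_E2: "Z\<^sub>2 \<subseteq> ?E2" by (auto intro: generate_field.incl)
  have "?E1 \<subseteq> {x. x ^ ?Q \<in> ?E2}"
  proof (rule generate_field_minimal)
    show "subfield {x. x ^ ?Q \<in> ?E2} RT"
      unfolding subfield_iff subring_iff
      by (auto simp: frobenius_diff power_mult_distrib power_inverse)
    show "K \<union> Z\<^sub>1 \<subseteq> {x. x ^ ?Q \<in> ?E2}"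
      unfolding assms(2)
    proof (intro Un_least subsetI)
      fix x assume "x \<in> K"
      then show "x \<in> {x. x ^ ?Q \<in> ?E2}" using K_E2 by blast
    next
      fix x assume "x \<in> (*) \<mu> ` Z\<^sub>2"
      then obtain z where "x = \<mu> * z" "z \<in> Z\<^sub>2" by blast
      moreover from this have "\<mu> ^ ?Q * z ^ ?Q \<in> ?E2"
        by (intro E2.mult_in subsetD[OF K_E2 assms(1)] E2.power_in subsetD[OF Z_E2])
      ultimately show "x \<in> {x. x ^ ?Q \<in> ?E2}" by (simp add: power_mult_distrib)
    qed
  qed
  moreover have "x \<in> ?E2" if "x ^ ?Q \<in> ?E2" "separable_over K x" for x
  proof (rule separable_and_purely_inseparable_imp_in[OF E2.subfield _ prime_CHAR that(1)])
    show "separable_over ?E2 x" using that(2) K_E2 unfolding separable_over_def by blast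
  qed
  ultimately have "M \<subseteq> ?E2" if "M \<subseteq> ?E1" "\<forall>x\<in>M. separable_over K x" for M
    using that by blast
  then show ?thesis unfolding max_separable_subfield_def by blast
qed

end

theorem theorem1:
  fixes Fr k :: "'c::{alg_closed_field, complete_space} set"
    and \<theta> :: "'c \<Rightarrow> 'f::field" and F :: "'f set"
    and S :: "'f set set" and Pol :: "'f set \<Rightarrow> 'c poly" and y :: "nat \<Rightarrow> nat"
    and sg\<^sub>1 sg\<^sub>2 :: "'c \<Rightarrow> 'c" and \<pi>\<^sub>1 \<pi>\<^sub>2 :: 'c and br\<^sub>1 br\<^sub>2 :: "'c set \<Rightarrow> 'c"
  assumes "scalar_extension Fr k \<theta> F"
    and "arithmetic_interest Fr k \<theta> F S Pol"
    and "padic_int CHAR('c) y"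
    and "sign_function Fr k sg\<^sub>1" and "positive_uniformizer Fr k sg\<^sub>1 \<pi>\<^sub>1"
    and "ideal_bracket Fr k sg\<^sub>1 \<pi>\<^sub>1 br\<^sub>1"
    and "sign_function Fr k sg\<^sub>2" and "positive_uniformizer Fr k sg\<^sub>2 \<pi>\<^sub>2"
    and "ideal_bracket Fr k sg\<^sub>2 \<pi>\<^sub>2 br\<^sub>2"
  shows "max_separable_subfield (field_K k) (zero_field Fr k \<theta> F S Pol br\<^sub>1 y) =
         max_separable_subfield (field_K k) (zero_field Fr k \<theta> F S Pol br\<^sub>2 y)"
proof -
  interpret scalar_extension Fr k \<theta> F by fact
  let ?y = "padic_uminus CHAR('c) y"
  have y: "padic_int CHAR('c) ?y"
    using assms(3) prime_CHAR by (intro padic_int_uminus) (auto simp: prime_gt_0_nat)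
  obtain D where D: "q = card Fr ^ D" using card_C by blast
  have "D > 0" using D q_ge_2 by (cases D) auto
  then have "D * (q - 1) > 0" using q_ge_2 by simp
  then obtain \<kappa> t where \<kappa>: "one_unit \<kappa>" "\<kappa> ^ (D * (q - 1)) = (\<pi>\<^sub>1 / \<pi>\<^sub>2) ^ (q - 1)"
      "\<kappa> ^ (CHAR('c) ^ t) \<in> K"
    using one_unit_root[OF uniformizer_ratio(2,1)[OF assms(5,8)]] by blast
  define \<mu> where "\<mu> = unit_powp \<kappa> ?y"
  have \<mu>0: "\<mu> \<noteq> 0" unfolding \<mu>_def by (rule unit_powp_nonzero[OF y \<kappa>(1)])
  have \<mu>K: "\<mu> ^ (CHAR('c) ^ t) \<in> K"
    unfolding \<mu>_def unit_powp_power[OF y \<kappa>(1), symmetric]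
    by (intro unit_powp_K y one_unit_power \<kappa>)
  have Z: "zeroes (L_fps Fr k \<theta> F S Pol br\<^sub>1 y) = (*) \<mu> ` zeroes (L_fps Fr k \<theta> F S Pol br\<^sub>2 y)"
  proof (rule zeroes_scaled[OF \<mu>0])
    fix P assume P: "P \<in> primes_of Fr k \<theta> F"
    let ?N = "ideal_norm Fr k \<theta> F P"
    note N = ideal_norm_brackets[OF assms(4-9) D \<kappa>(1,2) P]
    show "unit_powp (br\<^sub>1 ?N) ?y = \<mu> ^ ideal_deg Fr k ?N * unit_powp (br\<^sub>2 ?N) ?y"
      unfolding N(1) \<mu>_def using y \<kappa>(1) N(2)
      by (simp add: unit_powp_mult one_unit_power unit_powp_power)
  qed
  then have Z': "zeroes (L_fps Fr k \<theta> F S Pol br\<^sub>2 y) = (*) (inverse \<mu>) ` zeroes (L_fps Fr k \<theta> F S Pol br\<^sub>1 y)"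
    using scale_inverse(1)[OF \<mu>0] by simp
  have "inverse \<mu> ^ (CHAR('c) ^ t) \<in> K" using \<mu>K by (auto simp: power_inverse)
  then show ?thesis
    unfolding zero_field_def
    by (intro subset_antisym max_separable_subfield_purely_inseparable[OF \<mu>K Z]
          max_separable_subfield_purely_inseparable[OF _ Z'])
qed

end
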